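(* Let $N \geq 1$ be an integer. There is a family (sequence, indexed by integers $k \to \infty$) of fully irreducible outer automorphisms $\phi_k \in \mathrm{Out}(\mathbb{F}_N)$ such that $\omega(\phi_k) \to \infty$ and $\omega(\phi_k^{-1}) \to 1$ as $k \to \infty$ if and only if $N \geq 3$.
   Context: $\mathbb{F}_N$ is the free group of rank $N$ and $\mathrm{Out}(\mathbb{F}_N)$ its outer automorphism group. An outer automorphism $\phi$ is irreducible if there is no nontrivial decomposition $\mathbb{F}_N = A_1 * \cdots * A_r * B$ with $r\ge 1$, each $A_i$ a nontrivial proper free factor, such that $\phi$ permutes the conjugacy classes of $A_1,\dots,A_r$. It is fully irreducible if every positive power $\phi^n$, $n \geq 1$, is irreducible (equivalently, no positive power preserves the conjugacy class of a nontrivial proper free factor). The stretch factor $\lambda(\phi)$ of an irreducible $\phi$ is the Perron--Frobenius eigenvalue of the transition matrix of any irreducible train track representative of $\phi$ (Bestvina--Handel). If $f \in \mathbb{Z}[x]$ is a polynomial with roots $\lambda_1, \ldots, \lambda_m$ ordered such that $|\lambda_1| \geq |\lambda_2| \geq \cdots \geq |\lambda_m|$, the spectral ratio of $f$ is $\omega(f) := |\lambda_1/\lambda_2|$ (this requires $m \geq 2$ and $\lambda_2\neq 0$). For an irreducible $\phi \in \mathrm{Out}(\mathbb{F}_N)$, let $\mu_{\lambda(\phi)} \in \mathbb{Z}[x]$ be the minimal polynomial of its stretch factor $\lambda(\phi)$; the spectral ratio of $\phi$ is $\omega(\phi) := \omega(\mu_{\lambda(\phi)})$. When $N=1$ every automorphism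 has finite order and its spectral ratio is not defined, so no such family exists in that case. *)

theory Defs
  imports
    Complex_Main
    "HOL-Algebra.Bij"
    "HOL-Algebra.Coset"
    "HOL-Computational_Algebra.Polynomial_Factorial"
    "Jordan_Normal_Form.Char_Poly"
    "Graph_Theory.Digraph_Component"
begin

section \<open>Reduced words and free groups\<close>

text \<open>
  A letter \<open>(e, True)\<close> stands for a generator (or an edge) \<open>e\<close>,
  and \<open>(e, False)\<close> for its inverse (or the edge traversed backwards).
\<close>

type_synonym letter = "nat \<times> bool"

definition inv_letter :: "letter \<Rightarrow> letter" where
  "inv_letter x = (fst x, \<not> snd x)"

definition inv_word :: "letter list \<Rightarrow> letter list" where
  "inv_word w = rev (map inv_letter w)"

definition reduced_word :: "letter list \<Rightarrow> bool" where
  "reduced_word w \<longleftrightarrow> successively (\<lambda>x y. y \<noteq> inv_letter x) w"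

definition cancel_Cons :: "letter \<Rightarrow> letter list \<Rightarrow> letter list" where
  "cancel_Cons x w = (if w \<noteq> [] \<and> hd w = inv_letter x then tl w else x # w)"

definition reduce_word :: "letter list \<Rightarrow> letter list" where
  "reduce_word w = foldr cancel_Cons w []"

definition free_group :: "nat \<Rightarrow> letter list monoid" where
  "free_group N =
    \<lparr>carrier = {w. reduced_word w \<and> fst ` set w \<subseteq> {..<N}},
     monoid.mult = (\<lambda>u w. reduce_word (u @ w)),
     one = []\<rparr>"


section \<open>Outer automorphisms and irreducibility\<close>

definition inner_aut :: "('a, 'b) monoid_scheme \<Rightarrow> 'a \<Rightarrow> 'a \<Rightarrow> 'a" where
  "inner_aut G g = (\<lambda>x\<in>carrier G. g \<otimes>\<^bsub>G\<^esub> x \<otimes>\<^bsub>G\<^esub> inv\<^bsub>G\<^esub> g)"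

definition Inn :: "('a, 'b) monoid_scheme \<Rightarrow> ('a \<Rightarrow> 'a) set" where
  "Inn G = inner_aut G ` carrier G"

definition Out :: "('a, 'b) monoid_scheme \<Rightarrow> ('a \<Rightarrow> 'a) set monoid" where
  "Out G = AutoGroup G Mod Inn G"

text \<open>
  Internal free products: every element of \<open>G\<close> is the product of exactly one
  word whose syllables are nontrivial elements of the factors, consecutive ones
  taken from different factors.  Syllables carry the index of their factor.
\<close>

definition normal_forms ::
    "('a, 'b) monoid_scheme \<Rightarrow> 'i set \<Rightarrow> ('i \<Rightarrow> 'a set) \<Rightarrow> ('i \<times> 'a) list set" where
  "normal_forms G I H =
    {w. (\<forall>(i, h) \<in> set w. i \<in> I \<and> h \<in> H i \<and> h \<noteq> \<one>\<^bsub>G\<^esub>) \<and>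
        successively (\<lambda>x y. fst x \<noteq> fst y) w}"

definition internal_free_product ::
    "('a, 'b) monoid_scheme \<Rightarrow> 'i set \<Rightarrow> ('i \<Rightarrow> 'a set) \<Rightarrow> bool" where
  "internal_free_product G I H \<longleftrightarrow>
    (\<forall>i\<in>I. subgroup (H i) G) \<and>
    bij_betw (\<lambda>w. foldr (\<lambda>(i, h) g. h \<otimes>\<^bsub>G\<^esub> g) w \<one>\<^bsub>G\<^esub>) (normal_forms G I H) (carrier G)"

definition conj_class :: "('a, 'b) monoid_scheme \<Rightarrow> 'a set \<Rightarrow> 'a set set" where
  "conj_class G A = (\<lambda>g. inner_aut G g ` A) ` carrier G"

text \<open>Action of an outer automorphism (a coset of automorphisms) on conjugacy classes of subgroups.\<close>

definition out_act :: "('a \<Rightarrow> 'a) set \<Rightarrow> 'a set set \<Rightarrow> 'a set set" where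
  "out_act \<phi> C = {\<alpha> ` A | \<alpha> A. \<alpha> \<in> \<phi> \<and> A \<in> C}"

text \<open>
  In the decomposition \<open>A\<^sub>1 * \<dots> * A\<^sub>r * B\<close>, the factor \<open>A\<^sub>i\<close> is \<open>H i\<close> and the
  possibly trivial factor \<open>B\<close> is \<open>H 0\<close>.
\<close>

definition out_irreducible :: "('a, 'b) monoid_scheme \<Rightarrow> ('a \<Rightarrow> 'a) set \<Rightarrow> bool" where
  "out_irreducible G \<phi> \<longleftrightarrow>
    \<not> (\<exists>(r::nat) H. 1 \<le> r \<and> internal_free_product G {0..r} H \<and>
        (\<forall>i\<in>{1..r}. H i \<noteq> {\<one>\<^bsub>G\<^esub>} \<and> H i \<noteq> carrier G) \<and>
        bij_betw (out_act \<phi>) (conj_class G ` H ` {1..r}) (conj_class G ` H ` {1..r}))"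

definition out_fully_irreducible :: "('a, 'b) monoid_scheme \<Rightarrow> ('a \<Rightarrow> 'a) set \<Rightarrow> bool" where
  "out_fully_irreducible G \<phi> \<longleftrightarrow>
    (\<forall>n::nat. 1 \<le> n \<longrightarrow> out_irreducible G (\<phi> [^]\<^bsub>Out G\<^esub> n))"


section \<open>Marked graphs and topological representatives\<close>

text \<open>
  A graph is given by a digraph, whose arcs fix an orientation of each edge; loops
  and multiple edges are allowed.  Paths traverse arcs in both directions.
\<close>

definition init_vertex :: "('v, nat) pre_digraph \<Rightarrow> letter \<Rightarrow> 'v" where
  "init_vertex \<Gamma> x = (if snd x then tail \<Gamma> (fst x) else head \<Gamma> (fst x))"

definition term_vertex :: "('v, nat) pre_digraph \<Rightarrow> letter \<Rightarrow> 'v" where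
  "term_vertex \<Gamma> x = init_vertex \<Gamma> (inv_letter x)"

fun edge_path :: "('v, nat) pre_digraph \<Rightarrow> 'v \<Rightarrow> letter list \<Rightarrow> 'v \<Rightarrow> bool" where
  "edge_path \<Gamma> u [] v \<longleftrightarrow> u \<in> verts \<Gamma> \<and> u = v"
| "edge_path \<Gamma> u (x # p) v \<longleftrightarrow>
     fst x \<in> arcs \<Gamma> \<and> init_vertex \<Gamma> x = u \<and> edge_path \<Gamma> (term_vertex \<Gamma> x) p v"

text \<open>
  Every homotopy class (rel endpoints) of paths between vertices contains exactly
  one reduced edge path.
\<close>

definition fundamental_group :: "('v, nat) pre_digraph \<Rightarrow> 'v \<Rightarrow> letter list monoid" where
  "fundamental_group \<Gamma> v =
    \<lparr>carrier = {p. reduced_word p \<and> edge_path \<Gamma> v p v},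
     monoid.mult = (\<lambda>p q. reduce_word (p @ q)),
     one = []\<rparr>"

text \<open>
  Graphs being aspherical, a marking, i.e. a homotopy equivalence from the rose with
  \<open>N\<close> petals sending its vertex to \<open>v\<close>, is up to homotopy an isomorphism of
  fundamental groups.  The edges are numbered so that they can index a matrix.
\<close>

definition marked_graph ::
    "nat \<Rightarrow> (nat, nat) pre_digraph \<Rightarrow> nat \<Rightarrow> (letter list \<Rightarrow> letter list) \<Rightarrow> bool" where
  "marked_graph N \<Gamma> v \<tau> \<longleftrightarrow>
    fin_digraph \<Gamma> \<and> Digraph_Component.connected \<Gamma> \<and>
    arcs \<Gamma> = {..<card (arcs \<Gamma>)} \<and>
    (\<forall>u\<in>verts \<Gamma>. 2 \<le> card {x. fst x \<in> arcs \<Gamma> \<and> init_vertex \<Gamma> x = u}) \<and>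
    v \<in> verts \<Gamma> \<and> \<tau> \<in> iso (free_group N) (fundamental_group \<Gamma> v)"

definition path_image :: "(nat \<Rightarrow> letter list) \<Rightarrow> letter list \<Rightarrow> letter list" where
  "path_image fE p =
    concat (map (\<lambda>x. if snd x then fE (fst x) else inv_word (fE (fst x))) p)"

text \<open>A map sending vertices to vertices and edges to nontrivial immersed edge paths.\<close>

definition graph_map ::
    "('v, nat) pre_digraph \<Rightarrow> ('v \<Rightarrow> 'v) \<Rightarrow> (nat \<Rightarrow> letter list) \<Rightarrow> bool" where
  "graph_map \<Gamma> fV fE \<longleftrightarrow>
    fV \<in> verts \<Gamma> \<rightarrow> verts \<Gamma> \<and>
    (\<forall>e\<in>arcs \<Gamma>. fE e \<noteq> [] \<and> reduced_word (fE e) \<and>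
       edge_path \<Gamma> (fV (tail \<Gamma> e)) (fE e) (fV (head \<Gamma> e)))"

text \<open>
  As \<open>fV\<close> may move the base point \<open>v\<close>, the induced automorphism depends on a path
  \<open>p\<close> from \<open>v\<close> to \<open>fV v\<close>; its outer class does not.  Since \<open>\<alpha>\<close> is an automorphism,
  the map is a homotopy equivalence.
\<close>

definition topological_representative ::
    "nat \<Rightarrow> (letter list \<Rightarrow> letter list) set \<Rightarrow> (nat, nat) pre_digraph \<Rightarrow>
     (nat \<Rightarrow> nat) \<Rightarrow> (nat \<Rightarrow> letter list) \<Rightarrow> bool" where
  "topological_representative N \<phi> \<Gamma> fV fE \<longleftrightarrow>
    graph_map \<Gamma> fV fE \<and>
    (\<exists>v \<tau>. marked_graph N \<Gamma> v \<tau> \<and>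
      (\<exists>\<alpha>\<in>\<phi>. \<exists>p. edge_path \<Gamma> v p (fV v) \<and>
        (\<forall>x\<in>carrier (free_group N).
           \<tau> (\<alpha> x) = reduce_word (p @ path_image fE (\<tau> x) @ inv_word p))))"

text \<open>All positive iterates are immersed on every edge; iterates are not tightened.\<close>

definition train_track :: "('v, nat) pre_digraph \<Rightarrow> (nat \<Rightarrow> letter list) \<Rightarrow> bool" where
  "train_track \<Gamma> fE \<longleftrightarrow>
    (\<forall>e\<in>arcs \<Gamma>. \<forall>n::nat. 1 \<le> n \<longrightarrow> reduced_word ((path_image fE ^^ n) [(e, True)]))"

text \<open>The \<open>(i, j)\<close> entry is the number of times the image of edge \<open>j\<close> crosses edge \<open>i\<close>, in either direction.\<close>

definition transition_matrix :: "('v, nat) pre_digraph \<Rightarrow> (nat \<Rightarrow> letter list) \<Rightarrow> real mat" where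
  "transition_matrix \<Gamma> fE =
    mat (card (arcs \<Gamma>)) (card (arcs \<Gamma>)) (\<lambda>(i, j). real (count_list (map fst (fE j)) i))"

definition irreducible_mat :: "real mat \<Rightarrow> bool" where
  "irreducible_mat A \<longleftrightarrow>
    (\<forall>i<dim_row A. \<forall>j<dim_row A. \<exists>n::nat. 1 \<le> n \<and> 0 < (A ^\<^sub>m n) $$ (i, j))"

text \<open>
  For an irreducible nonnegative matrix, the Perron--Frobenius eigenvalue is the
  unique one with a strictly positive eigenvector.
\<close>

definition PF_eigenvalue :: "real mat \<Rightarrow> real \<Rightarrow> bool" where
  "PF_eigenvalue A l \<longleftrightarrow> (\<exists>w. eigenvector A w l \<and> (\<forall>i<dim_row A. 0 < w $ i))"

definition irreducible_train_track_rep ::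
    "nat \<Rightarrow> (letter list \<Rightarrow> letter list) set \<Rightarrow> (nat, nat) pre_digraph \<Rightarrow>
     (nat \<Rightarrow> nat) \<Rightarrow> (nat \<Rightarrow> letter list) \<Rightarrow> bool" where
  "irreducible_train_track_rep N \<phi> \<Gamma> fV fE \<longleftrightarrow>
    topological_representative N \<phi> \<Gamma> fV fE \<and> train_track \<Gamma> fE \<and>
    irreducible_mat (transition_matrix \<Gamma> fE)"

text \<open>
  By Bestvina and Handel, an irreducible \<open>\<phi>\<close> has an irreducible train track
  representative, and all of these have the same Perron--Frobenius eigenvalue.
\<close>

definition stretch_factor :: "nat \<Rightarrow> (letter list \<Rightarrow> letter list) set \<Rightarrow> real" where
  "stretch_factor N \<phi> =
    (THE l. \<exists>\<Gamma> fV fE. irreducible_train_track_rep N \<phi> \<Gamma> fV fE \<and>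
                     PF_eigenvalue (transition_matrix \<Gamma> fE) l)"


section \<open>Spectral ratios\<close>

text \<open>Irreducibility in \<open>\<int>[x]\<close> includes primitivity.\<close>

definition minimal_int_poly :: "real \<Rightarrow> int poly" where
  "minimal_int_poly x =
    (THE f. irreducible f \<and> 0 < lead_coeff f \<and> poly (map_poly of_int f) x = 0)"

text \<open>The list of all complex roots with multiplicity, by nonincreasing modulus.\<close>

definition ordered_roots :: "int poly \<Rightarrow> complex list \<Rightarrow> bool" where
  "ordered_roots f zs \<longleftrightarrow>
    f \<noteq> 0 \<and>
    map_poly of_int f = Polynomial.smult (of_int (lead_coeff f)) (\<Prod>z\<leftarrow>zs. [:- z, 1:]) \<and>
    sorted_wrt (\<lambda>z z'. cmod z \<ge> cmod z') zs"

definition has_spectral_ratio :: "int poly \<Rightarrow> real \<Rightarrow> bool" where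
  "has_spectral_ratio f r \<longleftrightarrow>
    (\<exists>zs. ordered_roots f zs \<and> 2 \<le> length zs \<and> zs ! 1 \<noteq> 0 \<and> r = cmod (zs ! 0 / zs ! 1))"

definition spectral_ratio_defined :: "int poly \<Rightarrow> bool" where
  "spectral_ratio_defined f \<longleftrightarrow> (\<exists>r. has_spectral_ratio f r)"

definition spectral_ratio :: "int poly \<Rightarrow> real" where
  "spectral_ratio f = (THE r. has_spectral_ratio f r)"

text \<open>
  The spectral ratio of an irreducible outer automorphism is undefined when its
  stretch factor is an integer, in particular always for \<open>N = 1\<close>.
\<close>

definition out_spectral_ratio_defined :: "nat \<Rightarrow> (letter list \<Rightarrow> letter list) set \<Rightarrow> bool" where
  "out_spectral_ratio_defined N \<phi> \<longleftrightarrow>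
    spectral_ratio_defined (minimal_int_poly (stretch_factor N \<phi>))"

definition out_spectral_ratio :: "nat \<Rightarrow> (letter list \<Rightarrow> letter list) set \<Rightarrow> real" where
  "out_spectral_ratio N \<phi> = spectral_ratio (minimal_int_poly (stretch_factor N \<phi>))"

end

theory Submission
  imports Defs
begin

text \<open>
  The family for rank \<open>N = M + 1 \<ge> 3\<close> is \<open>x\<^sub>0 \<mapsto> x\<^sub>1 \<mapsto> \<dots> \<mapsto> x\<^sub>M \<mapsto> x\<^sub>0 x\<^sub>M\<^sup>k\<close>.  It and its inverse are
  induced by train track maps of the rose, whose transition matrices have the characteristic
  polynomials \<open>x\<^sup>N - k x\<^sup>M - 1\<close> and \<open>x\<^sup>N - k x - 1\<close>.  The first has one root near \<open>k\<close> and all others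
  inside the unit disc, so the spectral ratio grows with \<open>k\<close>; such a polynomial is irreducible, and
  so is the second, which is obtained from one of \<open>x\<^sup>N - k x\<^sup>M \<plusminus> 1\<close> by the substitution of \<open>- 1/x\<close>.
  All roots of the second but a small one are near the circle of radius \<open>k\<^bsup>1/M\<^esup>\<close>, and since \<open>M \<ge> 2\<close>
  there are at least two of these, so the spectral ratio tends to 1 (\<open>family_exists\<close>).

  Full irreducibility is read off from the abelianization.  A proper free factor \<open>A\<close> contains an
  element with nonzero abelianization, and is annihilated by a nonzero integer functional: a free
  product retracts onto each factor, and each nontrivial subgroup of a free group maps nontrivially
  to the integers, by its Magnus coefficients of lowest degree.  If a power preserved the conjugacy
  class of \<open>A\<close>, the functional would vanish on infinitely many iterated images of that element
  (\<open>not_out_irreducible_abelianization\<close>).  Its values there come from a linear recurrence with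
  characteristic polynomial \<open>x\<^sup>N - k x\<^sup>M - 1\<close>, whose dominating root prevents this.

  The stretch factor does not depend on the train track representative because it is a growth rate:
  a positive eigenvector of the transition matrix makes iterated images of a conjugacy class grow by
  the eigenvalue in each step, up to bounded factors, and a change of the marking distorts lengths
  by a bounded factor (\<open>stretch_factor_eqI\<close>).

  In rank one no outer automorphism has a spectral ratio, as the minimal polynomial of its stretch
  factor is linear (\<open>rank_one_no_spectral_ratio\<close>).

  In rank two the stretch factors of \<open>\<phi>\<close> and \<open>\<phi>\<^sup>-\<^sup>1\<close> agree if \<open>\<phi>\<close> is fully irreducible
  (\<open>stretch_factor_inverse_rank_two\<close>), so that the two limits contradict each other.  Nielsen
  reduction shows that the outer automorphism group is generated by the exchange of the generators,
  the inversion of one generator and a transvection (\<open>all_spanned\<close>).  Their relations bring every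
  element of infinite order, up to conjugation, to a product of positive transvections followed by a
  symmetry (\<open>conjugate_positive\<close>).  Such a product is a train track map of the rose, and its stretch
  factor is determined by the trace and the determinant of a matrix of size two.  The inverse is
  conjugate to a product with the same transvections, possibly exchanged, in the reverse order, which
  has the same trace and determinant.
\<close>

section \<open>Reduced words and the free group\<close>

lemma inv_letter_inv [simp]: "inv_letter (inv_letter x) = x"
  by (simp add: inv_letter_def)

lemma inv_letter_neq [simp]: "inv_letter x \<noteq> x" "x \<noteq> inv_letter x"
  by (auto simp: inv_letter_def prod_eq_iff)

lemma fst_inv_letter [simp]: "fst (inv_letter x) = fst x"
  and snd_inv_letter [simp]: "snd (inv_letter x) = (\<not> snd x)"
  by (simp_all add: inv_letter_def)

lemma inv_letter_inject [simp]: "inv_letter x = inv_letter y \<longleftrightarrow> x = y"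
  by (metis inv_letter_inv)

lemma inv_word_simps [simp]:
  "inv_word [] = []" "inv_word (x # w) = inv_word w @ [inv_letter x]"
  "inv_word (u @ w) = inv_word w @ inv_word u" "inv_word (inv_word w) = w"
  "length (inv_word w) = length w"
  by (simp_all add: inv_word_def rev_map comp_def)

lemma set_inv_word [simp]: "set (inv_word w) = inv_letter ` set w"
  by (simp add: inv_word_def)

lemma fst_set_inv_word [simp]: "fst ` set (inv_word w) = fst ` set w"
  by (simp add: image_image)

lemma inv_word_eq_Nil [simp]: "inv_word w = [] \<longleftrightarrow> w = []"
  by (simp add: inv_word_def)

lemma reduced_word_Nil [simp]: "reduced_word []"
  by (simp add: reduced_word_def)

lemma reduced_word_single [simp]: "reduced_word [x]"
  by (simp add: reduced_word_def)

lemma reduced_word_Cons: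
  "reduced_word (x # w) \<longleftrightarrow> reduced_word w \<and> (w \<noteq> [] \<longrightarrow> hd w \<noteq> inv_letter x)"
  by (cases w) (auto simp: reduced_word_def)

lemma reduced_word_append:
  "reduced_word (u @ w) \<longleftrightarrow>
     reduced_word u \<and> reduced_word w \<and> (u \<noteq> [] \<longrightarrow> w \<noteq> [] \<longrightarrow> hd w \<noteq> inv_letter (last u))"
  by (auto simp: reduced_word_def successively_append_iff)

lemma reduced_word_inv_word [simp]: "reduced_word (inv_word w) \<longleftrightarrow> reduced_word w"
proof (induction w)
  case (Cons x w)
  have "last (inv_word w) = inv_letter (hd w)" if "w \<noteq> []"
    using that by (simp add: inv_word_def last_rev hd_map)
  then show ?case
    using Cons by (auto simp: reduced_word_append reduced_word_Cons)
qed simp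

lemma reduced_word_cancel_Cons: "reduced_word w \<Longrightarrow> reduced_word (cancel_Cons x w)"
  by (cases w) (auto simp: cancel_Cons_def reduced_word_Cons)

lemma cancel_Cons_inverse:
  "reduced_word w \<Longrightarrow> cancel_Cons x (cancel_Cons (inv_letter x) w) = w"
  by (cases w) (auto simp: cancel_Cons_def reduced_word_Cons)

lemma reduced_foldr_cancel: "reduced_word r \<Longrightarrow> reduced_word (foldr cancel_Cons u r)"
  by (induction u) (auto intro: reduced_word_cancel_Cons)

lemma reduced_reduce_word [simp]: "reduced_word (reduce_word w)"
  by (simp add: reduce_word_def reduced_foldr_cancel)

lemma reduce_word_Nil [simp]: "reduce_word [] = []"
  by (simp add: reduce_word_def)

lemma reduce_word_Cons: "reduce_word (x # w) = cancel_Cons x (reduce_word w)"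
  by (simp add: reduce_word_def)

lemma reduce_word_reduced [simp]: "reduced_word w \<Longrightarrow> reduce_word w = w"
  by (induction w) (auto simp: reduce_word_Cons reduced_word_Cons cancel_Cons_def)

lemma foldr_cancel_reduce:
  assumes "reduced_word r"
  shows "foldr cancel_Cons (reduce_word u) r = foldr cancel_Cons u r"
proof (induction u)
  case (Cons x u)
  show ?case
  proof (cases "reduce_word u \<noteq> [] \<and> hd (reduce_word u) = inv_letter x")
    case True
    then obtain t where t: "reduce_word u = inv_letter x # t"
      by (metis list.exhaust_sel)
    have "foldr cancel_Cons (reduce_word (x # u)) r = foldr cancel_Cons t r"
      by (simp add: reduce_word_Cons t cancel_Cons_def)
    also have "\<dots> = cancel_Cons x (foldr cancel_Cons (reduce_word u) r)"
      by (simp add: t cancel_Cons_inverse reduced_foldr_cancel[OF assms])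
    finally show ?thesis
      using Cons by simp
  next
    case False
    then have "reduce_word (x # u) = x # reduce_word u"
      by (auto simp: reduce_word_Cons cancel_Cons_def)
    then show ?thesis
      using Cons by simp
  qed
qed simp

lemma reduce_word_append: "reduce_word (u @ w) = foldr cancel_Cons u (reduce_word w)"
  by (simp add: reduce_word_def)

lemma reduce_word_append_left [simp]: "reduce_word (reduce_word u @ w) = reduce_word (u @ w)"
  by (simp add: reduce_word_append foldr_cancel_reduce)

lemma reduce_word_append_right [simp]: "reduce_word (u @ reduce_word w) = reduce_word (u @ w)"
  by (simp add: reduce_word_append)

lemma reduce_word_Cons_right [simp]: "reduce_word (x # reduce_word w) = reduce_word (x # w)"
  using reduce_word_append_right[of "[x]" w] by simp

lemma reduce_word_inv_right: "reduce_word (w @ inv_word w) = []"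
proof (induction w)
  case (Cons x w)
  have "reduce_word ((x # w) @ inv_word (x # w))
      = cancel_Cons x (reduce_word (reduce_word (w @ inv_word w) @ [inv_letter x]))"
    by (simp only: reduce_word_append_left) (simp add: reduce_word_Cons)
  then show ?case
    using Cons by (simp add: cancel_Cons_def)
qed simp

lemma set_reduce_word: "set (reduce_word w) \<subseteq> set w"
proof (induction w)
  case (Cons x w)
  then show ?case
    by (cases "reduce_word w") (auto simp: reduce_word_Cons cancel_Cons_def)
qed simp

lemma length_reduce_word: "length (reduce_word w) \<le> length w"
proof (induction w)
  case (Cons x w)
  then show ?case
    by (auto simp: reduce_word_Cons cancel_Cons_def)
qed simp

text \<open>
  Reduced words as a type with a group structure: calculations modulo free reduction then become
  rewriting in the (noncommutative) class \<open>group_add\<close>.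
\<close>

typedef fgroup = "{w. reduced_word w}"
  by (rule exI[of _ "[]"]) simp

definition fg :: "letter list \<Rightarrow> fgroup" where
  "fg w = Abs_fgroup (reduce_word w)"

lemma fg_eq_iff: "fg u = fg w \<longleftrightarrow> reduce_word u = reduce_word w"
  by (simp add: fg_def Abs_fgroup_inject)

lemma fg_Rep: "fg (Rep_fgroup x) = x"
  using Rep_fgroup[of x] by (simp add: fg_def Rep_fgroup_inverse)

instantiation fgroup :: group_add
begin

definition zero_fgroup where "zero_fgroup = fg []"
definition plus_fgroup where "plus_fgroup x y = fg (Rep_fgroup x @ Rep_fgroup y)"
definition uminus_fgroup where "uminus_fgroup x = fg (inv_word (Rep_fgroup x))"
definition minus_fgroup where "minus_fgroup (x :: fgroup) y = x + - y"

lemma Rep_fg: "Rep_fgroup (fg w) = reduce_word w"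
  by (simp add: fg_def Abs_fgroup_inverse)

lemma fg_append [simp]: "fg (u @ w) = fg u + fg w"
  by (simp add: plus_fgroup_def fg_eq_iff Rep_fg)

lemma fg_Nil [simp]: "fg [] = 0"
  by (simp add: zero_fgroup_def)

instance
proof
  fix a b c :: fgroup
  obtain u v w where eq: "a = fg u" "b = fg v" "c = fg w"
    by (metis fg_Rep)
  show "a + b + c = a + (b + c)"
    by (metis eq fg_append append.assoc)
  show "0 + a = a" "a + 0 = a"
    by (metis eq fg_append fg_Nil append_Nil append_Nil2)+
  show "- a + a = 0"
    using reduce_word_inv_right[of "inv_word (Rep_fgroup a)"]
    by (metis uminus_fgroup_def fg_Rep fg_append fg_Nil fg_eq_iff inv_word_simps(4) reduce_word_Nil)
  show "a + - b = a - b"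
    by (simp add: minus_fgroup_def)
qed

end

lemma fg_inv_word [simp]: "fg (inv_word w) = - fg w"
proof -
  have "fg w + fg (inv_word w) = 0"
    by (metis fg_append fg_eq_iff reduce_word_inv_right fg_Nil reduce_word_Nil)
  then show ?thesis
    by (simp add: eq_neg_iff_add_eq_0 minus_unique)
qed

lemma fg_reduce_word [simp]: "fg (reduce_word w) = fg w"
  by (simp add: fg_eq_iff)

lemma fg_Cons: "fg (x # w) = fg [x] + fg w"
  using fg_append[of "[x]" w] by simp

lemma reduced_eqI: "reduced_word u \<Longrightarrow> reduced_word w \<Longrightarrow> fg u = fg w \<Longrightarrow> u = w"
  by (simp add: fg_eq_iff)

lemma reduce_word_eqI: "fg u = fg w \<Longrightarrow> reduce_word u = reduce_word w"
  by (simp add: fg_eq_iff)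

lemma reduce_word_inv_word: "reduce_word (inv_word w) = inv_word (reduce_word w)"
  by (rule reduced_eqI) simp_all

lemma length_reduce_append_left: "length (reduce_word w) \<le> length u + length (reduce_word (u @ w))"
proof -
  have "reduce_word w = reduce_word (inv_word u @ reduce_word (u @ w))"
    by (rule reduce_word_eqI) simp
  then show ?thesis
    by (metis length_reduce_word length_append inv_word_simps(5))
qed

lemma length_reduce_append_right: "length (reduce_word w) \<le> length u + length (reduce_word (w @ u))"
proof -
  have "reduce_word w = reduce_word (reduce_word (w @ u) @ inv_word u)"
    by (rule reduce_word_eqI) (simp add: add.assoc)
  then show ?thesis
    by (metis add.commute length_reduce_word length_append inv_word_simps(5))
qed

text \<open>
  The free group of rank \<open>N\<close> and the fundamental group of a graph have the same shape: reduced
  words from a set closed under concatenation, inversion and reduction.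
\<close>

definition word_group :: "letter list set \<Rightarrow> letter list monoid" where
  "word_group C =
    \<lparr>carrier = {w. reduced_word w \<and> w \<in> C}, monoid.mult = (\<lambda>u w. reduce_word (u @ w)), one = []\<rparr>"

definition word_closed :: "letter list set \<Rightarrow> bool" where
  "word_closed C \<longleftrightarrow> [] \<in> C \<and> (\<forall>u\<in>C. \<forall>w\<in>C. u @ w \<in> C) \<and> (\<forall>w\<in>C. inv_word w \<in> C \<and> reduce_word w \<in> C)"

lemma word_group_sel [simp]:
  "carrier (word_group C) = {w. reduced_word w \<and> w \<in> C}"
  "u \<otimes>\<^bsub>word_group C\<^esub> w = reduce_word (u @ w)"
  "\<one>\<^bsub>word_group C\<^esub> = []"
  by (simp_all add: word_group_def)

lemma group_word_group: "word_closed C \<Longrightarrow> group (word_group C)"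
proof (rule groupI)
  assume C: "word_closed C"
  fix x assume x: "x \<in> carrier (word_group C)"
  have "reduce_word (inv_word x @ x) = []"
    using reduce_word_inv_right[of "inv_word x"] by simp
  then show "\<exists>y\<in>carrier (word_group C). y \<otimes>\<^bsub>word_group C\<^esub> x = \<one>\<^bsub>word_group C\<^esub>"
    using x C by (intro bexI[of _ "inv_word x"]) (auto simp: word_closed_def)
qed (auto simp: word_closed_def)

lemma inv_word_group:
  assumes "word_closed C" "x \<in> carrier (word_group C)"
  shows "inv\<^bsub>word_group C\<^esub> x = inv_word x"
proof (rule group.inv_equality[OF group_word_group[OF assms(1)]])
  show "inv_word x \<otimes>\<^bsub>word_group C\<^esub> x = \<one>\<^bsub>word_group C\<^esub>"
    using reduce_word_inv_right[of "inv_word x"] by simp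
  show "x \<in> carrier (word_group C)" "inv_word x \<in> carrier (word_group C)"
    using assms by (auto simp: word_closed_def)
qed

definition words :: "nat \<Rightarrow> letter list set" where
  "words N = {w. fst ` set w \<subseteq> {..<N}}"

lemma word_closed_words [simp]: "word_closed (words N)"
proof -
  have "fst ` set (reduce_word w) \<subseteq> {..<N}" if "fst ` set w \<subseteq> {..<N}" for w
    using that set_reduce_word[of w] by fastforce
  then show ?thesis
    unfolding word_closed_def words_def mem_Collect_eq fst_set_inv_word
    by (simp add: image_Un)
qed

lemma free_group_eq: "free_group N = word_group (words N)"
  by (simp add: free_group_def word_group_def words_def)

lemma words_simps [simp]:
  "[] \<in> words N" "(u @ w \<in> words N) \<longleftrightarrow> u \<in> words N \<and> w \<in> words N"
  "(x # w \<in> words N) \<longleftrightarrow> fst x < N \<and> w \<in> words N"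
  "inv_word w \<in> words N \<longleftrightarrow> w \<in> words N"
  by (auto simp: words_def image_subset_iff)

lemma words_reduce: "w \<in> words N \<Longrightarrow> reduce_word w \<in> words N"
  using word_closed_words by (auto simp: word_closed_def)

lemma free_group_sel [simp]:
  "carrier (free_group N) = {w. reduced_word w \<and> w \<in> words N}"
  "u \<otimes>\<^bsub>free_group N\<^esub> w = reduce_word (u @ w)"
  "\<one>\<^bsub>free_group N\<^esub> = []"
  by (simp_all add: free_group_eq)

lemma group_free_group: "group (free_group N)"
  by (simp add: free_group_eq group_word_group)

lemma inv_free_group:
  "reduced_word x \<Longrightarrow> x \<in> words N \<Longrightarrow> inv\<^bsub>free_group N\<^esub> x = inv_word x"
  by (simp add: free_group_eq inv_word_group)


section \<open>Homomorphisms determined by the images of the letters\<close>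

lemma path_image_simps [simp]:
  "path_image f [] = []" "path_image f (u @ w) = path_image f u @ path_image f w"
  by (simp_all add: path_image_def)

lemma path_image_Cons:
  "path_image f (x # w) = (if snd x then f (fst x) else inv_word (f (fst x))) @ path_image f w"
  by (simp add: path_image_def)

lemma path_image_single: "path_image f [(i, True)] = f i" "path_image f [(i, False)] = inv_word (f i)"
  by (simp_all add: path_image_def)

lemma path_image_inv_word: "path_image f (inv_word w) = inv_word (path_image f w)"
  by (induction w) (auto simp: path_image_Cons)

lemma fg_path_image_reduce: "fg (path_image f (reduce_word w)) = fg (path_image f w)"
proof (induction w)
  case (Cons x w)
  have 1: "fg (path_image f (x # t)) = fg (path_image f [x]) + fg (path_image f t)" for t
    by (simp add: path_image_Cons)
  show ?case
  proof (cases "reduce_word w \<noteq> [] \<and> hd (reduce_word w) = inv_letter x")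
    case True
    then obtain t where t: "reduce_word w = inv_letter x # t"
      by (metis list.exhaust_sel)
    have "fg (path_image f (x # w)) = fg (path_image f [x]) + fg (path_image f (inv_word [x] @ t))"
      using 1[of w] Cons by (simp add: t)
    also have "\<dots> = fg (path_image f t)"
      unfolding path_image_simps path_image_inv_word by simp
    finally show ?thesis
      by (simp add: reduce_word_Cons t cancel_Cons_def)
  next
    case False
    then have "reduce_word (x # w) = x # reduce_word w"
      by (auto simp: reduce_word_Cons cancel_Cons_def)
    then show ?thesis
      using Cons 1 by metis
  qed
qed simp

lemma fg_path_image_cong: "fg u = fg w \<Longrightarrow> fg (path_image f u) = fg (path_image f w)"
  by (metis fg_path_image_reduce fg_eq_iff)

lemma path_image_words:
  "w \<in> words N \<Longrightarrow> (\<And>i. i < N \<Longrightarrow> f i \<in> words M) \<Longrightarrow> path_image f w \<in> words M"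
  by (induction w) (auto simp: path_image_Cons)

lemma path_image_compose: "path_image f (path_image g w) = path_image (\<lambda>i. path_image f (g i)) w"
  by (induction w) (auto simp: path_image_Cons path_image_inv_word)

lemma path_image_id: "path_image (\<lambda>i. [(i, True)]) w = w"
  by (induction w) (auto simp: path_image_Cons inv_letter_def prod_eq_iff)

lemma fg_path_image_letterwise:
  assumes "w \<in> words N" "\<And>i. i < N \<Longrightarrow> fg (f i) = fg (g i)"
  shows "fg (path_image f w) = fg (path_image g w)"
  using assms(1)
proof (induction w)
  case (Cons x w)
  then show ?case
    using assms(2)[of "fst x"] by (simp add: path_image_Cons)
qed simp

text \<open>A homomorphism out of a free group is recovered from its values on the generators.\<close>

lemma hom_free_group_path_image:
  assumes h: "h \<in> hom (free_group N) (word_group C)" and C: "word_closed C" and w: "w \<in> words N"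
  shows "h (reduce_word w) = reduce_word (path_image (\<lambda>i. h [(i, True)]) w)"
proof -
  interpret group_hom "free_group N" "word_group C" h
    by (simp add: group_hom_def group_hom_axioms_def group_free_group group_word_group C h)
  show ?thesis
    using w
  proof (induction w)
    case Nil
    then show ?case using hom_one by simp
  next
    case (Cons x w)
    have x: "[x] \<in> carrier (free_group N)" "[inv_letter x] \<in> carrier (free_group N)"
      using Cons.prems by auto
    have 1: "h (inv_word [y]) = inv_word (h [y])" if "[y] \<in> carrier (free_group N)" for y
      using hom_inv[OF that] hom_closed[OF that] that by (simp add: inv_free_group inv_word_group C)
    have hx: "h [x] = path_image (\<lambda>i. h [(i, True)]) [x]"
    proof (cases "snd x")
      case True
      then have "x = (fst x, True)" by (simp add: prod_eq_iff)
      then show ?thesis using path_image_single(1) by metis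
    next
      case False
      then have *: "x = (fst x, False)" by (simp add: prod_eq_iff)
      then have **: "inv_letter x = (fst x, True)" by (simp add: prod_eq_iff)
      show ?thesis
        using 1[OF x(2)] path_image_single(2) * ** by (metis append_Nil inv_letter_inv inv_word_simps(1,2))
    qed
    have "h (reduce_word (x # w)) = h ([x] \<otimes>\<^bsub>free_group N\<^esub> reduce_word w)"
      by simp
    also have "\<dots> = reduce_word (h [x] @ h (reduce_word w))"
      using hom_mult[OF x(1), of "reduce_word w"] Cons.prems by (simp add: words_reduce)
    also have "\<dots> = reduce_word (path_image (\<lambda>i. h [(i, True)]) (x # w))"
      using Cons by (simp add: hx) (simp add: path_image_Cons)
    finally show ?case .
  qed
qed

definition word_map :: "nat \<Rightarrow> (nat \<Rightarrow> letter list) \<Rightarrow> letter list \<Rightarrow> letter list" where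
  "word_map N f = (\<lambda>x\<in>carrier (free_group N). reduce_word (path_image f x))"

lemma word_map_hom:
  assumes "\<And>i. i < N \<Longrightarrow> f i \<in> words N"
  shows "word_map N f \<in> hom (free_group N) (free_group N)"
proof (rule homI)
  fix x y assume "x \<in> carrier (free_group N)" "y \<in> carrier (free_group N)"
  then show "word_map N f (x \<otimes>\<^bsub>free_group N\<^esub> y) = word_map N f x \<otimes>\<^bsub>free_group N\<^esub> word_map N f y"
    by (auto simp: word_map_def words_reduce fg_path_image_reduce intro!: reduce_word_eqI)
qed (auto simp: word_map_def assms path_image_words words_reduce)

lemma word_map_eqI:
  assumes "\<And>i. i < N \<Longrightarrow> fg (f i) = fg (g i)"
  shows "word_map N f = word_map N g"
  using fg_path_image_letterwise[of _ N f g] assms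
  by (intro ext) (simp add: word_map_def fg_eq_iff)

lemma word_map_apply: "reduced_word x \<Longrightarrow> x \<in> words N \<Longrightarrow> word_map N f x = reduce_word (path_image f x)"
  by (simp add: word_map_def)

lemma word_map_compose:
  assumes "\<And>i. i < N \<Longrightarrow> g i \<in> words N"
  shows "compose (carrier (free_group N)) (word_map N f) (word_map N g)
       = word_map N (\<lambda>i. path_image f (g i))"
proof
  fix x
  show "compose (carrier (free_group N)) (word_map N f) (word_map N g) x
       = word_map N (\<lambda>i. path_image f (g i)) x"
    using path_image_words[of x N g N] assms
    by (auto simp: compose_def word_map_def words_reduce path_image_compose[symmetric]
          fg_path_image_reduce intro!: reduce_word_eqI)
qed

lemma word_map_id: "word_map N (\<lambda>i. [(i, True)]) = (\<lambda>x\<in>carrier (free_group N). x)"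
  by (auto simp: word_map_def path_image_id)

lemma hom_eq_word_map:
  assumes "h \<in> hom (free_group N) (free_group N)" "h \<in> extensional (carrier (free_group N))"
  shows "h = word_map N (\<lambda>i. h [(i, True)])"
proof
  fix x
  show "h x = word_map N (\<lambda>i. h [(i, True)]) x"
    using hom_free_group_path_image[of h N "words N" x] assms
    by (auto simp: free_group_eq word_map_def extensional_def)
qed

lemma word_map_auto:
  assumes f: "\<And>i. i < N \<Longrightarrow> f i \<in> words N" and g: "\<And>i. i < N \<Longrightarrow> g i \<in> words N"
    and fg: "\<And>i. i < N \<Longrightarrow> fg (path_image f (g i)) = fg [(i, True)]"
    and gf: "\<And>i. i < N \<Longrightarrow> fg (path_image g (f i)) = fg [(i, True)]"
  shows "word_map N f \<in> auto (free_group N)"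
proof -
  let ?C = "carrier (free_group N)"
  have hf: "word_map N f \<in> hom (free_group N) (free_group N)"
    and hg: "word_map N g \<in> hom (free_group N) (free_group N)"
    using f g by (auto intro: word_map_hom)
  have 1: "compose ?C (word_map N f) (word_map N g) = (\<lambda>x\<in>?C. x)"
    using word_map_compose[of N g f] word_map_eqI[of N "\<lambda>i. path_image f (g i)" "\<lambda>i. [(i, True)]"]
    by (simp only: g fg word_map_id)
  have 2: "compose ?C (word_map N g) (word_map N f) = (\<lambda>x\<in>?C. x)"
    using word_map_compose[of N f g] word_map_eqI[of N "\<lambda>i. path_image g (f i)" "\<lambda>i. [(i, True)]"]
    by (simp only: f gf word_map_id)
  have "bij_betw (word_map N f) ?C ?C"
  proof (rule bij_betwI[where g = "word_map N g"])
    show "word_map N f \<in> ?C \<rightarrow> ?C" "word_map N g \<in> ?C \<rightarrow> ?C"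
      using hf hg by (auto simp: hom_def)
    show "word_map N g (word_map N f x) = x" "word_map N f (word_map N g x) = x" if "x \<in> ?C" for x
      using that fun_cong[OF 1, of x] fun_cong[OF 2, of x] by (simp_all add: compose_def)
  qed
  then show ?thesis
    using hf by (auto simp: auto_def Bij_def word_map_def)
qed

text \<open>Additive functionals of the free group, given by their values on the generators.\<close>

definition esum :: "(nat \<Rightarrow> int) \<Rightarrow> letter list \<Rightarrow> int" where
  "esum u w = (\<Sum>x\<leftarrow>w. if snd x then u (fst x) else - u (fst x))"

lemma esum_simps [simp]:
  "esum u [] = 0" "esum u (v @ w) = esum u v + esum u w"
  "esum u (x # w) = (if snd x then u (fst x) else - u (fst x)) + esum u w"
  by (simp_all add: esum_def)

lemma esum_inv_word [simp]: "esum u (inv_word w) = - esum u w"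
  by (induction w) auto

lemma esum_reduce_word [simp]: "esum u (reduce_word w) = esum u w"
proof (induction w)
  case (Cons x w)
  show ?case
  proof (cases "reduce_word w")
    case Nil
    then show ?thesis using Cons by (auto simp: reduce_word_Cons cancel_Cons_def)
  next
    case (Cons y t)
    then show ?thesis using \<open>esum u (reduce_word w) = esum u w\<close>
      by (auto simp: reduce_word_Cons cancel_Cons_def)
  qed
qed simp

lemma esum_expand:
  assumes "w \<in> words N"
  shows "esum u w = (\<Sum>i<N. u i * esum (\<lambda>j. if j = i then 1 else 0) w)"
  using assms
proof (induction w)
  case (Cons x w)
  have "(\<Sum>i<N. u i * (if snd x then if fst x = i then 1 else 0 else - (if fst x = i then 1 else 0)))
      = (if snd x then u (fst x) else - u (fst x))"
    using Cons.prems by (auto simp: if_distrib[where f = "\<lambda>t. u _ * t"] sum_negf sum.delta' cong: if_cong)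
  with Cons show ?case
    by (simp add: distrib_left sum.distrib)
qed simp


section \<open>Outer automorphisms as cosets\<close>

lemma AutoGroup_sel:
  "carrier (AutoGroup G) = auto G" "\<one>\<^bsub>AutoGroup G\<^esub> = (\<lambda>x\<in>carrier G. x)"
  "\<alpha> \<in> auto G \<Longrightarrow> \<beta> \<in> auto G \<Longrightarrow> \<alpha> \<otimes>\<^bsub>AutoGroup G\<^esub> \<beta> = compose (carrier G) \<alpha> \<beta>"
  by (auto simp: AutoGroup_def BijGroup_def auto_def)

lemma auto_bij: "\<alpha> \<in> auto G \<Longrightarrow> bij_betw \<alpha> (carrier G) (carrier G)"
  and auto_hom: "\<alpha> \<in> auto G \<Longrightarrow> \<alpha> \<in> hom G G"
  and auto_ext: "\<alpha> \<in> auto G \<Longrightarrow> \<alpha> \<in> extensional (carrier G)"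
  by (auto simp: auto_def Bij_def)

lemma auto_closed: "\<alpha> \<in> auto G \<Longrightarrow> x \<in> carrier G \<Longrightarrow> \<alpha> x \<in> carrier G"
  using auto_bij bij_betwE by blast

context group
begin

lemma inner_aut_auto:
  assumes g: "g \<in> carrier G"
  shows "inner_aut G g \<in> auto G"
proof -
  have bij: "bij_betw (inner_aut G g) (carrier G) (carrier G)"
    by (rule bij_betwI[where g = "inner_aut G (inv g)"])
      (auto simp: inner_aut_def g m_assoc, (simp_all add: g flip: m_assoc)?)
  moreover have "inner_aut G g \<in> hom G G"
    by (rule homI) (auto simp: inner_aut_def g m_assoc inv_solve_left)
  ultimately show ?thesis
    by (auto simp: auto_def Bij_def inner_aut_def)
qed

lemma inner_aut_mult:
  assumes "g \<in> carrier G" "h \<in> carrier G"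
  shows "compose (carrier G) (inner_aut G g) (inner_aut G h) = inner_aut G (g \<otimes> h)"
  using assms by (auto simp: compose_def inner_aut_def m_assoc inv_mult_group)

lemma auto_inner_aut:
  assumes a: "\<alpha> \<in> auto G" and g: "g \<in> carrier G"
  shows "compose (carrier G) \<alpha> (inner_aut G g) = compose (carrier G) (inner_aut G (\<alpha> g)) \<alpha>"
proof -
  interpret A: group_hom G G \<alpha>
    using auto_hom[OF a] by (simp add: group_hom_def group_hom_axioms_def is_group)
  show ?thesis
    using g by (auto simp: compose_def inner_aut_def)
qed

lemma Inn_normal: "Inn G \<lhd> AutoGroup G"
proof -
  interpret A: group "AutoGroup G"
    by (rule AutoGroup)
  have sub: "subgroup (Inn G) (AutoGroup G)"
  proof (rule A.subgroupI)
    show "Inn G \<subseteq> carrier (AutoGroup G)" "Inn G \<noteq> {}"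
      by (auto simp: Inn_def AutoGroup_sel inner_aut_auto)
    fix a assume "a \<in> Inn G"
    then obtain g where g: "a = inner_aut G g" "g \<in> carrier G"
      by (auto simp: Inn_def)
    have one: "inner_aut G \<one> = (\<lambda>x\<in>carrier G. x)"
      by (auto simp: inner_aut_def)
    have "inv\<^bsub>AutoGroup G\<^esub> a = inner_aut G (inv g)"
      by (rule A.inv_equality) (auto simp: g AutoGroup_sel inner_aut_auto inner_aut_mult one)
    then show "inv\<^bsub>AutoGroup G\<^esub> a \<in> Inn G"
      using g by (simp add: Inn_def)
    fix b assume "b \<in> Inn G"
    then obtain h where h: "b = inner_aut G h" "h \<in> carrier G"
      by (auto simp: Inn_def)
    then show "a \<otimes>\<^bsub>AutoGroup G\<^esub> b \<in> Inn G"
      using g by (auto simp: Inn_def AutoGroup_sel inner_aut_auto inner_aut_mult)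
  qed
  show ?thesis
  proof (rule A.normal_inv_iff[THEN iffD2], intro conjI ballI sub)
    fix \<alpha> a assume \<alpha>: "\<alpha> \<in> carrier (AutoGroup G)" and "a \<in> Inn G"
    then obtain g where g: "a = inner_aut G g" "g \<in> carrier G"
      by (auto simp: Inn_def)
    have a: "a \<in> carrier (AutoGroup G)"
      by (simp add: g AutoGroup_sel inner_aut_auto)
    have \<alpha>g: "\<alpha> g \<in> carrier G"
      using \<alpha> g by (auto simp: AutoGroup_sel auto_closed)
    have "\<alpha> \<otimes>\<^bsub>AutoGroup G\<^esub> a = inner_aut G (\<alpha> g) \<otimes>\<^bsub>AutoGroup G\<^esub> \<alpha>"
      using \<alpha> g \<alpha>g by (simp add: AutoGroup_sel inner_aut_auto auto_inner_aut)
    then have "\<alpha> \<otimes>\<^bsub>AutoGroup G\<^esub> a \<otimes>\<^bsub>AutoGroup G\<^esub> inv\<^bsub>AutoGroup G\<^esub> \<alpha> = inner_aut G (\<alpha> g)"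
      using \<alpha> a \<alpha>g inner_aut_auto[OF \<alpha>g] A.r_inv A.m_assoc A.r_one A.inv_closed
      by (metis AutoGroup_sel(1))
    then show "\<alpha> \<otimes>\<^bsub>AutoGroup G\<^esub> a \<otimes>\<^bsub>AutoGroup G\<^esub> inv\<^bsub>AutoGroup G\<^esub> \<alpha> \<in> Inn G"
      using \<alpha>g by (auto simp: Inn_def)
  qed
qed

end

abbreviation outer :: "('a, 'b) monoid_scheme \<Rightarrow> ('a \<Rightarrow> 'a) \<Rightarrow> ('a \<Rightarrow> 'a) set" where
  "outer G \<alpha> \<equiv> Inn G #>\<^bsub>AutoGroup G\<^esub> \<alpha>"

context group
begin

lemma carrier_Out: "carrier (Out G) = outer G ` auto G"
  by (simp add: Out_def carrier_FactGroup AutoGroup_sel)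

lemma outer_def2: "\<alpha> \<in> auto G \<Longrightarrow> outer G \<alpha> = (\<lambda>g. compose (carrier G) (inner_aut G g) \<alpha>) ` carrier G"
  by (auto simp: r_coset_def Inn_def AutoGroup_sel inner_aut_auto)

lemma outer_self: "\<alpha> \<in> auto G \<Longrightarrow> \<alpha> \<in> outer G \<alpha>"
  using group.rcos_self[OF AutoGroup, of \<alpha> "Inn G"] Inn_normal normal_imp_subgroup
  by (auto simp: AutoGroup_sel)

lemma auto_compose: "\<alpha> \<in> auto G \<Longrightarrow> \<beta> \<in> auto G \<Longrightarrow> compose (carrier G) \<alpha> \<beta> \<in> auto G"
  using group.is_monoid[OF AutoGroup] monoid.m_closed[of "AutoGroup G" \<alpha> \<beta>] by (simp add: AutoGroup_sel)

lemma outer_memD: "\<alpha> \<in> auto G \<Longrightarrow> \<beta> \<in> outer G \<alpha> \<Longrightarrow> \<beta> \<in> auto G"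
  by (auto simp: outer_def2 auto_compose inner_aut_auto)

lemma outer_eqI: "\<alpha> \<in> auto G \<Longrightarrow> \<beta> \<in> outer G \<alpha> \<Longrightarrow> outer G \<beta> = outer G \<alpha>"
  using group.repr_independence[OF AutoGroup, of \<beta> "Inn G" \<alpha>] Inn_normal normal_imp_subgroup
  by (auto simp: AutoGroup_sel)

lemma outer_mult:
  assumes "\<alpha> \<in> auto G" "\<beta> \<in> auto G"
  shows "outer G \<alpha> \<otimes>\<^bsub>Out G\<^esub> outer G \<beta> = outer G (compose (carrier G) \<alpha> \<beta>)"
  using normal.rcos_sum[OF Inn_normal] assms by (simp add: Out_def AutoGroup_sel)

lemma group_Out: "group (Out G)"
  unfolding Out_def by (rule normal.factorgroup_is_group[OF Inn_normal])

lemma outer_one: "\<one>\<^bsub>Out G\<^esub> = outer G (\<lambda>x\<in>carrier G. x)"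
  using group.coset_mult_one[OF AutoGroup, of "Inn G"] subgroup.subset[OF normal_imp_subgroup[OF Inn_normal]]
  by (simp add: Out_def AutoGroup_sel)

lemma outer_inverse:
  assumes "\<alpha> \<in> auto G" "\<beta> \<in> auto G" "compose (carrier G) \<beta> \<alpha> = (\<lambda>x\<in>carrier G. x)"
  shows "inv\<^bsub>Out G\<^esub> (outer G \<alpha>) = outer G \<beta>"
  by (rule group.inv_equality[OF group_Out]) (use assms in \<open>auto simp: outer_mult outer_one carrier_Out\<close>)

lemma outer_pow:
  assumes a: "\<alpha> \<in> auto G"
  shows "\<exists>\<beta>\<in>auto G. outer G \<alpha> [^]\<^bsub>Out G\<^esub> (n::nat) = outer G \<beta> \<and> (\<forall>x\<in>carrier G. \<beta> x = (\<alpha> ^^ n) x)"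
proof (induction n)
  case 0
  have "outer G \<alpha> [^]\<^bsub>Out G\<^esub> (0::nat) = outer G (\<lambda>x\<in>carrier G. x)"
    by (simp only: Group.nat_pow_0 outer_one)
  then show ?case
    by (intro bexI[OF _ id_in_auto] conjI) (assumption, simp)
next
  case (Suc n)
  then obtain \<beta> where b: "\<beta> \<in> auto G" "outer G \<alpha> [^]\<^bsub>Out G\<^esub> n = outer G \<beta>"
      "\<forall>x\<in>carrier G. \<beta> x = (\<alpha> ^^ n) x" by auto
  have "outer G \<alpha> [^]\<^bsub>Out G\<^esub> Suc n = outer G (compose (carrier G) \<beta> \<alpha>)"
    using b a by (simp add: outer_mult)
  moreover have "compose (carrier G) \<beta> \<alpha> x = (\<alpha> ^^ Suc n) x" if "x \<in> carrier G" for x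
    using that b(3) auto_closed[OF a that] by (simp add: compose_def funpow_swap1)
  ultimately show ?case
    using auto_compose[OF b(1) a] by blast
qed

end


section \<open>Edge paths and the fundamental group\<close>

lemmas fg_arith = diff_conv_add_uminus add.assoc minus_add

lemma init_vertex_inv [simp]: "init_vertex \<Gamma> (inv_letter x) = term_vertex \<Gamma> x"
  and term_vertex_inv [simp]: "term_vertex \<Gamma> (inv_letter x) = init_vertex \<Gamma> x"
  by (simp_all add: term_vertex_def)

lemma edge_path_arcs: "edge_path \<Gamma> u p v \<Longrightarrow> fst ` set p \<subseteq> arcs \<Gamma>"
  by (induction p arbitrary: u) auto

locale edge_graph = wf_digraph G for G :: "('v, nat) pre_digraph"
begin

lemma init_vertex_verts: "fst x \<in> arcs G \<Longrightarrow> init_vertex G x \<in> verts G"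
  and term_vertex_verts: "fst x \<in> arcs G \<Longrightarrow> term_vertex G x \<in> verts G"
  by (auto simp: init_vertex_def term_vertex_def)

lemma edge_path_verts: "edge_path G u p v \<Longrightarrow> u \<in> verts G \<and> v \<in> verts G"
  by (induction p arbitrary: u) (auto simp: init_vertex_verts)

lemma edge_path_append: "edge_path G u (p @ q) v \<longleftrightarrow> (\<exists>m. edge_path G u p m \<and> edge_path G m q v)"
  by (induction p arbitrary: u) (auto dest: edge_path_verts)

lemma edge_path_inv_word: "edge_path G u p v \<Longrightarrow> edge_path G v (inv_word p) u"
proof (induction p arbitrary: u)
  case (Cons x p)
  then show ?case
    by (auto simp: edge_path_append init_vertex_verts)
qed simp

lemma edge_path_reduce_word: "edge_path G u p v \<Longrightarrow> edge_path G u (reduce_word p) v"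
proof (induction p arbitrary: u)
  case (Cons x p)
  then have IH: "edge_path G (term_vertex G x) (reduce_word p) v" by simp
  show ?case
  proof (cases "reduce_word p \<noteq> [] \<and> hd (reduce_word p) = inv_letter x")
    case True
    then obtain t where "reduce_word p = inv_letter x # t"
      by (metis list.exhaust_sel)
    then show ?thesis
      using IH Cons.prems by (simp add: reduce_word_Cons cancel_Cons_def)
  next
    case False
    then have "reduce_word (x # p) = x # reduce_word p"
      by (auto simp: reduce_word_Cons cancel_Cons_def)
    then show ?thesis
      using IH Cons.prems by simp
  qed
qed simp

lemma word_closed_loops: "v \<in> verts G \<Longrightarrow> word_closed {p. edge_path G v p v}"
  by (auto simp: word_closed_def edge_path_append edge_path_inv_word edge_path_reduce_word)

lemma connected_edge_path:
  assumes "Digraph_Component.connected G" "u \<in> verts G" "v \<in> verts G"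
  shows "\<exists>p. edge_path G u p v"
proof -
  have "(u, v) \<in> rtrancl_on (verts G) (arcs_ends (with_proj (mk_symmetric G)))"
    using assms by (auto simp: Digraph_Component.connected_def strongly_connected_def reachable_def)
  then show ?thesis
  proof (induction rule: rtrancl_on_induct)
    case base
    then show ?case by (intro exI[of _ "[]"]) simp
  next
    case (step y z)
    then obtain p where p: "edge_path G u p y" by blast
    have "(y, z) \<in> (\<Union>e\<in>arcs G. {(tail G e, head G e), (head G e, tail G e)})"
      using step(2) by (auto simp: arcs_ends_conv parcs_mk_symmetric)
    then obtain e where e: "e \<in> arcs G" "(y, z) = (tail G e, head G e) \<or> (y, z) = (head G e, tail G e)"
      by auto
    then have "edge_path G y [(e, True)] z \<or> edge_path G y [(e, False)] z"
      by (auto simp: init_vertex_def term_vertex_def)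
    then show ?case
      using p edge_path_append by blast
  qed
qed

end

lemma fundamental_group_eq: "fundamental_group \<Gamma> v = word_group {p. edge_path \<Gamma> v p v}"
  by (auto simp: fundamental_group_def word_group_def)

text \<open>
  Homomorphisms out of the fundamental group of a finite connected graph are Lipschitz for word
  length, since the group is generated by one loop for each edge.
\<close>

lemma fundamental_group_hom_Lipschitz:
  assumes G: "fin_digraph \<Gamma>" and v: "v \<in> verts \<Gamma>"
    and C: "word_closed C" and \<theta>: "\<theta> \<in> hom (fundamental_group \<Gamma> v) (word_group C)"
    and s: "\<And>u. u \<in> verts \<Gamma> \<Longrightarrow> edge_path \<Gamma> v (s u) u"
  shows "\<exists>D\<ge>0. \<forall>z u u'. edge_path \<Gamma> u z u' \<longrightarrow>
     length (\<theta> (reduce_word (s u @ z @ inv_word (s u')))) \<le> D * length z"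
proof -
  interpret fin_digraph \<Gamma> by (rule G)
  interpret edge_graph \<Gamma> by unfold_locales
  interpret \<theta>: group_hom "fundamental_group \<Gamma> v" "word_group C" \<theta>
    using group_word_group[OF word_closed_loops[OF v]] group_word_group[OF C] \<theta>
    by (simp add: group_hom_def group_hom_axioms_def fundamental_group_eq)
  define loop where "loop x = reduce_word (s (init_vertex \<Gamma> x) @ [x] @ inv_word (s (term_vertex \<Gamma> x)))" for x
  define D where "D = Max (insert 0 ((\<lambda>x. length (\<theta> (loop x))) ` {x. fst x \<in> arcs \<Gamma>}))"
  have fin: "finite {x :: letter. fst x \<in> arcs \<Gamma>}"
    by (rule finite_subset[of _ "arcs \<Gamma> \<times> UNIV"]) auto
  have D: "length (\<theta> (loop x)) \<le> D" if "fst x \<in> arcs \<Gamma>" for x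
    unfolding D_def using that fin by (intro Max_ge) auto
  have closed: "reduce_word (s u @ z @ inv_word (s u')) \<in> carrier (fundamental_group \<Gamma> v)"
    if "edge_path \<Gamma> u z u'" for u z u'
  proof -
    have "edge_path \<Gamma> v (s u @ z @ inv_word (s u')) v"
      using edge_path_append edge_path_inv_word s edge_path_verts[OF that] that by blast
    then show ?thesis
      by (simp add: fundamental_group_eq edge_path_reduce_word)
  qed
  have "length (\<theta> (reduce_word (s u @ z @ inv_word (s u')))) \<le> D * length z"
    if "edge_path \<Gamma> u z u'" for z u u'
    using that
  proof (induction z arbitrary: u)
    case Nil
    then show ?case
      using \<theta>.hom_one reduce_word_inv_right[of "s u"] by (auto simp: fundamental_group_eq)
  next
    case (Cons x z)
    let ?m = "term_vertex \<Gamma> x"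
    have x: "fst x \<in> arcs \<Gamma>" "init_vertex \<Gamma> x = u" and z: "edge_path \<Gamma> ?m z u'"
      using Cons.prems by simp_all
    have lx: "loop x \<in> carrier (fundamental_group \<Gamma> v)"
      unfolding loop_def using x by (intro closed) (simp add: term_vertex_verts)
    have "reduce_word (s u @ (x # z) @ inv_word (s u'))
        = loop x \<otimes>\<^bsub>fundamental_group \<Gamma> v\<^esub> reduce_word (s ?m @ z @ inv_word (s u'))"
      unfolding fundamental_group_eq word_group_sel loop_def
      by (rule reduce_word_eqI) (simp add: x fg_arith fg_Cons[of x "z @ inv_word (s u')"]
            fg_Cons[of x "inv_word (s ?m)"] del: add_uminus_conv_diff)
    then have "\<theta> (reduce_word (s u @ (x # z) @ inv_word (s u')))
        = reduce_word (\<theta> (loop x) @ \<theta> (reduce_word (s ?m @ z @ inv_word (s u'))))"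
      using \<theta>.hom_mult[OF lx closed[OF z]] by simp
    then have "length (\<theta> (reduce_word (s u @ (x # z) @ inv_word (s u'))))
        \<le> length (\<theta> (loop x)) + length (\<theta> (reduce_word (s ?m @ z @ inv_word (s u'))))"
      by (metis length_append length_reduce_word)
    then show ?case
      using D[OF x(1)] Cons.IH[OF z] by simp
  qed
  then show ?thesis by blast
qed

text \<open>
  A cyclically reduced word is no longer than any of its conjugates: compare a high power of the
  conjugate with the conjugate of the power.
\<close>

lemma reduced_word_concat_replicate:
  assumes "reduced_word (\<sigma> @ \<sigma>)"
  shows "reduced_word (concat (replicate m \<sigma>))"
proof (cases "\<sigma> = []")
  case False
  have "reduced_word (concat (replicate m \<sigma>)) \<and> (m > 0 \<longrightarrow> hd (concat (replicate m \<sigma>)) = hd \<sigma>)"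
    using assms False by (induction m) (auto simp: reduced_word_append)
  then show ?thesis ..
qed simp

lemma cyclically_reduced_length_minimal:
  assumes red: "reduced_word (\<sigma> @ \<sigma>)" and conj: "fg z = fg r + fg \<sigma> - fg r"
  shows "length \<sigma> \<le> length z"
proof (rule ccontr)
  assume "\<not> ?thesis"
  then have less: "length z + 1 \<le> length \<sigma>" by simp
  define m where "m = 2 * length r + 1"
  have pow: "fg (concat (replicate m z)) = fg r + fg (concat (replicate m \<sigma>)) - fg r" for m
  proof (induction m)
    case (Suc m)
    then show ?case
      using conj by (simp add: fg_arith del: add_uminus_conv_diff)
  qed simp
  have len: "length (concat (replicate k w)) = k * length w" for k and w :: "letter list"
    by (induction k) auto
  have "reduce_word (concat (replicate m z)) = reduce_word (r @ concat (replicate m \<sigma>) @ inv_word r)"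
    using pow by (intro reduce_word_eqI) (simp add: fg_arith del: add_uminus_conv_diff)
  then have "length (reduce_word (r @ concat (replicate m \<sigma>) @ inv_word r)) \<le> m * length z"
    by (metis length_reduce_word len)
  moreover have "length (reduce_word (concat (replicate m \<sigma>)))
      \<le> length r + (length r + length (reduce_word (r @ concat (replicate m \<sigma>) @ inv_word r)))"
    using length_reduce_append_right[of "concat (replicate m \<sigma>)" "inv_word r"]
      length_reduce_append_left[of "concat (replicate m \<sigma>) @ inv_word r" r] by simp
  ultimately have "m * length \<sigma> \<le> 2 * length r + m * length z"
    by (simp add: reduced_word_concat_replicate[OF red] len)
  moreover have "m * (length z + 1) \<le> m * length \<sigma>"
    using less by (rule mult_left_mono) simp
  ultimately show False
    by (simp add: m_def)
qed


section \<open>Growth under a graph map\<close>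

abbreviation edge_count :: "letter list \<Rightarrow> nat \<Rightarrow> nat" where
  "edge_count w i \<equiv> count_list (map fst w) i"

lemma edge_count_inv_word [simp]: "edge_count (inv_word w) i = edge_count w i"
  by (induction w) (auto simp: count_list_append)

lemma length_eq_sum_edge_count:
  assumes "fst ` set w \<subseteq> {..<E}"
  shows "length w = (\<Sum>i<E. edge_count w i)"
  using sum_count_set[of "map fst w" "{..<E}"] assms by simp

lemma path_image_funpow_simps [simp]:
  "(path_image f ^^ n) [] = []"
  "(path_image f ^^ n) (u @ w) = (path_image f ^^ n) u @ (path_image f ^^ n) w"
  "(path_image f ^^ n) (inv_word w) = inv_word ((path_image f ^^ n) w)"
  by (induction n) (simp_all add: path_image_inv_word)

lemma path_image_funpow_Cons:
  "(path_image f ^^ n) (x # w) = (path_image f ^^ n) [x] @ (path_image f ^^ n) w"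
  using path_image_funpow_simps(2)[of n f "[x]" w] by simp

lemma edge_count_funpow_letter: "edge_count ((path_image f ^^ n) [x]) i = edge_count ((path_image f ^^ n) [(fst x, True)]) i"
proof (cases "snd x")
  case True
  then show ?thesis by (metis prod.collapse)
next
  case False
  then have "[x] = inv_word [(fst x, True)]"
    by (simp add: prod_eq_iff)
  then show ?thesis
    by (metis edge_count_inv_word path_image_funpow_simps(3))
qed

lemma edge_count_funpow:
  assumes "fst ` set w \<subseteq> {..<E}"
  shows "edge_count ((path_image f ^^ n) w) i
       = (\<Sum>m<E. edge_count ((path_image f ^^ n) [(m, True)]) i * edge_count w m)"
  using assms
proof (induction w)
  case (Cons x w)
  let ?c = "\<lambda>m. edge_count ((path_image f ^^ n) [(m, True)]) i"
  have "edge_count ((path_image f ^^ n) (x # w)) i = ?c (fst x) + (\<Sum>m<E. ?c m * edge_count w m)"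
    using Cons edge_count_funpow_letter[of n f x i]
    by (subst path_image_funpow_Cons) (simp add: count_list_append)
  also have "?c (fst x) = (\<Sum>m<E. if fst x = m then ?c m else 0)"
    using Cons.prems by (subst sum.delta') auto
  also have "\<dots> + (\<Sum>m<E. ?c m * edge_count w m) = (\<Sum>m<E. ?c m * edge_count (x # w) m)"
    unfolding sum.distrib[symmetric] by (rule sum.cong) (auto simp: algebra_simps)
  finally show ?case .
qed simp

text \<open>A graph map together with a positive eigenvector of its transition matrix.\<close>

locale graph_map_eigen =
  fixes \<Gamma> :: "(nat, nat) pre_digraph" and fV :: "nat \<Rightarrow> nat" and f :: "nat \<Rightarrow> letter list"
    and l :: real and wv :: "real vec"
  assumes fin: "fin_digraph \<Gamma>" and arcs: "arcs \<Gamma> = {..<card (arcs \<Gamma>)}"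
    and gm: "graph_map \<Gamma> fV f"
    and eig: "eigenvector (transition_matrix \<Gamma> f) wv l" and pos: "\<forall>i<card (arcs \<Gamma>). 0 < wv $ i"
begin

sublocale \<Gamma>: fin_digraph \<Gamma> by (rule fin)
sublocale \<Gamma>: edge_graph \<Gamma> by unfold_locales

abbreviation "E \<equiv> card (arcs \<Gamma>)"
abbreviation "F \<equiv> path_image f"
abbreviation "A \<equiv> transition_matrix \<Gamma> f"

definition "cnt n i j = edge_count ((F ^^ n) [(j, True)]) i"

lemma carrier_A: "A \<in> carrier_mat E E"
  by (simp add: transition_matrix_def)

lemma arcs_lt: "e \<in> arcs \<Gamma> \<longleftrightarrow> e < E"
  using arcs by auto

lemma E_pos: "0 < E"
proof -
  have "wv \<noteq> 0\<^sub>v E" "wv \<in> carrier_vec E"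
    using eig carrier_A by (auto simp: eigenvector_def)
  then show ?thesis
    by (metis eq_vecI carrier_vecD gr0I index_zero_vec(2) not_less_zero)
qed

lemma edge_path_image: "edge_path \<Gamma> u p v \<Longrightarrow> edge_path \<Gamma> (fV u) (F p) (fV v)"
proof (induction p arbitrary: u)
  case Nil
  then show ?case
    using gm by (auto simp: graph_map_def)
next
  case (Cons x p)
  have e: "edge_path \<Gamma> (fV (tail \<Gamma> (fst x))) (f (fst x)) (fV (head \<Gamma> (fst x)))"
    using Cons.prems gm by (auto simp: graph_map_def)
  have "edge_path \<Gamma> (fV u) (F [x]) (fV (term_vertex \<Gamma> x))"
    using Cons.prems e \<Gamma>.edge_path_inv_word[OF e]
    by (cases "snd x") (auto simp: path_image_Cons init_vertex_def term_vertex_def)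
  then show ?case
    using Cons \<Gamma>.edge_path_append path_image_simps(2)[of f "[x]" p] by (metis append_Cons append_Nil edge_path.simps(2))
qed

lemma edge_path_image_funpow: "edge_path \<Gamma> u p v \<Longrightarrow> edge_path \<Gamma> ((fV ^^ n) u) ((F ^^ n) p) ((fV ^^ n) v)"
  by (induction n) (auto intro: edge_path_image)

lemma edges_funpow: "fst ` set w \<subseteq> {..<E} \<Longrightarrow> fst ` set ((F ^^ n) w) \<subseteq> {..<E}"
proof (induction n)
  case (Suc n)
  have f: "fst ` set (f e) \<subseteq> {..<E}" if "e < E" for e
    using that gm edge_path_arcs arcs by (metis arcs_lt graph_map_def)
  have "fst ` set (F v) \<subseteq> {..<E}" if "fst ` set v \<subseteq> {..<E}" for v
    using that
  proof (induction v)
    case (Cons x v)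
    then show ?case
      using f[of "fst x"] fst_set_inv_word[of "f (fst x)"]
      by (simp add: path_image_Cons image_Un del: set_inv_word fst_set_inv_word)
  qed simp
  then show ?case
    using Suc by simp
qed simp

lemma cnt_Suc: "j < E \<Longrightarrow> cnt (Suc n) i j = (\<Sum>m<E. cnt n i m * edge_count (f j) m)"
proof -
  assume j: "j < E"
  have "(F ^^ Suc n) [(j, True)] = (F ^^ n) (f j)"
    by (simp add: funpow_swap1 path_image_single)
  moreover have "fst ` set (f j) \<subseteq> {..<E}"
    using edges_funpow[of "[(j, True)]" 1] j by (simp add: path_image_single)
  ultimately show ?thesis
    unfolding cnt_def using edge_count_funpow by simp
qed

lemma pow_entry: "i < E \<Longrightarrow> j < E \<Longrightarrow> (A ^\<^sub>m n) $$ (i, j) = real (cnt n i j)"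
proof (induction n arbitrary: j)
  case 0
  then show ?case
    by (simp add: cnt_def transition_matrix_def)
next
  case (Suc n)
  have dim: "dim_row (A ^\<^sub>m n) = E" "dim_col (A ^\<^sub>m n) = E"
    using carrier_A by auto
  have "(A ^\<^sub>m Suc n) $$ (i, j) = (\<Sum>m<E. (A ^\<^sub>m n) $$ (i, m) * A $$ (m, j))"
    using Suc.prems dim carrier_A by (simp add: scalar_prod_def atLeast0LessThan)
  also have "\<dots> = (\<Sum>m<E. real (cnt n i m) * real (edge_count (f j) m))"
    using Suc by (intro sum.cong) (simp_all add: transition_matrix_def)
  finally show ?case
    using Suc.prems by (simp add: cnt_Suc)
qed

lemma eigen_sum: "i < E \<Longrightarrow> (\<Sum>j<E. real (edge_count (f j) i) * wv $ j) = l * wv $ i"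
proof -
  assume i: "i < E"
  have d: "dim_vec wv = E"
    using eig carrier_A by (auto simp: eigenvector_def)
  have "(A *\<^sub>v wv) $ i = (l \<cdot>\<^sub>v wv) $ i"
    using eig by (simp add: eigenvector_def)
  then show ?thesis
    using i d by (simp add: transition_matrix_def scalar_prod_def atLeast0LessThan)
qed

lemma eigen_sum_funpow: "i < E \<Longrightarrow> (\<Sum>j<E. real (cnt n i j) * wv $ j) = l ^ n * wv $ i"
proof (induction n)
  case 0
  have "(\<Sum>j<E. real (cnt 0 i j) * wv $ j) = (\<Sum>j<E. if i = j then wv $ j else 0)"
    by (rule sum.cong) (auto simp: cnt_def)
  then show ?case
    using 0 by simp
next
  case (Suc n)
  have "(\<Sum>j<E. real (cnt (Suc n) i j) * wv $ j)
      = (\<Sum>j<E. \<Sum>m<E. real (cnt n i m) * (real (edge_count (f j) m) * wv $ j))"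
    by (rule sum.cong) (simp_all add: cnt_Suc sum_distrib_right mult.assoc)
  also have "\<dots> = (\<Sum>m<E. real (cnt n i m) * (\<Sum>j<E. real (edge_count (f j) m) * wv $ j))"
    by (subst sum.swap) (simp add: sum_distrib_left)
  also have "\<dots> = (\<Sum>m<E. l * (real (cnt n i m) * wv $ m))"
    by (rule sum.cong) (simp_all add: eigen_sum)
  also have "\<dots> = l * (\<Sum>m<E. real (cnt n i m) * wv $ m)"
    by (rule sum_distrib_left[symmetric])
  finally show ?case
    using Suc by simp
qed

definition "len n j = length ((F ^^ n) [(j, True)])"

lemma len_eq: "j < E \<Longrightarrow> len n j = (\<Sum>i<E. cnt n i j)"
  unfolding len_def cnt_def by (rule length_eq_sum_edge_count) (rule edges_funpow, simp)

lemma eigen_len: "(\<Sum>j<E. real (len n j) * wv $ j) = l ^ n * (\<Sum>i<E. wv $ i)"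
proof -
  have "(\<Sum>j<E. real (len n j) * wv $ j) = (\<Sum>j<E. \<Sum>i<E. real (cnt n i j) * wv $ j)"
    by (rule sum.cong) (simp_all add: len_eq sum_distrib_right)
  also have "\<dots> = (\<Sum>i<E. l ^ n * wv $ i)"
    by (subst sum.swap) (simp add: eigen_sum_funpow)
  finally show ?thesis
    by (simp add: sum_distrib_left)
qed

lemma length_funpow:
  assumes "fst ` set w \<subseteq> {..<E}"
  shows "length ((F ^^ n) w) = (\<Sum>j<E. len n j * edge_count w j)"
proof -
  have "length ((F ^^ n) w) = (\<Sum>i<E. \<Sum>j<E. cnt n i j * edge_count w j)"
    using length_eq_sum_edge_count[OF edges_funpow[OF assms]] edge_count_funpow[OF assms, of n f]
    by (simp add: cnt_def)
  also have "\<dots> = (\<Sum>j<E. \<Sum>i<E. cnt n i j * edge_count w j)"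
    by (rule sum.swap)
  finally show ?thesis
    by (simp add: len_eq sum_distrib_right)
qed

lemma growth_upper: "\<exists>C\<ge>0. \<forall>n w. fst ` set w \<subseteq> {..<E} \<longrightarrow> length ((F ^^ n) w) \<le> C * l ^ n * length w"
proof -
  let ?W = "\<Sum>i<E. wv $ i"
  define C where "C = (\<Sum>j<E. ?W / wv $ j)"
  have W: "?W \<ge> 0"
    using pos by (intro sum_nonneg) (simp add: less_imp_le)
  have C: "?W / wv $ j \<le> C" if "j < E" for j
    unfolding C_def using that pos W by (intro member_le_sum) (auto simp: less_imp_le)
  have l: "l ^ n \<ge> 0" for n
  proof -
    have "0 \<le> l ^ n * wv $ 0"
      unfolding eigen_sum_funpow[OF E_pos, symmetric] using pos by (intro sum_nonneg) (simp add: less_imp_le)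
    then show ?thesis
      using pos E_pos by (simp add: zero_le_mult_iff) (metis less_le_not_le)
  qed
  have len: "real (len n j) \<le> C * l ^ n" if "j < E" for n j
  proof -
    have "real (len n j) * wv $ j \<le> (\<Sum>j<E. real (len n j) * wv $ j)"
      using that pos by (intro member_le_sum[where f = "\<lambda>j. real (len n j) * wv $ j"]) (auto simp: less_imp_le)
    then have "real (len n j) \<le> l ^ n * (?W / wv $ j)"
      using pos that by (simp add: eigen_len pos_le_divide_eq)
    also have "\<dots> \<le> l ^ n * C"
      using C[OF that] l by (rule mult_left_mono)
    finally show ?thesis by (simp add: mult.commute)
  qed
  have "length ((F ^^ n) w) \<le> C * l ^ n * length w" if w: "fst ` set w \<subseteq> {..<E}" for n w
  proof -
    have "real (length ((F ^^ n) w)) = (\<Sum>j<E. real (len n j) * real (edge_count w j))"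
      by (simp add: length_funpow[OF w])
    also have "\<dots> \<le> (\<Sum>j<E. (C * l ^ n) * real (edge_count w j))"
      by (intro sum_mono mult_right_mono) (simp_all add: len)
    also have "\<dots> = C * l ^ n * length w"
      by (simp add: length_eq_sum_edge_count[OF w] flip: sum_distrib_left)
    finally show ?thesis .
  qed
  moreover have "C \<ge> 0"
    unfolding C_def using pos W by (intro sum_nonneg) (auto simp: less_imp_le)
  ultimately show ?thesis by blast
qed

lemma long_edge: "\<exists>j<E. real (len n j) \<ge> l ^ n"
proof (rule ccontr)
  assume "\<not> ?thesis"
  then have "(\<Sum>j<E. real (len n j) * wv $ j) < (\<Sum>j<E. l ^ n * wv $ j)"
    using E_pos pos by (intro sum_strict_mono mult_strict_right_mono) (auto simp: not_le)
  then show False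
    by (simp add: eigen_len sum_distrib_left)
qed

context
  assumes irr: "irreducible_mat A"
begin

lemma irreducible_cnt: "i < E \<Longrightarrow> j < E \<Longrightarrow> \<exists>n\<ge>1. cnt n i j \<ge> 1"
proof -
  assume ij: "i < E" "j < E"
  then obtain n where "n \<ge> 1" "0 < (A ^\<^sub>m n) $$ (i, j)"
    using irr carrier_A by (auto simp: irreducible_mat_def)
  then show ?thesis
    using pow_entry[OF ij] by (intro exI[of _ n]) auto
qed

lemma eigenvalue_ge_1: "l \<ge> 1"
proof -
  obtain n where n: "n \<ge> 1" "cnt n 0 0 \<ge> 1"
    using irreducible_cnt[OF E_pos E_pos] by blast
  have w0: "wv $ 0 > 0"
    using pos E_pos by simp
  have "1 * wv $ 0 \<le> real (cnt n 0 0) * wv $ 0"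
    using n w0 by (intro mult_right_mono) auto
  also have "\<dots> \<le> (\<Sum>j<E. real (cnt n 0 j) * wv $ j)"
    using E_pos pos by (intro member_le_sum[where f = "\<lambda>j. real (cnt n 0 j) * wv $ j"]) (auto simp: less_imp_le)
  also have "\<dots> = l ^ n * wv $ 0"
    by (rule eigen_sum_funpow[OF E_pos])
  finally have ln: "1 \<le> l ^ n"
    using w0 by simp
  have "0 \<le> l * wv $ 0"
    unfolding eigen_sum[OF E_pos, symmetric] using pos by (intro sum_nonneg) (simp add: less_imp_le)
  then have "0 \<le> l"
    using w0 by (simp add: zero_le_mult_iff)
  then show ?thesis
    using ln power_less_one_iff[of l n] n(1) by (cases "l < 1") auto
qed

lemma growth_lower:
  "\<exists>M. \<forall>w n. w \<noteq> [] \<longrightarrow> fst ` set w \<subseteq> {..<E} \<longrightarrow> (\<exists>m\<le>M. real (length ((F ^^ (n + m)) w)) \<ge> l ^ n)"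
proof -
  have "\<forall>p\<in>{..<E} \<times> {..<E}. \<exists>m. cnt m (fst p) (snd p) \<ge> 1"
    using irreducible_cnt by force
  then obtain m where m: "\<forall>p\<in>{..<E} \<times> {..<E}. cnt (m p) (fst p) (snd p) \<ge> 1"
    by metis
  define M where "M = Max (m ` ({..<E} \<times> {..<E}))"
  have "\<exists>m\<le>M. real (length ((F ^^ (n + m)) w)) \<ge> l ^ n" if w: "w \<noteq> []" "fst ` set w \<subseteq> {..<E}" for w n
  proof -
    obtain j where j: "j < E" "l ^ n \<le> real (len n j)"
      using long_edge by blast
    define e where "e = fst (hd w)"
    have e: "e < E" "edge_count w e \<ge> 1"
      using w by (cases w; auto simp: e_def)+
    define k where "k = m (j, e)"
    have k: "k \<le> M"
      unfolding M_def k_def using j e by (intro Max_ge) auto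
    have cnt: "cnt k j e \<ge> 1"
      using m j e by (auto simp: k_def)
    have "1 \<le> edge_count ((F ^^ k) w) j"
    proof -
      have "1 \<le> cnt k j e * edge_count w e"
        using cnt e(2) by (simp add: Suc_le_eq)
      also have "\<dots> \<le> (\<Sum>m<E. cnt k j m * edge_count w m)"
        using e(1) by (intro member_le_sum[where f = "\<lambda>m. cnt k j m * edge_count w m"]) auto
      finally show ?thesis
        by (simp add: edge_count_funpow[OF w(2)] cnt_def)
    qed
    then have "len n j \<le> len n j * edge_count ((F ^^ k) w) j"
      by simp
    also have "\<dots> \<le> (\<Sum>j<E. len n j * edge_count ((F ^^ k) w) j)"
      using j member_le_sum[of j "{..<E}" "\<lambda>j. len n j * edge_count ((F ^^ k) w) j"] by simp
    also have "\<dots> = length ((F ^^ n) ((F ^^ k) w))"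
      by (rule length_funpow[symmetric]) (rule edges_funpow[OF w(2)])
    finally have "len n j \<le> length ((F ^^ (n + k)) w)"
      by (simp add: funpow_add)
    then show ?thesis
      using k j by (intro exI[of _ k]) auto
  qed
  then show ?thesis by blast
qed

end

text \<open>
  If the eigenvalue exceeds 1, the images of some edge get long enough to cross an edge twice in
  the same direction.  The loop between the two crossings stays cyclically reduced under all
  iterates of a train track map.
\<close>

lemma cyclically_legal_loop:
  assumes tt: "train_track \<Gamma> f" and l: "l > 1"
  shows "\<exists>u \<sigma>. \<sigma> \<noteq> [] \<and> edge_path \<Gamma> u \<sigma> u \<and> (\<forall>n. reduced_word ((F ^^ n) \<sigma> @ (F ^^ n) \<sigma>))"
proof -
  obtain n where n: "l ^ n > real (2 * E)"
    using real_arch_pow[OF l] by blast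
  obtain j where j: "j < E" "real (len n j) \<ge> l ^ n"
    using long_edge by blast
  define w where "w = (F ^^ n) [(j, True)]"
  have len: "length w > 2 * E"
    using n j unfolding len_def w_def by linarith
  have "\<not> distinct w"
  proof
    assume d: "distinct w"
    have "fst ` set w \<subseteq> {..<E}"
      unfolding w_def by (rule edges_funpow) (simp add: j)
    then have "set w \<subseteq> {..<E} \<times> (UNIV :: bool set)"
      by auto
    then have "card (set w) \<le> card ({..<E} \<times> (UNIV :: bool set))"
      by (intro card_mono) auto
    then show False
      using len d by (simp add: distinct_card card_cartesian_product)
  qed
  then obtain p q r x where w: "w = p @ [x] @ q @ [x] @ r"
    using not_distinct_decomp by blast
  have fe: "f e \<noteq> []" if "e < E" for e
    using gm that arcs_lt by (auto simp: graph_map_def)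
  have ne: "(F ^^ m) v \<noteq> []" if "v \<noteq> []" "fst ` set v \<subseteq> {..<E}" for m v
    using that
  proof (induction m)
    case (Suc m)
    have "F v' \<noteq> []" if "v' \<noteq> []" "fst ` set v' \<subseteq> {..<E}" for v'
      using that fe by (cases v') (auto simp: path_image_Cons)
    then show ?case
      using Suc edges_funpow by simp
  qed simp
  have xw: "fst x < E"
    using edges_funpow[of "[(j, True)]" n] j w unfolding w_def[symmetric] by auto
  define \<sigma> where "\<sigma> = x # q"
  have red: "reduced_word ((F ^^ m) \<sigma> @ (F ^^ m) \<sigma>)" for m
  proof -
    have "reduced_word ((F ^^ m) w)"
    proof (cases "m + n = 0")
      case True
      then show ?thesis by (simp add: w_def)
    next
      case False
      then have "reduced_word ((F ^^ (m + n)) [(j, True)])"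
        using tt j arcs_lt by (auto simp: train_track_def)
      then show ?thesis
        by (simp add: w_def funpow_add)
    qed
    moreover have "(F ^^ m) w = (F ^^ m) p @ ((F ^^ m) \<sigma> @ (F ^^ m) [x]) @ (F ^^ m) r"
      by (simp add: w \<sigma>_def path_image_funpow_Cons[of m f x q] path_image_funpow_Cons[of m f x "q @ _"]
            path_image_funpow_Cons[of m f x r])
    ultimately have 1: "reduced_word ((F ^^ m) \<sigma> @ (F ^^ m) [x])"
      using reduced_word_append[of "(F ^^ m) p" "((F ^^ m) \<sigma> @ (F ^^ m) [x]) @ (F ^^ m) r"]
        reduced_word_append[of "(F ^^ m) \<sigma> @ (F ^^ m) [x]" "(F ^^ m) r"] by metis
    have nx: "(F ^^ m) [x] \<noteq> []"
      using xw by (intro ne) auto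
    have \<sigma>x: "(F ^^ m) \<sigma> = (F ^^ m) [x] @ (F ^^ m) q"
      unfolding \<sigma>_def by (rule path_image_funpow_Cons)
    have "hd ((F ^^ m) \<sigma>) = hd ((F ^^ m) [x])"
      using nx by (simp add: \<sigma>x)
    then show ?thesis
      using 1 nx by (simp add: reduced_word_append)
  qed
  have "edge_path \<Gamma> (tail \<Gamma> j) [(j, True)] (head \<Gamma> j)"
    using j arcs_lt by (simp add: init_vertex_def term_vertex_def)
  then have "edge_path \<Gamma> ((fV ^^ n) (tail \<Gamma> j)) w ((fV ^^ n) (head \<Gamma> j))"
    unfolding w_def by (rule edge_path_image_funpow)
  then obtain m1 m2 where "edge_path \<Gamma> m1 ([x] @ q) m2" "edge_path \<Gamma> m2 ([x] @ r) ((fV ^^ n) (head \<Gamma> j))"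
    unfolding w \<Gamma>.edge_path_append by blast
  then have "edge_path \<Gamma> (init_vertex \<Gamma> x) \<sigma> (init_vertex \<Gamma> x)"
    by (auto simp: \<sigma>_def)
  then show ?thesis
    using red by (intro exI[of _ "init_vertex \<Gamma> x"] exI[of _ \<sigma>]) (simp add: \<sigma>_def)
qed

end


section \<open>Uniqueness of the stretch factor\<close>

lemma irreducible_train_track_repD:
  assumes "irreducible_train_track_rep N \<phi> \<Gamma> fV f" "PF_eigenvalue (transition_matrix \<Gamma> f) l"
  obtains wv v \<tau> \<alpha> p where "graph_map_eigen \<Gamma> fV f l wv" "train_track \<Gamma> f"
    "irreducible_mat (transition_matrix \<Gamma> f)" "Digraph_Component.connected \<Gamma>" "v \<in> verts \<Gamma>"
    "\<tau> \<in> iso (free_group N) (fundamental_group \<Gamma> v)" "\<alpha> \<in> \<phi>" "edge_path \<Gamma> v p (fV v)"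
    "\<forall>x\<in>carrier (free_group N). \<tau> (\<alpha> x) = reduce_word (p @ path_image f (\<tau> x) @ inv_word p)"
proof -
  obtain wv where w: "eigenvector (transition_matrix \<Gamma> f) wv l" "\<forall>i<card (arcs \<Gamma>). 0 < wv $ i"
    using assms(2) by (auto simp: PF_eigenvalue_def transition_matrix_def)
  obtain v \<tau> \<alpha> p where "graph_map \<Gamma> fV f" "marked_graph N \<Gamma> v \<tau>" "\<alpha> \<in> \<phi>" "edge_path \<Gamma> v p (fV v)"
      "\<forall>x\<in>carrier (free_group N). \<tau> (\<alpha> x) = reduce_word (p @ path_image f (\<tau> x) @ inv_word p)"
    using assms(1) unfolding irreducible_train_track_rep_def topological_representative_def by blast
  moreover have "train_track \<Gamma> f" "irreducible_mat (transition_matrix \<Gamma> f)"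
    using assms(1) by (auto simp: irreducible_train_track_rep_def)
  ultimately show ?thesis
    using w by (intro that[of wv v \<tau> \<alpha> p])
      (auto simp: marked_graph_def graph_map_eigen_def)
qed

text \<open>
  Let \<open>l > 1\<close> be the eigenvalue of one train track representative and \<open>l'\<close> that of another.  The
  cyclically legal loop in the first graph grows at least like \<open>l\<^sup>n\<close> under the iterates.  The
  same conjugacy class, read in the second graph, has length at most a constant times \<open>l'\<^sup>n\<close>, and
  changing the marking distorts lengths by at most a constant factor.
\<close>

lemma train_track_eigenvalue_le:
  assumes \<phi>: "\<phi> \<in> carrier (Out (free_group N))"
    and rep: "irreducible_train_track_rep N \<phi> \<Gamma> fV f" "PF_eigenvalue (transition_matrix \<Gamma> f) l"
    and rep': "irreducible_train_track_rep N \<phi> \<Gamma>' fV' f'" "PF_eigenvalue (transition_matrix \<Gamma>' f') l'"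
  shows "l \<le> l'"
proof (rule ccontr)
  assume "\<not> l \<le> l'"
  let ?F = "free_group N"
  interpret FG: group ?F by (rule group_free_group)
  obtain wv v \<tau> \<alpha> p where gme: "graph_map_eigen \<Gamma> fV f l wv" and tt: "train_track \<Gamma> f"
    and irr: "irreducible_mat (transition_matrix \<Gamma> f)" and conn: "Digraph_Component.connected \<Gamma>"
    and v: "v \<in> verts \<Gamma>" and \<tau>: "\<tau> \<in> iso ?F (fundamental_group \<Gamma> v)" and \<alpha>: "\<alpha> \<in> \<phi>"
    and p: "edge_path \<Gamma> v p (fV v)"
    and eq: "\<forall>x\<in>carrier ?F. \<tau> (\<alpha> x) = reduce_word (p @ path_image f (\<tau> x) @ inv_word p)"
    by (rule irreducible_train_track_repD[OF rep])
  obtain wv' v' \<tau>' \<alpha>' p' where gme': "graph_map_eigen \<Gamma>' fV' f' l' wv'" and "train_track \<Gamma>' f'"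
    and irr': "irreducible_mat (transition_matrix \<Gamma>' f')" and conn': "Digraph_Component.connected \<Gamma>'"
    and v': "v' \<in> verts \<Gamma>'" and \<tau>': "\<tau>' \<in> iso ?F (fundamental_group \<Gamma>' v')" and \<alpha>': "\<alpha>' \<in> \<phi>"
    and p': "edge_path \<Gamma>' v' p' (fV' v')"
    and eq': "\<forall>x\<in>carrier ?F. \<tau>' (\<alpha>' x) = reduce_word (p' @ path_image f' (\<tau>' x) @ inv_word p')"
    by (rule irreducible_train_track_repD[OF rep'])
  interpret g: graph_map_eigen \<Gamma> fV f l wv by (rule gme)
  interpret g': graph_map_eigen \<Gamma>' fV' f' l' wv' by (rule gme')
  have l': "l' \<ge> 1"
    by (rule g'.eigenvalue_ge_1[OF irr'])
  with \<open>\<not> l \<le> l'\<close> have l: "l > l'" "l > 1" by auto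
  obtain u \<sigma> where \<sigma>: "\<sigma> \<noteq> []" "edge_path \<Gamma> u \<sigma> u" "\<And>n. reduced_word ((g.F ^^ n) \<sigma> @ (g.F ^^ n) \<sigma>)"
    using g.cyclically_legal_loop[OF tt l(2)] by blast

  \<comment> \<open>automorphisms in the same outer class, and the markings as group isomorphisms\<close>
  obtain \<gamma> where \<gamma>: "\<gamma> \<in> auto ?F" "\<phi> = outer ?F \<gamma>"
    using \<phi> by (auto simp: FG.carrier_Out)
  have auto: "\<alpha> \<in> auto ?F" "\<alpha>' \<in> auto ?F"
    using FG.outer_memD \<gamma> \<alpha> \<alpha>' by auto
  have "\<alpha>' \<in> outer ?F \<alpha>"
    using FG.outer_eqI \<gamma> \<alpha> \<alpha>' by metis
  then obtain h where h: "h \<in> carrier ?F" "\<alpha>' = compose (carrier ?F) (inner_aut ?F h) \<alpha>"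
    by (auto simp: FG.outer_def2[OF auto(1)])
  have word_\<alpha>: "fg (\<alpha> x) = fg (path_image (\<lambda>i. \<alpha> [(i, True)]) x)" if "x \<in> carrier ?F" for x
    using hom_free_group_path_image[of \<alpha> N "words N" x] auto_hom[OF auto(1)] that
    by (auto simp: free_group_eq)
  have iter_closed: "(\<beta> ^^ n) x \<in> carrier ?F" if "\<beta> \<in> auto ?F" "x \<in> carrier ?F" for \<beta> n x
    using that by (induction n) (auto simp: auto_closed simp del: free_group_sel(1))
  interpret \<tau>: group_hom ?F "fundamental_group \<Gamma> v" \<tau>
    using \<tau> group_word_group[OF g.\<Gamma>.word_closed_loops[OF v]] group_free_group
    by (simp add: iso_def group_hom_def group_hom_axioms_def fundamental_group_eq)
  interpret \<tau>': group_hom ?F "fundamental_group \<Gamma>' v'" \<tau>'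
    using \<tau>' group_word_group[OF g'.\<Gamma>.word_closed_loops[OF v']] group_free_group
    by (simp add: iso_def group_hom_def group_hom_axioms_def fundamental_group_eq)
  have conj_hom: "fg (\<theta> z) = fg (\<theta> k) + fg (\<theta> y) - fg (\<theta> k)"
    if \<theta>: "\<theta> \<in> hom (word_group C) (word_group D)" and C: "word_closed C" and D: "word_closed D"
      and k: "k \<in> carrier (word_group C)" and y: "y \<in> carrier (word_group C)" and z: "z \<in> carrier (word_group C)"
      and zky: "fg z = fg k + fg y - fg k" for \<theta> C D k y z
  proof -
    interpret \<theta>: group_hom "word_group C" "word_group D" \<theta>
      using C D \<theta> by (simp add: group_hom_def group_hom_axioms_def group_word_group)
    have "z \<otimes>\<^bsub>word_group C\<^esub> k = k \<otimes>\<^bsub>word_group C\<^esub> y"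
      using zky by (simp add: fg_eq_iff[symmetric] fg_arith del: add_uminus_conv_diff)
    then have "\<theta> z \<otimes>\<^bsub>word_group D\<^esub> \<theta> k = \<theta> k \<otimes>\<^bsub>word_group D\<^esub> \<theta> y"
      using \<theta>.hom_mult k y z by metis
    then have "fg (\<theta> z) + fg (\<theta> k) = fg (\<theta> k) + fg (\<theta> y)"
      by (simp add: fg_eq_iff[symmetric])
    then show ?thesis
      by (simp add: eq_diff_eq)
  qed

  \<comment> \<open>the conjugacy class of the loop, as an element of the free group\<close>
  obtain t where t: "edge_path \<Gamma> v t u"
    using g.\<Gamma>.connected_edge_path[OF conn v] g.\<Gamma>.edge_path_verts[OF \<sigma>(2)] by blast
  define y where "y = reduce_word (t @ \<sigma> @ inv_word t)"
  have "y \<in> carrier (fundamental_group \<Gamma> v)"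
    using g.\<Gamma>.edge_path_append g.\<Gamma>.edge_path_inv_word[OF t] t \<sigma>(2) g.\<Gamma>.edge_path_reduce_word
    by (auto simp: y_def fundamental_group_eq) blast
  moreover have "\<tau> ` carrier ?F = carrier (fundamental_group \<Gamma> v)"
    using \<tau> unfolding iso_def bij_betw_def by blast
  ultimately have "y \<in> \<tau> ` carrier ?F"
    by (simp only:)
  then obtain x where x: "x \<in> carrier ?F" "\<tau> x = y"
    by (elim imageE) simp
  have claim1: "\<exists>q. fg (\<tau> ((\<alpha> ^^ n) x)) = fg q + fg ((g.F ^^ n) \<sigma>) - fg q" for n
  proof (induction n)
    case 0
    then show ?case
      using x by (intro exI[of _ t]) (simp add: y_def fg_arith del: add_uminus_conv_diff)
  next
    case (Suc n)
    then obtain q where q: "fg (\<tau> ((\<alpha> ^^ n) x)) = fg (q @ (g.F ^^ n) \<sigma> @ inv_word q)"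
      by (auto simp: fg_arith simp del: add_uminus_conv_diff)
    have "fg (\<tau> ((\<alpha> ^^ Suc n) x)) = fg (p @ g.F (\<tau> ((\<alpha> ^^ n) x)) @ inv_word p)"
      using eq[rule_format, OF iter_closed[OF auto(1) x(1)], of n] by simp
    also have "\<dots> = fg ((p @ g.F q) @ (g.F ^^ Suc n) \<sigma> @ inv_word (p @ g.F q))"
      using fg_path_image_cong[OF q, of f]
      by (simp add: path_image_inv_word fg_arith del: add_uminus_conv_diff)
    finally show ?case
      by (intro exI[of _ "p @ g.F q"]) (simp add: fg_arith del: add_uminus_conv_diff)
  qed
  have claim2: "\<exists>q. edge_path \<Gamma>' v' q ((fV' ^^ n) v') \<and>
      fg (\<tau>' ((\<alpha>' ^^ n) x)) = fg q + fg ((g'.F ^^ n) (\<tau>' x)) - fg q" for n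
  proof (induction n)
    case 0
    then show ?case
      using v' by (intro exI[of _ "[]"]) simp
  next
    case (Suc n)
    then obtain q where qp: "edge_path \<Gamma>' v' q ((fV' ^^ n) v')"
      and q: "fg (\<tau>' ((\<alpha>' ^^ n) x)) = fg (q @ (g'.F ^^ n) (\<tau>' x) @ inv_word q)"
      by (auto simp: fg_arith simp del: add_uminus_conv_diff)
    have "fg (\<tau>' ((\<alpha>' ^^ Suc n) x)) = fg (p' @ g'.F (\<tau>' ((\<alpha>' ^^ n) x)) @ inv_word p')"
      using eq'[rule_format, OF iter_closed[OF auto(2) x(1)], of n] by simp
    also have "\<dots> = fg ((p' @ g'.F q) @ (g'.F ^^ Suc n) (\<tau>' x) @ inv_word (p' @ g'.F q))"
      using fg_path_image_cong[OF q, of f']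
      by (simp add: path_image_inv_word fg_arith del: add_uminus_conv_diff)
    finally have "fg (\<tau>' ((\<alpha>' ^^ Suc n) x))
        = fg (p' @ g'.F q) + fg ((g'.F ^^ Suc n) (\<tau>' x)) - fg (p' @ g'.F q)"
      by (simp add: fg_arith del: add_uminus_conv_diff)
    moreover have "edge_path \<Gamma>' v' (p' @ g'.F q) ((fV' ^^ Suc n) v')"
      using g'.\<Gamma>.edge_path_append p' g'.edge_path_image[OF qp] by auto
    ultimately show ?case by blast
  qed
  have claim3: "\<exists>k\<in>carrier ?F. fg ((\<alpha>' ^^ n) x) = fg k + fg ((\<alpha> ^^ n) x) - fg k" for n
  proof (induction n)
    case 0
    then show ?case
      by (intro bexI[of _ "[]"]) simp_all
  next
    case (Suc n)
    then obtain k where k: "k \<in> carrier ?F" "fg ((\<alpha>' ^^ n) x) = fg k + fg ((\<alpha> ^^ n) x) - fg k" by blast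
    have \<alpha>k: "\<alpha> k \<in> carrier ?F" "\<alpha> ((\<alpha>' ^^ n) x) \<in> carrier ?F"
      using auto_closed[OF auto(1)] k(1) iter_closed[OF auto(2) x(1)] by blast+
    have "fg (\<alpha> ((\<alpha>' ^^ n) x)) = fg (\<alpha> k) + fg (\<alpha> ((\<alpha> ^^ n) x)) - fg (\<alpha> k)"
      by (rule conj_hom[of \<alpha> "words N" "words N"])
        (use auto_hom[OF auto(1)] k iter_closed[OF auto(1) x(1)] iter_closed[OF auto(2) x(1)] in
          \<open>auto simp: free_group_eq\<close>)
    moreover have "fg ((\<alpha>' ^^ Suc n) x) = fg h + fg (\<alpha> ((\<alpha>' ^^ n) x)) - fg h"
      using h \<alpha>k(2) iter_closed[OF auto(2) x(1), of n]
      by (simp add: compose_def inner_aut_def inv_free_group fg_arith del: add_uminus_conv_diff)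
    ultimately show ?case
      using h(1) \<alpha>k(1) by (intro bexI[of _ "reduce_word (h @ \<alpha> k)"])
        (simp_all add: fg_arith words_reduce del: add_uminus_conv_diff)
  qed

  \<comment> \<open>change of marking\<close>
  define \<theta> where "\<theta> = \<tau> \<circ> inv_into (carrier ?F) \<tau>'"
  have \<theta>_hom: "\<theta> \<in> hom (fundamental_group \<Gamma>' v') (fundamental_group \<Gamma> v)"
    using FG.iso_set_sym[OF \<tau>'] \<tau> unfolding \<theta>_def by (intro hom_compose) (auto simp: iso_def)
  have \<theta>\<tau>': "\<theta> (\<tau>' z) = \<tau> z" if "z \<in> carrier ?F" for z
    using that \<tau>' by (simp add: \<theta>_def iso_def bij_betw_def inv_into_f_f del: free_group_sel(1))
  have "\<forall>w\<in>verts \<Gamma>'. \<exists>s. edge_path \<Gamma>' v' s w"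
    using g'.\<Gamma>.connected_edge_path[OF conn' v'] by blast
  then obtain s where s: "\<And>w. w \<in> verts \<Gamma>' \<Longrightarrow> edge_path \<Gamma>' v' (s w) w" by metis
  obtain D where D: "D \<ge> (0::nat)" "\<And>z w w'. edge_path \<Gamma>' w z w' \<Longrightarrow>
      length (\<theta> (reduce_word (s w @ z @ inv_word (s w')))) \<le> D * length z"
    using fundamental_group_hom_Lipschitz[OF g'.fin v' g.\<Gamma>.word_closed_loops[OF v] \<theta>_hom[unfolded fundamental_group_eq[of \<Gamma>]] s]
    by blast
  have \<tau>'x: "\<tau>' x \<in> carrier (fundamental_group \<Gamma>' v')"
    using \<tau>'.hom_closed[OF x(1)] .
  then have loop': "edge_path \<Gamma>' v' (\<tau>' x) v'"
    by (simp add: fundamental_group_eq)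
  have compare: "length ((g.F ^^ n) \<sigma>) \<le> D * length ((g'.F ^^ n) (\<tau>' x))" for n
  proof -
    let ?w = "(fV' ^^ n) v'" and ?z = "(g'.F ^^ n) (\<tau>' x)"
    have path: "edge_path \<Gamma>' ?w ?z ?w"
      by (rule g'.edge_path_image_funpow[OF loop'])
    then have w: "?w \<in> verts \<Gamma>'"
      using g'.\<Gamma>.edge_path_verts by blast
    obtain q where q: "edge_path \<Gamma>' v' q ?w" "fg (\<tau>' ((\<alpha>' ^^ n) x)) = fg q + fg ?z - fg q"
      using claim2 by blast
    obtain k where k: "k \<in> carrier ?F" "fg ((\<alpha>' ^^ n) x) = fg k + fg ((\<alpha> ^^ n) x) - fg k"
      using claim3 by blast
    obtain r where r: "fg (\<tau> ((\<alpha> ^^ n) x)) = fg r + fg ((g.F ^^ n) \<sigma>) - fg r"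
      using claim1 by blast
    let ?y = "reduce_word (s ?w @ ?z @ inv_word (s ?w))" and ?d = "reduce_word (s ?w @ inv_word q)"
    have y: "?y \<in> carrier (fundamental_group \<Gamma>' v')"
      using g'.\<Gamma>.edge_path_append g'.\<Gamma>.edge_path_inv_word[OF s[OF w]] s[OF w] path
        g'.\<Gamma>.edge_path_reduce_word by (auto simp: fundamental_group_eq) blast
    have d: "?d \<in> carrier (fundamental_group \<Gamma>' v')"
      using g'.\<Gamma>.edge_path_append g'.\<Gamma>.edge_path_inv_word[OF q(1)] s[OF w]
        g'.\<Gamma>.edge_path_reduce_word by (auto simp: fundamental_group_eq) blast
    have "fg ?z = - fg q + fg (\<tau>' ((\<alpha>' ^^ n) x)) + fg q"
      using q(2) by (simp add: fg_arith del: add_uminus_conv_diff)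
    then have "fg (\<theta> ?y) = fg (\<theta> ?d) + fg (\<theta> (\<tau>' ((\<alpha>' ^^ n) x))) - fg (\<theta> ?d)"
      using y d \<tau>'.hom_closed[OF iter_closed[OF auto(2) x(1)], of n] \<theta>_hom
      by (intro conj_hom[of \<theta> "{p. edge_path \<Gamma>' v' p v'}" "{p. edge_path \<Gamma> v p v}"])
        (auto simp: fundamental_group_eq g.\<Gamma>.word_closed_loops g'.\<Gamma>.word_closed_loops v v' fg_arith
          simp del: add_uminus_conv_diff)
    moreover have "fg (\<tau> ((\<alpha>' ^^ n) x)) = fg (\<tau> k) + fg (\<tau> ((\<alpha> ^^ n) x)) - fg (\<tau> k)"
      using k iter_closed[OF auto(1) x(1), of n] iter_closed[OF auto(2) x(1), of n] \<tau>
      by (intro conj_hom[of \<tau> "words N" "{p. edge_path \<Gamma> v p v}"])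
        (auto simp: free_group_eq fundamental_group_eq iso_def g.\<Gamma>.word_closed_loops v)
    ultimately have "fg (\<theta> ?y) = fg (\<theta> ?d @ \<tau> k @ r) + fg ((g.F ^^ n) \<sigma>) - fg (\<theta> ?d @ \<tau> k @ r)"
      using \<theta>\<tau>'[OF iter_closed[OF auto(2) x(1)], of n] r by (simp add: fg_arith del: add_uminus_conv_diff)
    then have "length ((g.F ^^ n) \<sigma>) \<le> length (\<theta> ?y)"
      by (rule cyclically_reduced_length_minimal[OF \<sigma>(3)])
    then show ?thesis
      using D(2)[OF path] by linarith
  qed

  \<comment> \<open>comparing the growth rates\<close>
  obtain C where C: "C \<ge> 0" "\<And>n w. fst ` set w \<subseteq> {..<g'.E} \<Longrightarrow> length ((g'.F ^^ n) w) \<le> C * l' ^ n * length w"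
    using g'.growth_upper by blast
  obtain M where M: "\<And>w n. w \<noteq> [] \<Longrightarrow> fst ` set w \<subseteq> {..<g.E} \<Longrightarrow>
      (\<exists>m\<le>M. real (length ((g.F ^^ (n + m)) w)) \<ge> l ^ n)"
    using g.growth_lower[OF irr] by blast
  define K where "K = D * (C * length (\<tau>' x)) * l' ^ M"
  have bound: "l ^ n \<le> K * l' ^ n" for n
  proof -
    have "fst ` set \<sigma> \<subseteq> {..<g.E}"
      using edge_path_arcs[OF \<sigma>(2)] g.arcs by blast
    then obtain m where m: "m \<le> M" "real (length ((g.F ^^ (n + m)) \<sigma>)) \<ge> l ^ n"
      using M[OF \<sigma>(1)] by blast
    have "real (length ((g.F ^^ (n + m)) \<sigma>)) \<le> D * real (length ((g'.F ^^ (n + m)) (\<tau>' x)))"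
      using compare[of "n + m"] by (metis of_nat_le_iff of_nat_mult)
    also have "\<dots> \<le> D * (C * l' ^ (n + m) * length (\<tau>' x))"
      using C(2)[of "\<tau>' x" "n + m"] edge_path_arcs[OF loop'] g'.arcs by (intro mult_left_mono) auto
    also have "\<dots> = D * (C * length (\<tau>' x)) * l' ^ m * l' ^ n"
      by (simp add: power_add)
    also have "\<dots> \<le> K * l' ^ n"
      unfolding K_def using C(1) l' m(1) by (intro mult_right_mono mult_left_mono power_increasing) auto
    finally show ?thesis
      using m(2) by linarith
  qed
  obtain n where "(l / l') ^ n > K"
    using real_arch_pow[of "l / l'" K] l l' by auto
  then have "l ^ n > K * l' ^ n"
    using l' by (simp add: power_divide pos_less_divide_eq)
  then show False
    using bound[of n] by simp
qed

lemma stretch_factor_eqI: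
  assumes "\<phi> \<in> carrier (Out (free_group N))"
    and "irreducible_train_track_rep N \<phi> \<Gamma> fV f" "PF_eigenvalue (transition_matrix \<Gamma> f) l"
  shows "stretch_factor N \<phi> = l"
  unfolding stretch_factor_def
proof (rule the_equality)
  show "\<exists>\<Gamma> fV fE. irreducible_train_track_rep N \<phi> \<Gamma> fV fE \<and> PF_eigenvalue (transition_matrix \<Gamma> fE) l"
    using assms by blast
  show "l' = l" if "\<exists>\<Gamma> fV fE. irreducible_train_track_rep N \<phi> \<Gamma> fV fE \<and>
      PF_eigenvalue (transition_matrix \<Gamma> fE) l'" for l'
    using that assms train_track_eigenvalue_le by (meson order_antisym)
qed


section \<open>Magnus coefficients\<close>

text \<open>
  The Magnus expansion sends the generator \<open>x\<^sub>i\<close> to \<open>1 + X\<^sub>i\<close> in the ring of formal power series in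
  noncommuting variables.  A series is represented by its coefficient function on monomials; the
  two functions below are left multiplication by \<open>1 + X\<^sub>i\<close> and by its inverse.
\<close>

fun mag_pos :: "nat \<Rightarrow> (nat list \<Rightarrow> int) \<Rightarrow> nat list \<Rightarrow> int" where
  "mag_pos i P [] = P []"
| "mag_pos i P (j # c) = P (j # c) + (if i = j then P c else 0)"

fun mag_neg :: "nat \<Rightarrow> (nat list \<Rightarrow> int) \<Rightarrow> nat list \<Rightarrow> int" where
  "mag_neg i P [] = P []"
| "mag_neg i P (j # c) = P (j # c) - (if i = j then mag_neg i P c else 0)"

definition mag_letter :: "letter \<Rightarrow> (nat list \<Rightarrow> int) \<Rightarrow> nat list \<Rightarrow> int" where
  "mag_letter x = (if snd x then mag_pos (fst x) else mag_neg (fst x))"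

definition mag :: "letter list \<Rightarrow> nat list \<Rightarrow> int" where
  "mag w = foldr mag_letter w (\<lambda>c. if c = [] then 1 else 0)"

lemma mag_neg_pos: "mag_neg i (mag_pos i P) c = P c"
  by (induction c) auto

lemma mag_pos_neg: "mag_pos i (mag_neg i P) c = P c"
  by (cases c) auto

lemma mag_letter_inverse: "mag_letter x (mag_letter (inv_letter x) P) = P"
  by (auto simp: mag_letter_def mag_neg_pos mag_pos_neg)

lemma mag_Nil: "mag [] = (\<lambda>c. if c = [] then 1 else 0)"
  by (simp add: mag_def)

lemma mag_Cons: "mag (x # w) = mag_letter x (mag w)"
  by (simp add: mag_def)

lemma mag_reduce_word: "mag (reduce_word w) = mag w"
proof (induction w)
  case (Cons x w)
  show ?case
  proof (cases "reduce_word w \<noteq> [] \<and> hd (reduce_word w) = inv_letter x")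
    case True
    then obtain t where t: "reduce_word w = inv_letter x # t"
      by (metis list.exhaust_sel)
    have "mag (x # w) = mag_letter x (mag (inv_letter x # t))"
      using Cons t by (simp add: mag_Cons)
    then show ?thesis
      by (simp add: mag_Cons mag_letter_inverse reduce_word_Cons t cancel_Cons_def)
  next
    case False
    then have "reduce_word (x # w) = x # reduce_word w"
      by (auto simp: reduce_word_Cons cancel_Cons_def)
    then show ?thesis
      using Cons by (simp add: mag_Cons)
  qed
qed simp

definition conv :: "(nat list \<Rightarrow> int) \<Rightarrow> (nat list \<Rightarrow> int) \<Rightarrow> nat list \<Rightarrow> int" where
  "conv P Q c = (\<Sum>k\<le>length c. P (take k c) * Q (drop k c))"

lemma conv_Nil: "conv P Q [] = P [] * Q []"
  by (simp add: conv_def)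

lemma conv_Cons: "conv P Q (j # c) = P [] * Q (j # c) + conv (\<lambda>d. P (j # d)) Q c"
  by (simp add: conv_def sum.atMost_Suc_shift del: sum.atMost_Suc)

lemma conv_mag_pos: "conv (mag_pos i P) Q = mag_pos i (conv P Q)"
proof
  fix c show "conv (mag_pos i P) Q c = mag_pos i (conv P Q) c"
  proof (cases c)
    case (Cons j d)
    have "conv (\<lambda>d. P (j # d) + P d) Q d = conv (\<lambda>d. P (j # d)) Q d + conv P Q d" for d
      by (simp add: conv_def distrib_right sum.distrib)
    then show ?thesis
      using Cons by (auto simp: conv_Cons)
  qed (simp add: conv_Nil)
qed

lemma conv_mag_letter: "conv (mag_letter x P) Q = mag_letter x (conv P Q)"
proof (cases "snd x")
  case True
  then show ?thesis by (simp add: mag_letter_def conv_mag_pos)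
next
  case False
  have "mag_pos (fst x) (mag_neg (fst x) P) = P"
    by (rule ext) (simp add: mag_pos_neg)
  then have "mag_neg (fst x) (conv P Q) = mag_neg (fst x) (mag_pos (fst x) (conv (mag_neg (fst x) P) Q))"
    by (metis conv_mag_pos)
  also have "\<dots> = conv (mag_neg (fst x) P) Q"
    by (rule ext) (simp add: mag_neg_pos)
  finally show ?thesis
    using False by (simp add: mag_letter_def)
qed

lemma conv_one: "conv (\<lambda>c. if c = [] then 1 else 0) Q = Q"
proof
  have zero: "conv (\<lambda>d. 0) Q c = 0" for c
    by (simp add: conv_def)
  fix c show "conv (\<lambda>c. if c = [] then 1 else 0) Q c = Q c"
    by (cases c) (simp_all add: conv_Nil conv_Cons zero)
qed

lemma mag_append: "mag (u @ w) = conv (mag u) (mag w)"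
  by (induction u) (simp_all add: mag_Nil mag_Cons conv_one conv_mag_letter)

lemma mag_constant [simp]: "mag w [] = 1"
  by (induction w) (auto simp: mag_Nil mag_Cons mag_letter_def)

text \<open>
  Below the lowest degree that occurs in two expansions, the product is the sum in that degree.
\<close>

lemma mag_append_lowest:
  assumes u: "\<And>c. c \<noteq> [] \<Longrightarrow> length c < length d \<Longrightarrow> mag u c = 0"
    and d: "d \<noteq> []"
  shows "mag (u @ w) d = mag u d + mag w d"
proof -
  obtain l where l: "length d = Suc l"
    using d by (cases d) auto
  have "mag (u @ w) d = (\<Sum>k\<le>Suc l. mag u (take k d) * mag w (drop k d))"
    by (simp add: mag_append conv_def l)
  also have "\<dots> = mag w d + (\<Sum>k\<le>l. mag u (take (Suc k) d) * mag w (drop (Suc k) d))"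
    by (subst sum.atMost_Suc_shift) simp
  also have "(\<Sum>k\<le>l. mag u (take (Suc k) d) * mag w (drop (Suc k) d))
           = (\<Sum>k\<in>{l}. mag u (take (Suc k) d) * mag w (drop (Suc k) d))"
    by (rule sum.mono_neutral_right) (use l d in \<open>auto intro!: u\<close>)
  also have "\<dots> = mag u d"
    by (simp add: l[symmetric])
  finally show ?thesis by simp
qed

lemma mag_power_Cons:
  assumes "c = [] \<or> hd c \<noteq> i"
  shows "mag (replicate n (i, b) @ w) c = mag w c"
    and "mag (replicate n (i, b) @ w) (i # c) = mag w (i # c) + (if b then int n else - int n) * mag w c"
proof -
  show 1: "mag (replicate n (i, b) @ w) c = mag w c" for n
    using assms by (induction n; cases c) (auto simp: mag_Cons mag_letter_def)
  have neg: "mag_neg i P c = P c" for P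
    using assms by (cases c) auto
  show "mag (replicate n (i, b) @ w) (i # c)
      = mag w (i # c) + (if b then int n else - int n) * mag w c"
    using 1 by (induction n) (auto simp: mag_Cons mag_letter_def neg algebra_simps)
qed

text \<open>
  Writing a reduced word as \<open>x\<^sub>i\<^sup>m w\<close> with \<open>m \<noteq> 0\<close> maximal, the coefficient of \<open>X\<^sub>i c\<close> is \<open>m\<close> times
  the coefficient of \<open>c\<close> in the expansion of \<open>w\<close>, as long as \<open>X\<^sub>i c\<close> has more alternations
  than \<open>w\<close> has syllables.
\<close>

lemma mag_reduced_nontrivial_aux:
  "reduced_word w \<Longrightarrow>
   \<exists>c. (w = [] \<longleftrightarrow> c = []) \<and> (w \<noteq> [] \<longrightarrow> hd c = fst (hd w)) \<and> distinct_adj c \<and> mag w c \<noteq> 0 \<and>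
       (\<forall>d. distinct_adj d \<longrightarrow> length c < length d \<longrightarrow> mag w d = 0)"
proof (induction w rule: length_induct)
  case (1 w)
  show ?case
  proof (cases w)
    case Nil
    then show ?thesis
      by (intro exI[of _ "[]"]) (simp add: mag_Nil)
  next
    case (Cons x t)
    obtain i b where x: "x = (i, b)" by (cases x)
    define v where "v = dropWhile (\<lambda>y. y = x) w"
    define n where "n = length (takeWhile (\<lambda>y. y = x) w)"
    have n: "n > 0" by (simp add: n_def Cons)
    have w: "w = replicate n x @ v"
    proof -
      have "takeWhile (\<lambda>y. y = x) w = replicate n x"
        by (rule replicate_eqI) (auto simp: n_def dest: set_takeWhileD)
      then show ?thesis
        by (metis v_def takeWhile_dropWhile_id)
    qed
    have redv: "reduced_word v"
      using 1(2) w by (simp add: reduced_word_append)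
    have "length v < length w"
      using w n by simp
    then obtain c where c: "v = [] \<longleftrightarrow> c = []" "v \<noteq> [] \<longrightarrow> hd c = fst (hd v)" "distinct_adj c"
        "mag v c \<noteq> 0" "\<forall>d. distinct_adj d \<longrightarrow> length c < length d \<longrightarrow> mag v d = 0"
      using 1 redv by blast
    have hdv: "fst (hd v) \<noteq> i" if "v \<noteq> []"
    proof
      assume "fst (hd v) = i"
      moreover have "hd v \<noteq> x"
        using that hd_dropWhile[of "\<lambda>y. y = x" w] by (simp add: v_def)
      ultimately have "hd v = inv_letter x"
        by (simp add: x inv_letter_def prod_eq_iff)
      then show False
        using 1(2) w that n by (simp add: reduced_word_append)
    qed
    have ci: "c = [] \<or> hd c \<noteq> i"
      using c hdv by metis
    have adj: "distinct_adj (i # c)"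
      using ci c(3) by (cases c) auto
    have "mag w (i # c) \<noteq> 0"
      using mag_power_Cons(2)[OF ci, of n b v] c(4,5) adj n by (simp add: w x)
    moreover have "mag w d = 0" if d: "distinct_adj d" "Suc (length c) < length d" for d
    proof (cases "d \<noteq> [] \<and> hd d = i")
      case True
      then obtain e where e: "d = i # e" by (metis list.exhaust_sel)
      have "e = [] \<or> hd e \<noteq> i"
        using d(1) e by (cases e) auto
      then have "mag w d = mag v d + (if b then int n else - int n) * mag v e"
        using mag_power_Cons(2)[of e i n b v] by (simp add: w x e)
      moreover have "distinct_adj e"
        using d(1) e by (cases e) auto
      ultimately show ?thesis
        using d e c(5) by simp
    next
      case False
      then have "mag w d = mag v d"
        using mag_power_Cons(1)[of d i n b v] by (auto simp: w x)
      then show ?thesis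
        using d c(5) by simp
    qed
    ultimately show ?thesis
      using adj by (intro exI[of _ "i # c"]) (simp add: Cons x)
  qed
qed

lemma mag_reduced_nontrivial: "reduced_word w \<Longrightarrow> w \<noteq> [] \<Longrightarrow> \<exists>c. c \<noteq> [] \<and> mag w c \<noteq> 0"
  using mag_reduced_nontrivial_aux by metis

text \<open>
  A nontrivial subgroup of a free group maps nontrivially to the integers: read off the Magnus
  coefficients in the lowest degree in which some element of the subgroup has a nonzero one.
\<close>

lemma subgroup_free_group_functional:
  assumes H: "subgroup H (free_group N)" and nt: "H \<noteq> {[]}"
  shows "\<exists>\<chi> :: letter list \<Rightarrow> int.
     (\<forall>g\<in>H. \<forall>h\<in>H. \<chi> (reduce_word (g @ h)) = \<chi> g + \<chi> h) \<and> (\<exists>h\<in>H. \<chi> h \<noteq> 0)"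
proof -
  define D where "D = {c. c \<noteq> [] \<and> (\<exists>h\<in>H. mag h c \<noteq> 0)}"
  have "[] \<in> H"
    using subgroup.one_closed[OF H] by simp
  then obtain h where h: "h \<in> H" "h \<noteq> []"
    using nt by auto
  then have "reduced_word h"
    using subgroup.subset[OF H] by auto
  then obtain c where "c \<noteq> []" "mag h c \<noteq> 0"
    using mag_reduced_nontrivial[OF _ h(2)] by blast
  then have "c \<in> D"
    using h(1) by (auto simp: D_def)
  then obtain d where d: "d \<in> D" "\<And>c. c \<in> D \<Longrightarrow> length d \<le> length c"
    using ex_has_least_nat[of "\<lambda>c. c \<in> D" c length] by blast
  have "mag (reduce_word (g @ h)) d = mag g d + mag h d" if "g \<in> H" "h \<in> H" for g h
    unfolding mag_reduce_word
  proof (rule mag_append_lowest)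
    show "d \<noteq> []"
      using d by (simp add: D_def)
    fix c :: "nat list" assume "c \<noteq> []" "length c < length d"
    then show "mag g c = 0"
      using d(2)[of c] that by (auto simp: D_def)
  qed
  moreover have "\<exists>h\<in>H. mag h d \<noteq> 0"
    using d(1) by (simp add: D_def)
  ultimately show ?thesis
    by (intro exI[of _ "\<lambda>h. mag h d"]) auto
qed

lemma additive_eq_esum:
  assumes add: "\<And>x y. x \<in> carrier (free_group N) \<Longrightarrow> y \<in> carrier (free_group N) \<Longrightarrow>
                 \<chi> (reduce_word (x @ y)) = \<chi> x + (\<chi> y :: int)"
    and w: "w \<in> words N"
  shows "\<chi> (reduce_word w) = esum (\<lambda>i. \<chi> [(i, True)]) w"
  using w
proof (induction w)
  case Nil
  then show ?case using add[of "[]" "[]"] by simp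
next
  case (Cons x w)
  have 0: "\<chi> [] = 0"
    using add[of "[]" "[]"] by simp
  have "\<chi> [(i, False)] = - \<chi> [(i, True)]" if "i < N" for i
    using add[of "[(i, True)]" "[(i, False)]"] that 0 reduce_word_inv_right[of "[(i, True)]"]
    by (simp add: inv_letter_def)
  moreover have "\<chi> (reduce_word (x # w)) = \<chi> [x] + \<chi> (reduce_word w)"
    using add[of "[x]" "reduce_word w"] Cons.prems by (simp add: words_reduce)
  ultimately show ?case
    using Cons by (cases x) auto
qed


section \<open>Free factors and full irreducibility\<close>

text \<open>
  An internal free product retracts onto each of its factors, by deleting from the normal form all
  syllables that belong to other factors.
\<close>

definition nf_prod :: "('a, 'b) monoid_scheme \<Rightarrow> ('i \<times> 'a) list \<Rightarrow> 'a" where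
  "nf_prod G w = foldr (\<lambda>(i, h) g. h \<otimes>\<^bsub>G\<^esub> g) w \<one>\<^bsub>G\<^esub>"

lemma nf_prod_simps [simp]:
  "nf_prod G [] = \<one>\<^bsub>G\<^esub>" "nf_prod G (s # w) = snd s \<otimes>\<^bsub>G\<^esub> nf_prod G w"
  by (simp_all add: nf_prod_def case_prod_beta)

lemma internal_free_product_retraction:
  fixes G (structure)
  assumes G: "group G" and ifp: "internal_free_product G I H" and j: "j \<in> I"
  shows "\<exists>\<rho>\<in>hom G G. (\<forall>h\<in>H j. \<rho> h = h) \<and> (\<forall>i\<in>I. i \<noteq> j \<longrightarrow> (\<forall>h\<in>H i. \<rho> h = \<one>)) \<and> \<rho> ` carrier G \<subseteq> H j"
proof -
  interpret group G by (rule G)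
  let ?NF = "normal_forms G I H"
  have sub: "subgroup (H i) G" if "i \<in> I" for i
    using ifp that by (simp add: internal_free_product_def)
  have carr: "h \<in> carrier G" if "i \<in> I" "h \<in> H i" for i h
    using sub that subgroup.mem_carrier by metis
  have bij: "bij_betw (nf_prod G) ?NF (carrier G)"
    using ifp by (simp add: internal_free_product_def nf_prod_def[abs_def])
  define nf where "nf = the_inv_into ?NF (nf_prod G)"
  have nfI: "nf (nf_prod G w) = w" if "w \<in> ?NF" for w
    using that bij the_inv_into_f_f unfolding nf_def bij_betw_def by metis
  have nf: "nf g \<in> ?NF" "nf_prod G (nf g) = g" if "g \<in> carrier G" for g
    using that bij bij_betw_the_inv_into[OF bij] f_the_inv_into_f_bij_betw[OF bij]
    unfolding nf_def by (auto simp: bij_betwE)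
  define del where "del = (\<lambda>w. nf_prod G (filter (\<lambda>s. fst s = j) w))"
  define \<rho> where "\<rho> = (\<lambda>g. del (nf g))"
  have NF_Cons: "(i, h) # w \<in> ?NF \<longleftrightarrow>
      i \<in> I \<and> h \<in> H i \<and> h \<noteq> \<one> \<and> w \<in> ?NF \<and> (w \<noteq> [] \<longrightarrow> fst (hd w) \<noteq> i)" for i h w
    by (cases w) (auto simp: normal_forms_def)
  have NF_Nil: "[] \<in> ?NF"
    by (simp add: normal_forms_def)
  have prod_carr: "nf_prod G w \<in> carrier G" if "w \<in> ?NF" for w
    using that by (induction w) (auto simp: NF_Cons carr)
  have del_H: "del w \<in> H j" if "w \<in> ?NF" for w
    using that
  proof (induction w)
    case Nil
    show ?case using sub[OF j] by (simp add: del_def subgroup.one_closed)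
  next
    case (Cons s w)
    then show ?case
      using subgroup.m_closed[OF sub[OF j]] by (cases s) (auto simp: del_def NF_Cons)
  qed
  have del_carr: "del w \<in> carrier G" if "w \<in> ?NF" for w
    using carr[OF j] del_H that by blast
  define \<sigma> where "\<sigma> = (\<lambda>i h. if i = j then h else \<one>)"
  have \<sigma>_carr: "\<sigma> i h \<in> carrier G" if "i \<in> I" "h \<in> H i" for i h
    using carr[OF that] by (simp add: \<sigma>_def)
  have \<sigma>_mult: "\<sigma> i (h \<otimes> h') = \<sigma> i h \<otimes> \<sigma> i h'" if "i \<in> I" "h \<in> H i" "h' \<in> H i" for i h h'
    using that by (auto simp: \<sigma>_def)
  have del_Cons: "del ((i, h) # w) = \<sigma> i h \<otimes> del w" if "(i, h) # w \<in> ?NF" for i h w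
    using that del_carr[of w] by (auto simp: del_def \<sigma>_def NF_Cons)
  have \<rho>_nf: "\<rho> (nf_prod G w) = del w" if "w \<in> ?NF" for w
    using that by (simp add: \<rho>_def nfI)
  \<comment> \<open>Multiplying a normal form by a syllable prepends it, or merges it into the first syllable.\<close>
  have step: "\<rho> (h \<otimes> nf_prod G w) = \<sigma> i h \<otimes> del w" if ih: "i \<in> I" "h \<in> H i" and w: "w \<in> ?NF" for i h w
  proof (cases "h = \<one>")
    case True
    then show ?thesis
      using w by (simp add: \<rho>_nf prod_carr del_carr \<sigma>_def)
  next
    case h1: False
    show ?thesis
    proof (cases "w \<noteq> [] \<and> fst (hd w) = i")
      case False
      then have "(i, h) # w \<in> ?NF"
        using ih w h1 by (auto simp: NF_Cons)
      then show ?thesis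
        using \<rho>_nf[of "(i, h) # w"] del_Cons by simp
    next
      case True
      then obtain h' t where wt: "w = (i, h') # t"
        by (metis list.exhaust_sel prod.collapse)
      then have t: "t \<in> ?NF" "h' \<in> H i" "t \<noteq> [] \<longrightarrow> fst (hd t) \<noteq> i"
        using w by (simp_all add: NF_Cons)
      have hh: "h \<otimes> h' \<in> H i"
        using ih t subgroup.m_closed[OF sub] by simp
      have prod: "h \<otimes> nf_prod G w = (h \<otimes> h') \<otimes> nf_prod G t"
        using wt ih t carr prod_carr by (simp add: m_assoc)
      have del: "\<sigma> i h \<otimes> del w = \<sigma> i (h \<otimes> h') \<otimes> del t"
        using wt w ih t \<sigma>_carr del_carr by (simp add: del_Cons \<sigma>_mult m_assoc)
      show ?thesis
      proof (cases "h \<otimes> h' = \<one>")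
        case True
        then show ?thesis
          using prod del t by (simp add: \<rho>_nf prod_carr del_carr \<sigma>_def)
      next
        case False
        then have "(i, h \<otimes> h') # t \<in> ?NF"
          using ih t hh by (simp add: NF_Cons)
        then show ?thesis
          using \<rho>_nf[of "(i, h \<otimes> h') # t"] del_Cons prod del by simp
      qed
    qed
  qed
  have mult: "\<rho> (nf_prod G v \<otimes> g) = del v \<otimes> \<rho> g" if "v \<in> ?NF" "g \<in> carrier G" for v g
    using that
  proof (induction v)
    case Nil
    then show ?case
      using del_carr nf by (simp add: del_def \<rho>_def)
  next
    case (Cons s v)
    obtain i h where s: "s = (i, h)" by (cases s)
    have v: "v \<in> ?NF" "i \<in> I" "h \<in> H i"
      using Cons.prems s by (simp_all add: NF_Cons)
    have vg: "nf_prod G v \<otimes> g \<in> carrier G"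
      using v Cons.prems by (simp add: prod_carr)
    have "\<rho> (nf_prod G (s # v) \<otimes> g) = \<rho> (h \<otimes> nf_prod G (nf (nf_prod G v \<otimes> g)))"
      using s v Cons.prems carr prod_carr nf[OF vg] by (simp add: m_assoc)
    also have "\<dots> = \<sigma> i h \<otimes> \<rho> (nf_prod G v \<otimes> g)"
      using step[OF v(2,3) nf(1)[OF vg]] by (simp add: \<rho>_def)
    also have "\<dots> = (\<sigma> i h \<otimes> del v) \<otimes> \<rho> g"
      using Cons v \<sigma>_carr del_carr nf by (simp add: m_assoc \<rho>_def)
    finally show ?case
      using Cons.prems s by (simp add: del_Cons)
  qed
  have "\<rho> \<in> hom G G"
  proof (rule homI)
    fix x y assume "x \<in> carrier G" "y \<in> carrier G"
    then show "\<rho> (x \<otimes> y) = \<rho> x \<otimes> \<rho> y"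
      using mult[OF nf(1), of x y] nf by (simp add: \<rho>_def)
  qed (simp add: \<rho>_def del_carr nf)
  moreover have on_H: "\<rho> h = \<sigma> i h" if "i \<in> I" "h \<in> H i" for i h
    using step[OF that NF_Nil] carr[OF that] \<sigma>_carr[OF that] by (simp add: del_def)
  moreover have "\<rho> ` carrier G \<subseteq> H j"
    using del_H nf by (auto simp: \<rho>_def)
  ultimately show ?thesis
    using j by (intro bexI[of _ \<rho>]) (auto simp: \<sigma>_def)
qed

lemma esum_nontrivial:
  assumes "w \<in> words N" "esum u w \<noteq> 0"
  shows "\<exists>i<N. u i \<noteq> 0 \<and> esum (\<lambda>j. if j = i then 1 else 0) w \<noteq> 0"
proof (rule ccontr)
  assume "\<not> ?thesis"
  then have "esum u w = 0"
    unfolding esum_expand[OF assms(1), of u] by (intro sum.neutral) auto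
  then show False
    using assms(2) by simp
qed

text \<open>
  Homologically a proper nontrivial free factor \<open>A\<close> is visible from both sides: some element of
  \<open>A\<close> has nonzero abelianization, as \<open>A\<close> maps nontrivially to the integers and this map extends
  to the free group along the retraction onto \<open>A\<close>; and some nonzero functional vanishes on \<open>A\<close>,
  obtained in the same way from another factor.
\<close>

lemma free_factor_abelianization:
  assumes ifp: "internal_free_product (free_group N) I H" and j: "j \<in> I"
    and nt: "H j \<noteq> {[]}" and proper: "H j \<noteq> carrier (free_group N)"
  shows "(\<exists>h\<in>H j. \<exists>i<N. esum (\<lambda>l. if l = i then 1 else 0) h \<noteq> 0) \<and>
         (\<exists>u. (\<exists>i<N. u i \<noteq> 0) \<and> (\<forall>h\<in>H j. esum u h = 0))"
proof -
  let ?F = "free_group N"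
  interpret group ?F by (rule group_free_group)
  have sub: "subgroup (H i) ?F" if "i \<in> I" for i
    using ifp that by (simp add: internal_free_product_def)
  have func: "\<exists>u. (\<exists>h\<in>H i. esum u h \<noteq> 0) \<and> (\<forall>l\<in>I. l \<noteq> i \<longrightarrow> (\<forall>h\<in>H l. esum u h = 0))"
    if i: "i \<in> I" and nti: "H i \<noteq> {[]}" for i
  proof -
    obtain \<chi> :: "letter list \<Rightarrow> int" where \<chi>: "\<forall>g\<in>H i. \<forall>h\<in>H i. \<chi> (reduce_word (g @ h)) = \<chi> g + \<chi> h"
        and \<chi>nt: "\<exists>h\<in>H i. \<chi> h \<noteq> 0"
      using subgroup_free_group_functional[OF sub[OF i] nti] by blast
    obtain \<rho> where \<rho>: "\<rho> \<in> hom ?F ?F" "\<forall>h\<in>H i. \<rho> h = h" "\<forall>l\<in>I. l \<noteq> i \<longrightarrow> (\<forall>h\<in>H l. \<rho> h = [])"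
        "\<rho> ` carrier ?F \<subseteq> H i"
      using internal_free_product_retraction[OF is_group ifp i] by (auto simp del: free_group_sel(1))
    define u where "u = (\<lambda>i. \<chi> (\<rho> [(i, True)]))"
    have \<chi>0: "\<chi> [] = 0"
      using \<chi> subgroup.one_closed[OF sub[OF i]] by force
    have u: "\<chi> (\<rho> w) = esum u w" if "w \<in> carrier ?F" for w
    proof -
      have "\<chi> (\<rho> (reduce_word (x @ y))) = \<chi> (\<rho> x) + \<chi> (\<rho> y)"
        if "x \<in> carrier ?F" "y \<in> carrier ?F" for x y
        using hom_mult[OF \<rho>(1) that] \<chi> \<rho>(4) that by (simp add: image_subset_iff)
      then show ?thesis
        using additive_eq_esum[of N "\<lambda>x. \<chi> (\<rho> x)" w] that by (simp add: u_def)
    qed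
    have "esum u h = \<chi> (\<rho> h)" if "l \<in> I" "h \<in> H l" for l h
      using u subgroup.subset[OF sub[OF that(1)]] that(2) by auto
    then show ?thesis
      using \<chi>nt \<rho> \<chi>0 i by (intro exI[of _ u]) auto
  qed
  have wordsH: "h \<in> words N" if "i \<in> I" "h \<in> H i" for i h
    using subgroup.subset[OF sub[OF that(1)]] that(2) by auto
  have vis: "\<exists>h\<in>H j. \<exists>i<N. esum (\<lambda>l. if l = i then 1 else 0) h \<noteq> 0"
  proof -
    obtain u g where "g \<in> H j" "esum u g \<noteq> 0"
      using func[OF j nt] by (elim exE conjE bexE)
    then show ?thesis
      using esum_nontrivial[OF wordsH[OF j], of g u] by meson
  qed
  have "\<exists>i\<in>I. i \<noteq> j \<and> H i \<noteq> {[]}"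
  proof (rule ccontr)
    assume "\<not> ?thesis"
    then have triv: "H i = {[]}" if "i \<in> I" "i \<noteq> j" for i
      using that by blast
    have "carrier ?F \<subseteq> H j"
    proof
      fix g assume "g \<in> carrier ?F"
      then obtain w where w: "w \<in> normal_forms ?F I H" "g = nf_prod ?F w"
        using ifp by (auto simp: internal_free_product_def nf_prod_def bij_betw_def simp del: free_group_sel)
      then have "\<forall>s\<in>set w. snd s \<in> H j"
        using triv by (fastforce simp: normal_forms_def)
      then have "nf_prod ?F w \<in> H j"
        using subgroup.m_closed[OF sub[OF j]] subgroup.one_closed[OF sub[OF j]]
        by (induction w) (auto simp del: free_group_sel)
      then show "g \<in> H j"
        using w by simp
    qed
    then show False
      using proper subgroup.subset[OF sub[OF j]] by blast
  qed
  then obtain i where i: "i \<in> I" "i \<noteq> j" "H i \<noteq> {[]}" by blast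
  obtain u g where u: "g \<in> H i" "esum u g \<noteq> 0" "\<forall>l\<in>I. l \<noteq> i \<longrightarrow> (\<forall>h\<in>H l. esum u h = 0)"
    using func[OF i(1,3)] by (elim exE conjE bexE)
  have nz: "\<exists>l<N. u l \<noteq> 0"
    using esum_nontrivial[OF wordsH[OF i(1) u(1)] u(2)] by (elim exE conjE) (rule exI conjI | assumption)+
  have z: "\<forall>h\<in>H j. esum u h = 0"
    by (rule bspec[OF u(3) j, THEN mp]) (rule i(2)[symmetric])
  show ?thesis
  proof (rule conjI[OF vis])
    show "\<exists>u. (\<exists>i<N. u i \<noteq> 0) \<and> (\<forall>h\<in>H j. esum u h = 0)"
      by (rule exI[of _ u]) (rule conjI[OF nz z])
  qed
qed

lemma funpow_bij_betw_finite_fixed: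
  assumes "finite S" "bij_betw f S S" "x \<in> S"
  shows "\<exists>m\<ge>1. (f ^^ m) x = x"
proof -
  have bij: "bij_betw (f ^^ n) S S" for n
    using assms(2) by (rule bij_betw_funpow)
  then have closed: "(f ^^ n) x \<in> S" for n
    using assms(3) bij_betwE by metis
  have "\<not> inj (\<lambda>n. (f ^^ n) x)"
  proof
    assume "inj (\<lambda>n. (f ^^ n) x)"
    then have "infinite (range (\<lambda>n. (f ^^ n) x))"
      by (rule range_inj_infinite)
    moreover have "range (\<lambda>n. (f ^^ n) x) \<subseteq> S"
      using closed by auto
    ultimately show False
      using assms(1) finite_subset by blast
  qed
  then obtain c d where "c \<noteq> d" "(f ^^ c) x = (f ^^ d) x"
    by (auto simp: inj_def)
  then obtain a b where ab: "a < b" "(f ^^ a) x = (f ^^ b) x"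
    by (cases "c < d") (metis linorder_neqE_nat)+
  have "(f ^^ a) ((f ^^ (b - a)) x) = (f ^^ a) x"
    using ab funpow_add[of a "b - a" f] by simp
  then have "(f ^^ (b - a)) x = x"
    using bij[of a] closed assms(3) unfolding bij_betw_def by (meson inj_onD)
  then show ?thesis
    using ab(1) by (intro exI[of _ "b - a"]) simp
qed

text \<open>
  The homological obstruction to a reducible power: a power of a reducible automorphism maps a
  free factor to a conjugate of itself, hence preserves the homological traces of the factor.
\<close>

lemma not_out_irreducible_abelianization:
  assumes \<alpha>: "\<alpha> \<in> auto (free_group N)" and red: "\<not> out_irreducible (free_group N) (outer (free_group N) \<alpha>)"
  shows "\<exists>u h m. (\<exists>i<N. u i \<noteq> 0) \<and> h \<in> carrier (free_group N) \<and>
     (\<exists>i<N. esum (\<lambda>l. if l = i then 1 else 0) h \<noteq> 0) \<and> m \<ge> 1 \<and>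
     (\<forall>j. esum u ((\<alpha> ^^ (m * j)) h) = 0)"
proof -
  let ?F = "free_group N" and ?\<phi> = "outer (free_group N) \<alpha>"
  interpret group ?F by (rule group_free_group)
  obtain r H where r: "1 \<le> (r::nat)" and ifp: "internal_free_product ?F {0..r} H"
    and H: "\<forall>i\<in>{1..r}. H i \<noteq> {[]} \<and> H i \<noteq> carrier ?F"
    and bij: "bij_betw (out_act ?\<phi>) (conj_class ?F ` H ` {1..r}) (conj_class ?F ` H ` {1..r})"
    using red unfolding out_irreducible_def by (auto simp del: free_group_sel(1))
  define C where "C = conj_class ?F (H 1)"
  have "C \<in> conj_class ?F ` H ` {1..r}"
    using r by (simp add: C_def)
  then obtain m where m: "m \<ge> 1" "(out_act ?\<phi> ^^ m) C = C"
    using funpow_bij_betw_finite_fixed[OF _ bij] by blast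
  have ab: "(\<exists>h\<in>H 1. \<exists>i<N. esum (\<lambda>l. if l = i then 1 else 0) h \<noteq> 0) \<and>
         (\<exists>u. (\<exists>i<N. u i \<noteq> 0) \<and> (\<forall>h\<in>H 1. esum u h = 0))"
    by (rule free_factor_abelianization[OF ifp]) (use r H in \<open>auto simp del: free_group_sel(1)\<close>)
  have sub: "subgroup (H 1) ?F"
    using ifp r by (simp add: internal_free_product_def)
  have H1: "inner_aut ?F \<one>\<^bsub>?F\<^esub> ` H 1 = H 1"
    using subgroup.subset[OF sub] by (auto simp: inner_aut_def inv_free_group image_iff subset_iff)
  have iter: "(image \<alpha> ^^ n) A \<in> (out_act ?\<phi> ^^ n) D" if "A \<in> D" for n A D
    using that
  proof (induction n)
    case (Suc n)
    then show ?case
      using outer_self[OF \<alpha>] by (auto simp: out_act_def)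
  qed simp
  have img: "(image \<alpha> ^^ n) A = (\<alpha> ^^ n) ` A" for n A
    by (induction n) (auto simp: image_image)
  have conj: "(\<alpha> ^^ (m * j)) ` H 1 \<in> C" for j
  proof -
    have "H 1 \<in> C"
      unfolding C_def conj_class_def
      by (rule image_eqI[where x = "\<one>\<^bsub>?F\<^esub>"], rule H1[symmetric], rule one_closed)
    then have "(\<alpha> ^^ (m * j)) ` H 1 \<in> (out_act ?\<phi> ^^ (m * j)) C"
      using iter[of "H 1" C "m * j"] by (simp only: img)
    also have "(out_act ?\<phi> ^^ (m * j)) C = ((out_act ?\<phi> ^^ m) ^^ j) C"
      by (simp add: funpow_mult)
    also have "\<dots> = C"
      using m(2) by (induction j) auto
    finally show ?thesis .
  qed
  obtain u h where u: "\<exists>i<N. u i \<noteq> 0" "\<forall>h\<in>H 1. esum u h = 0"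
      and h: "h \<in> H 1" "\<exists>i<N. esum (\<lambda>l. if l = i then 1 else 0) h \<noteq> 0"
    using ab by blast
  have "esum u ((\<alpha> ^^ (m * j)) h) = 0" for j
  proof -
    obtain g where g: "g \<in> carrier ?F" "(\<alpha> ^^ (m * j)) ` H 1 = inner_aut ?F g ` H 1"
      using conj[of j] by (auto simp: C_def conj_class_def)
    then have "(\<alpha> ^^ (m * j)) h \<in> inner_aut ?F g ` H 1"
      using h(1) by blast
    then obtain h' where h': "h' \<in> H 1" "(\<alpha> ^^ (m * j)) h = inner_aut ?F g h'"
      by blast
    then have "(\<alpha> ^^ (m * j)) h = reduce_word (reduce_word (g @ h') @ inv_word g)"
      using g(1) subgroup.subset[OF sub] by (auto simp: inner_aut_def inv_free_group)
    then have "esum u ((\<alpha> ^^ (m * j)) h) = esum u h'"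
      by (simp only: esum_reduce_word esum_simps esum_inv_word)
    then show ?thesis
      using u(2) h'(1) by simp
  qed
  moreover have "h \<in> carrier ?F"
    using h(1) subgroup.subset[OF sub] by blast
  ultimately show ?thesis
    using u(1) h(2) m(1)
    by (intro exI[where x = u], intro exI[where x = h], intro exI[where x = m], intro conjI allI)
qed


section \<open>Linear recurrences with a dominating root\<close>

text \<open>
  Throughout, \<open>\<mu>\<close> is a root of \<open>x\<^sup>M\<^sup>+\<^sup>1 - k x\<^sup>M - \<epsilon>\<close> with \<open>\<epsilon> = \<plusminus>1\<close>.  Dividing by \<open>x - \<mu>\<close> leaves
  \<open>x\<^sup>M + \<epsilon> \<mu>\<^sup>-\<^sup>M (x\<^sup>M\<^sup>-\<^sup>1 + \<mu> x\<^sup>M\<^sup>-\<^sup>2 + \<dots> + \<mu>\<^sup>M\<^sup>-\<^sup>1)\<close>.  As \<open>\<mu> \<ge> 3\<close>, the coefficients of this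
  quotient below the leading one have absolute values summing up to less than \<open>1/2\<close>, so that its
  roots lie inside the unit disc.  Arguing with sequences in place of roots, the functional
  \<open>Q\<close> is the quotient polynomial, evaluated at the shift operator and scaled by \<open>\<mu>\<^sup>M\<close>.
\<close>

locale pisot =
  fixes M :: nat and k \<epsilon> :: int and \<mu> :: real
  assumes M: "M \<ge> 1" and \<epsilon>: "\<bar>\<epsilon>\<bar> = 1" and \<mu>3: "\<mu> \<ge> 3"
    and root: "\<mu> ^ Suc M = of_int k * \<mu> ^ M + of_int \<epsilon>"
begin

definition recur :: "(nat \<Rightarrow> 'a::real_normed_field) \<Rightarrow> bool" where
  "recur b \<longleftrightarrow> (\<forall>n. b (n + Suc M) = of_int k * b (n + M) + of_int \<epsilon> * b n)"

definition Q :: "(nat \<Rightarrow> 'a::real_normed_field) \<Rightarrow> nat \<Rightarrow> 'a" where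
  "Q b n = of_real (\<mu> ^ M) * b (n + M) + of_int \<epsilon> * (\<Sum>j<M. of_real (\<mu> ^ (M - 1 - j)) * b (n + j))"

lemma Q_Suc:
  assumes "recur b"
  shows "Q b (Suc n) = of_real \<mu> * Q b n"
proof -
  define g where "g j = of_real (\<mu> ^ (M - j)) * b (n + j)" for j
  define S where "S = (\<Sum>j<M. of_real (\<mu> ^ (M - 1 - j)) * b (n + j))"
  have "(\<Sum>j<M. of_real (\<mu> ^ (M - 1 - j)) * b (Suc n + j)) = (\<Sum>j<M. g (Suc j))"
    by (rule sum.cong) (auto simp: g_def)
  also have "\<dots> = (\<Sum>j<M. g j) + g M - g 0"
    using sum.lessThan_Suc_shift[of g M] by (simp add: algebra_simps)
  also have "(\<Sum>j<M. g j) = of_real \<mu> * S"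
    unfolding S_def sum_distrib_left
  proof (rule sum.cong)
    fix j assume "j \<in> {..<M}"
    then have "M - j = Suc (M - 1 - j)" by auto
    then show "g j = of_real \<mu> * (of_real (\<mu> ^ (M - 1 - j)) * b (n + j))"
      by (simp add: g_def)
  qed simp
  finally have shift: "(\<Sum>j<M. of_real (\<mu> ^ (M - 1 - j)) * b (Suc n + j))
      = of_real \<mu> * S + b (n + M) - of_real (\<mu> ^ M) * b n"
    by (simp add: g_def)
  have rt: "(of_real \<mu> :: 'a) * of_real (\<mu> ^ M) = of_int k * of_real (\<mu> ^ M) + of_int \<epsilon>"
    using arg_cong[OF root, of "of_real :: real \<Rightarrow> 'a"] by simp
  have "Q b (Suc n) = of_real (\<mu> ^ M) * (of_int k * b (n + M) + of_int \<epsilon> * b n)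
      + of_int \<epsilon> * (of_real \<mu> * S + b (n + M) - of_real (\<mu> ^ M) * b n)"
    using assms shift by (simp add: Q_def recur_def)
  also have "\<dots> = (of_int k * of_real (\<mu> ^ M) + of_int \<epsilon>) * b (n + M) + of_int \<epsilon> * (of_real \<mu> * S)"
    by (simp add: algebra_simps)
  also have "\<dots> = of_real \<mu> * Q b n"
    unfolding rt[symmetric] by (simp add: Q_def S_def algebra_simps)
  finally show ?thesis .
qed

lemma Q_eq: "recur b \<Longrightarrow> Q b n = of_real \<mu> ^ n * Q b 0"
  by (induction n) (simp_all add: Q_Suc)

lemma decay_step:
  assumes "Q b n = 0" and B: "\<And>j. j < M \<Longrightarrow> norm (b (n + j)) \<le> B"
  shows "norm (b (n + M)) \<le> B / 2"
proof -
  have B0: "B \<ge> 0"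
    using B[of 0] M norm_ge_zero[of "b (n + 0)"] by linarith
  have "of_real (\<mu> ^ M) * b (n + M) = - (of_int \<epsilon> * (\<Sum>j<M. of_real (\<mu> ^ (M - 1 - j)) * b (n + j)))"
    using assms(1) by (simp add: Q_def eq_neg_iff_add_eq_0)
  then have "norm (of_real (\<mu> ^ M) * b (n + M)) = norm (\<Sum>j<M. of_real (\<mu> ^ (M - 1 - j)) * b (n + j))"
    using \<epsilon> by (simp add: norm_mult) (metis of_int_abs of_int_1 mult_1)
  also have "\<dots> \<le> (\<Sum>j<M. \<mu> ^ (M - 1 - j) * B)"
  proof (rule order_trans[OF norm_sum], rule sum_mono)
    fix j assume "j \<in> {..<M}"
    then show "norm (of_real (\<mu> ^ (M - 1 - j)) * b (n + j)) \<le> \<mu> ^ (M - 1 - j) * B"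
      using \<mu>3 B by (simp add: norm_mult norm_power mult_left_mono)
  qed
  also have "\<dots> = (\<Sum>j<M. \<mu> ^ j) * B"
    unfolding sum_distrib_right[symmetric]
    using sum.nat_diff_reindex[of "\<lambda>j. \<mu> ^ j" M] by simp
  also have "(\<Sum>j<M. \<mu> ^ j) = (\<mu> ^ M - 1) / (\<mu> - 1)"
    using \<mu>3 by (intro geometric_sum) simp
  also have "\<dots> \<le> \<mu> ^ M / 2"
  proof -
    have "(\<mu> ^ M - 1) / (\<mu> - 1) \<le> \<mu> ^ M / (\<mu> - 1)"
      using \<mu>3 by (intro divide_right_mono) auto
    also have "\<dots> \<le> \<mu> ^ M / 2"
      using \<mu>3 by (intro divide_left_mono) auto
    finally show ?thesis .
  qed
  finally have "\<mu> ^ M * norm (b (n + M)) \<le> \<mu> ^ M * (B / 2)"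
    using B0 \<mu>3 by (simp add: norm_mult norm_power mult_right_mono)
  then show ?thesis
    using \<mu>3 by simp
qed

lemma decay:
  assumes "\<And>n. Q b n = 0" and e: "e > 0"
  shows "\<exists>n0. \<forall>n\<ge>n0. norm (b n) < e"
proof -
  define B where "B = (\<Sum>j<M. norm (b j))"
  have B0: "B \<ge> 0"
    by (simp add: B_def sum_nonneg)
  have bound: "norm (b n) \<le> B * (1/2) ^ (n div M)" for n
  proof (induction n rule: less_induct)
    case (less n)
    show ?case
    proof (cases "n < M")
      case True
      then have "norm (b n) \<le> B"
        unfolding B_def by (intro member_le_sum) auto
      then show ?thesis
        using True by simp
    next
      case False
      define m where "m = n - M"
      have n: "n = m + M"
        using False by (simp add: m_def)
      have "norm (b (m + j)) \<le> B * (1/2) ^ (m div M)" if "j < M" for j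
      proof -
        have "norm (b (m + j)) \<le> B * (1/2) ^ ((m + j) div M)"
          using that n by (intro less) simp
        also have "\<dots> \<le> B * (1/2) ^ (m div M)"
          using B0 by (intro mult_left_mono power_decreasing) (auto simp: div_le_mono)
        finally show ?thesis .
      qed
      then have "norm (b n) \<le> B * (1/2) ^ (m div M) / 2"
        unfolding n by (rule decay_step[OF assms(1)])
      moreover have "n div M = Suc (m div M)"
        using M by (simp add: n)
      ultimately show ?thesis by simp
    qed
  qed
  obtain m where m: "(1/2::real) ^ m < e / (B + 1)"
    using real_arch_pow_inv[of "e / (B + 1)" "1/2"] B0 e by auto
  have "norm (b n) < e" if "n \<ge> m * M" for n
  proof -
    have "m \<le> n div M"
      using that M by (metis div_le_mono nonzero_mult_div_cancel_right not_one_le_zero)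
    then have "B * (1/2) ^ (n div M) \<le> B * (1/2) ^ m"
      using B0 by (intro mult_left_mono power_decreasing) auto
    also have "\<dots> \<le> (B + 1) * (1/2) ^ m"
      by (intro mult_right_mono) auto
    also have "\<dots> < e"
      using m B0 by (simp add: field_simps)
    finally show ?thesis
      using bound[of n] by linarith
  qed
  then show ?thesis by blast
qed

lemma integer_sequence_zero:
  fixes a :: "nat \<Rightarrow> int"
  assumes rec: "recur (\<lambda>n. real_of_int (a n))" and Q0: "Q (\<lambda>n. real_of_int (a n)) 0 = 0"
  shows "a n = 0"
proof -
  have Qz: "Q (\<lambda>n. real_of_int (a n)) n = 0" for n
    by (subst Q_eq[OF rec]) (simp only: Q0 mult_zero_right)
  have "\<exists>n0. \<forall>n\<ge>n0. norm (real_of_int (a n)) < 1"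
    by (rule decay) (rule Qz, simp)
  then obtain n0 where n0: "\<forall>n\<ge>n0. norm (real_of_int (a n)) < 1" ..
  have backward: "a n = \<epsilon> * (a (n + Suc M) - k * a (n + M))" for n
  proof -
    have "real_of_int (a (n + Suc M)) = real_of_int (k * a (n + M) + \<epsilon> * a n)"
      using rec by (simp add: recur_def)
    then have "a (n + Suc M) = k * a (n + M) + \<epsilon> * a n"
      by (simp only: of_int_eq_iff)
    moreover have "\<epsilon> * \<epsilon> = 1"
      using \<epsilon> by (cases "\<epsilon> \<ge> 0") auto
    ultimately show ?thesis
      by (simp add: mult.assoc[symmetric])
  qed
  have "\<forall>n. n + d \<ge> n0 \<longrightarrow> a n = 0" for d
  proof (induction d)
    case 0
    then show ?case
      using n0 by force
  next
    case (Suc d)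
    show ?case
    proof (intro allI impI)
      fix n assume "n + Suc d \<ge> n0"
      then have "a (n + Suc M) = 0" "a (n + M) = 0"
        using Suc M by auto
      then show "a n = 0"
        using backward[of n] by simp
    qed
  qed
  then show ?thesis by (metis le_add2)
qed

text \<open>
  Windows of an integer solution, weighted by integers \<open>v\<^sub>0, \<dots>, v\<^sub>M\<close>, form a solution again; its
  \<open>\<mu>\<close>-component is the product of the \<open>\<mu>\<close>-component of the given one and of \<open>\<Sum> v\<^sub>i \<mu>\<^sup>i\<close>.
\<close>

lemma recur_window:
  assumes "recur (\<lambda>n. real_of_int (a n))"
  shows "recur (\<lambda>n. real_of_int (\<Sum>i\<le>M. v i * a (n + i)))"
  unfolding recur_def
proof
  fix n
  have "real_of_int (v i) * real_of_int (a (n + Suc M + i))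
      = real_of_int k * (v i * a (n + M + i)) + real_of_int \<epsilon> * (v i * a (n + i))" for i
  proof -
    have "real_of_int (a ((n + i) + Suc M))
        = real_of_int k * real_of_int (a ((n + i) + M)) + real_of_int \<epsilon> * real_of_int (a (n + i))"
      using assms unfolding recur_def by blast
    moreover have "n + Suc M + i = (n + i) + Suc M" "n + M + i = (n + i) + M"
      by simp_all
    ultimately show ?thesis
      by (simp add: algebra_simps)
  qed
  then show "real_of_int (\<Sum>i\<le>M. v i * a (n + Suc M + i))
      = of_int k * real_of_int (\<Sum>i\<le>M. v i * a (n + M + i)) + of_int \<epsilon> * real_of_int (\<Sum>i\<le>M. v i * a (n + i))"
    by (simp only: of_int_sum of_int_mult sum_distrib_left sum.distrib[symmetric])
qed

lemma Q_window:
  assumes "recur (\<lambda>n. real_of_int (a n))"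
  shows "Q (\<lambda>n. real_of_int (\<Sum>i\<le>M. v i * a (n + i))) 0
       = Q (\<lambda>n. real_of_int (a n)) 0 * (\<Sum>i\<le>M. v i * \<mu> ^ i)"
proof -
  have "Q (\<lambda>n. real_of_int (\<Sum>i\<le>M. v i * a (n + i))) 0
      = (\<Sum>i\<le>M. v i * Q (\<lambda>n. real_of_int (a n)) i)"
  proof -
    let ?a = "\<lambda>n. real_of_int (a n)"
    have 1: "\<mu> ^ M * (\<Sum>i\<le>M. v i * ?a (M + i)) = (\<Sum>i\<le>M. v i * (\<mu> ^ M * ?a (i + M)))"
      unfolding sum_distrib_left by (rule sum.cong) (simp_all add: add.commute)
    have "(\<Sum>j<M. \<mu> ^ (M - 1 - j) * (\<Sum>i\<le>M. v i * ?a (j + i)))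
        = (\<Sum>i\<le>M. \<Sum>j<M. \<mu> ^ (M - 1 - j) * (v i * ?a (j + i)))"
      unfolding sum_distrib_left by (rule sum.swap)
    also have "\<dots> = (\<Sum>i\<le>M. v i * (\<Sum>j<M. \<mu> ^ (M - 1 - j) * ?a (i + j)))"
      unfolding sum_distrib_left by (intro sum.cong refl) (simp add: add.commute)
    finally have 2: "of_int \<epsilon> * (\<Sum>j<M. \<mu> ^ (M - 1 - j) * (\<Sum>i\<le>M. v i * ?a (j + i)))
        = (\<Sum>i\<le>M. v i * (of_int \<epsilon> * (\<Sum>j<M. \<mu> ^ (M - 1 - j) * ?a (i + j))))"
      by (simp add: sum_distrib_left mult.left_commute)
    show ?thesis
      using 1 2 by (simp add: Q_def distrib_left sum.distrib)
  qed
  also have "\<dots> = (\<Sum>i\<le>M. v i * (\<mu> ^ i * Q (\<lambda>n. real_of_int (a n)) 0))"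
  proof (intro sum.cong refl)
    fix i
    have "Q (\<lambda>n. real_of_int (a n)) i = \<mu> ^ i * Q (\<lambda>n. real_of_int (a n)) 0"
      using Q_eq[OF assms, of i] by (simp only: of_real_eq_id id_apply)
    then show "v i * Q (\<lambda>n. real_of_int (a n)) i = v i * (\<mu> ^ i * Q (\<lambda>n. real_of_int (a n)) 0)"
      by (simp only:)
  qed
  finally show ?thesis
    by (simp add: sum_distrib_left algebra_simps)
qed

fun impulse :: "nat \<Rightarrow> int" where
  "impulse n = (if n < M then 0 else if n = M then 1 else k * impulse (n - 1) + \<epsilon> * impulse (n - 1 - M))"

declare impulse.simps [simp del]

lemma recur_impulse: "recur (\<lambda>n. real_of_int (impulse n))"
  unfolding recur_def
proof
  fix n
  have "impulse (n + Suc M) = k * impulse (n + M) + \<epsilon> * impulse n"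
    by (subst impulse.simps) simp
  then show "real_of_int (impulse (n + Suc M)) = of_int k * real_of_int (impulse (n + M)) + of_int \<epsilon> * real_of_int (impulse n)"
    by simp
qed

text \<open>Hence \<open>\<mu>\<close> has degree \<open>M + 1\<close> over the rationals.\<close>

lemma powers_independent:
  assumes "(\<Sum>i\<le>M. of_int (v i) * \<mu> ^ i) = 0" "i \<le> M"
  shows "v i = 0"
proof -
  have zero: "(\<Sum>i\<le>M. v i * impulse (n + i)) = 0" for n
    by (rule integer_sequence_zero[OF recur_window[OF recur_impulse]])
      (simp only: Q_window[OF recur_impulse] assms mult_zero_right)
  have "j \<le> M \<longrightarrow> v (M - j) = 0" for j
  proof (induction j rule: less_induct)
    case (less j)
    show ?case
    proof
      assume j: "j \<le> M"
      have "(\<Sum>i\<le>M. v i * impulse (j + i)) = (\<Sum>i\<in>{M - j}. v i * impulse (j + i))"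
      proof (rule sum.mono_neutral_right)
        show "\<forall>i\<in>{..M} - {M - j}. v i * impulse (j + i) = 0"
        proof
          fix i assume i: "i \<in> {..M} - {M - j}"
          show "v i * impulse (j + i) = 0"
          proof (cases "i < M - j")
            case True
            then have "impulse (j + i) = 0"
              by (subst impulse.simps) simp
            then show ?thesis by simp
          next
            case False
            then have "M - i < j" "M - (M - i) = i" "M - i \<le> M"
              using i j by auto
            then have "v i = 0"
              using less by metis
            then show ?thesis by simp
          qed
        qed
      qed auto
      moreover have "impulse M = 1"
        by (subst impulse.simps) simp
      ultimately show "v (M - j) = 0"
        using zero[of j] j by simp
    qed
  qed
  then show ?thesis
    using assms(2) by (metis diff_diff_cancel diff_le_self)
qed

text \<open>
  A nonzero window sequence has a nonzero \<open>\<mu>\<close>-component, so it grows like \<open>\<mu>\<^sup>n\<close> and vanishes only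
  finitely often.
\<close>

lemma window_eventually_nonzero:
  fixes a v :: "nat \<Rightarrow> int"
  assumes rec: "recur (\<lambda>n. real_of_int (a n))" and a: "i \<le> M" "a i \<noteq> 0" and v: "j \<le> M" "v j \<noteq> 0"
    and m: "m \<ge> 1"
  shows "\<exists>l. (\<Sum>i\<le>M. v i * a (m * l + i)) \<noteq> 0"
proof (rule ccontr)
  assume "\<not> ?thesis"
  then have zero: "(\<Sum>i\<le>M. v i * a (m * l + i)) = 0" for l by blast
  define s where "s = (\<lambda>n. real_of_int (\<Sum>i\<le>M. v i * a (n + i)))"
  have s: "recur s"
    unfolding s_def by (rule recur_window[OF rec])
  have "Q (\<lambda>n. real_of_int (a n)) 0 \<noteq> 0"
    using integer_sequence_zero[OF rec, of i] a by auto
  moreover have "(\<Sum>i\<le>M. v i * \<mu> ^ i) \<noteq> 0"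
    using powers_independent[of v j] v by auto
  ultimately have Qs: "Q s 0 \<noteq> 0"
    unfolding s_def Q_window[OF rec] by simp
  have pw: "recur (\<lambda>n. \<mu> ^ n)"
    unfolding recur_def
  proof
    fix n
    have "\<mu> ^ (n + Suc M) = \<mu> ^ n * \<mu> ^ Suc M"
      by (rule power_add)
    also have "\<dots> = of_int k * \<mu> ^ (n + M) + of_int \<epsilon> * \<mu> ^ n"
      unfolding root by (simp add: power_add algebra_simps)
    finally show "\<mu> ^ (n + Suc M) = of_int k * \<mu> ^ (n + M) + of_int \<epsilon> * \<mu> ^ n" .
  qed
  define q where "q = Q (\<lambda>n. \<mu> ^ n) 0"
  have q: "q \<noteq> 0"
  proof
    assume "q = 0"
    then have "Q (\<lambda>n. \<mu> ^ n) n = 0" for n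
      using Q_eq[OF pw, of n] by (simp add: q_def)
    then obtain n0 where "\<forall>n\<ge>n0. norm (\<mu> ^ n) < 1"
      using decay[of "\<lambda>n. \<mu> ^ n" 1] by auto
    then have "norm (\<mu> ^ n0) < 1" by blast
    moreover have "1 \<le> \<mu> ^ n0"
      using \<mu>3 by (intro one_le_power) simp
    ultimately show False by simp
  qed
  define c where "c = Q s 0 / q"
  have c: "c \<noteq> 0"
    using Qs q by (simp add: c_def)
  have lin: "Q (\<lambda>n. s n - c * \<mu> ^ n) n = Q s n - c * Q (\<lambda>n. \<mu> ^ n) n" for n
    by (simp add: Q_def algebra_simps sum_subtractf sum_distrib_left)
  have "Q (\<lambda>n. s n - c * \<mu> ^ n) n = 0" for n
    unfolding lin using Q_eq[OF s, of n] Q_eq[OF pw, of n] q by (simp add: c_def q_def)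
  then obtain n0 where n0: "\<forall>n\<ge>n0. norm (s n - c * \<mu> ^ n) < \<bar>c\<bar>"
    using decay[of "\<lambda>n. s n - c * \<mu> ^ n" "\<bar>c\<bar>"] c by auto
  have "s (m * n0) = 0"
    unfolding s_def zero by simp
  moreover have "m * n0 \<ge> n0"
    using m by simp
  ultimately have "\<bar>c\<bar> * \<bar>\<mu> ^ (m * n0)\<bar> < \<bar>c\<bar>"
    using n0 by (metis abs_minus_cancel abs_mult diff_0 real_norm_def)
  moreover have "\<bar>c\<bar> * 1 \<le> \<bar>c\<bar> * \<bar>\<mu> ^ (m * n0)\<bar>"
    using \<mu>3 one_le_power[of \<mu> "m * n0"] by (intro mult_left_mono) auto
  ultimately show False by simp
qed

text \<open>The conjugates of \<open>\<mu>\<close> lie inside the unit disc.\<close>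

lemma conjugate_norm_less_1:
  fixes z :: complex
  assumes z: "z ^ Suc M = of_int k * z ^ M + of_int \<epsilon>" "z \<noteq> of_real \<mu>"
  shows "norm z < 1"
proof -
  have pw: "recur (\<lambda>n. z ^ n)"
    unfolding recur_def
  proof
    fix n
    have "z ^ (n + Suc M) = z ^ n * z ^ Suc M"
      by (rule power_add)
    also have "\<dots> = of_int k * z ^ (n + M) + of_int \<epsilon> * z ^ n"
      unfolding z(1) by (simp add: power_add algebra_simps)
    finally show "z ^ (n + Suc M) = of_int k * z ^ (n + M) + of_int \<epsilon> * z ^ n" .
  qed
  have "Q (\<lambda>n. z ^ n) (Suc 0) = z * Q (\<lambda>n. z ^ n) 0"
    by (simp add: Q_def algebra_simps sum_distrib_left)
  then have "z * Q (\<lambda>n. z ^ n) 0 = of_real \<mu> * Q (\<lambda>n. z ^ n) 0"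
    by (simp only: Q_Suc[OF pw])
  then have "Q (\<lambda>n. z ^ n) 0 = 0"
    using z(2) by simp
  then have Qz: "Q (\<lambda>n. z ^ n) n = 0" for n
    using Q_eq[OF pw, of n] by simp
  have "\<exists>n0. \<forall>n\<ge>n0. norm (z ^ n) < 1"
    by (rule decay) (rule Qz, simp)
  then obtain n0 where "\<forall>n\<ge>n0. norm (z ^ n) < 1" ..
  then have "norm z ^ n0 < 1"
    by (simp add: norm_power)
  then show ?thesis
    using one_le_power[of "norm z" n0] by linarith
qed

end

lemma pisot_exists:
  assumes M: "M \<ge> 1" and \<epsilon>: "\<bar>\<epsilon>\<bar> = 1" and k: "k \<ge> 4"
  shows "\<exists>\<mu>. pisot M k \<epsilon> \<mu> \<and> of_int k - 1 \<le> \<mu>"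
proof -
  let ?p = "\<lambda>x::real. x ^ M * (x - of_int k) - of_int \<epsilon>"
  have \<epsilon>': "\<epsilon> = 1 \<or> \<epsilon> = - 1"
    using \<epsilon> by linarith
  have pos: "(of_int k + 1 :: real) ^ M \<ge> 1" "(of_int k - 1 :: real) ^ M \<ge> 1"
    using k by (auto intro!: one_le_power)
  have "\<exists>x\<ge>of_int k - 1. x \<le> of_int k + 1 \<and> ?p x = 0"
  proof (rule IVT')
    show "?p (of_int k - 1) \<le> 0" "0 \<le> ?p (of_int k + 1)"
      using pos \<epsilon>' by auto
    show "continuous_on {of_int k - 1..of_int k + 1} ?p"
      by (intro continuous_intros)
  qed simp
  then obtain x where "x \<ge> of_int k - 1" "?p x = 0" by blast
  then show ?thesis
    using assms by (intro exI[of _ x]) (auto simp: pisot_def algebra_simps)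
qed


section \<open>Minimal polynomials and spectral ratios\<close>

abbreviation ipoly :: "int poly \<Rightarrow> 'a::comm_ring_1 \<Rightarrow> 'a" where
  "ipoly f x \<equiv> poly (map_poly of_int f) x"

lemma ipoly_eq_sum:
  fixes x :: "'a::{comm_ring_1,ring_char_0}"
  assumes "degree f \<le> n"
  shows "ipoly f x = (\<Sum>i\<le>n. of_int (coeff f i) * x ^ i)"
proof -
  have "ipoly f x = (\<Sum>i\<le>degree f. of_int (coeff f i) * x ^ i)"
    by (simp add: poly_altdef degree_map_poly coeff_map_poly)
  also have "\<dots> = (\<Sum>i\<le>n. of_int (coeff f i) * x ^ i)"
    using assms by (intro sum.mono_neutral_left) (auto simp: coeff_eq_0)
  finally show ?thesis .
qed

lemma map_poly_of_int_mult:
  "map_poly (of_int :: int \<Rightarrow> 'a::{comm_ring_1,ring_char_0}) (f * g) = map_poly of_int f * map_poly of_int g"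
  by (rule poly_eqI) (simp add: coeff_map_poly coeff_mult)

lemma map_poly_of_int_add:
  "map_poly (of_int :: int \<Rightarrow> 'a::{comm_ring_1,ring_char_0}) (f + g) = map_poly of_int f + map_poly of_int g"
  by (rule poly_eqI) (simp add: coeff_map_poly)

lemma ipoly_mult: "ipoly (f * g) (x :: 'a::{comm_ring_1,ring_char_0}) = ipoly f x * ipoly g x"
  by (simp add: map_poly_of_int_mult)

lemma ipoly_smult: "ipoly (Polynomial.smult c f) (x :: 'a::{comm_ring_1,ring_char_0}) = of_int c * ipoly f x"
  by (simp add: map_poly_smult)

text \<open>
  Two irreducible integer polynomials with a common root agree up to sign: an integer polynomial of
  minimal degree vanishing at the root is divisible by both, and by degree the cofactors are
  constant.
\<close>

lemma irreducible_common_root: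
  fixes x :: "'a::field_char_0"
  assumes f: "irreducible (f :: int poly)" "0 < lead_coeff f" "ipoly f x = 0"
    and g: "irreducible (g :: int poly)" "0 < lead_coeff g" "ipoly g x = 0"
  shows "f = g"
proof -
  have "f \<noteq> 0" using f by auto
  then obtain m :: "int poly" where m: "m \<noteq> 0" "ipoly m x = 0"
      and min: "\<And>h :: int poly. h \<noteq> 0 \<Longrightarrow> ipoly h x = 0 \<Longrightarrow> degree m \<le> degree h"
    using ex_has_least_nat[of "\<lambda>h :: int poly. h \<noteq> 0 \<and> ipoly h x = 0" f degree] f by blast
  have posdeg: "degree h > 0" if "h \<noteq> 0" "ipoly h x = 0" for h :: "int poly"
  proof (rule ccontr)
    assume "\<not> degree h > 0"
    then obtain c where "h = [:c:]"
      using degree_eq_zeroE by blast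
    then show False
      using that by (simp add: map_poly_pCons)
  qed
  have dvd: "h dvd m \<and> degree h = degree m" if h: "irreducible h" "ipoly h x = 0" for h :: "int poly"
  proof -
    have h0: "h \<noteq> 0" using h by auto
    obtain c q where cq: "c \<noteq> 0" "Polynomial.smult c h = m * q + pseudo_mod h m"
      using pseudo_mod(1)[OF m(1), of h] by blast
    have "pseudo_mod h m = 0 \<or> degree (pseudo_mod h m) < degree m"
      by (rule pseudo_mod(2)[OF m(1)])
    moreover have "ipoly (pseudo_mod h m) x = 0"
      using arg_cong[OF cq(2), of "\<lambda>p. ipoly p x"] m(2) h(2)
      by (simp add: map_poly_of_int_add ipoly_mult ipoly_smult)
    ultimately have eq: "Polynomial.smult c h = m * q"
      using min[of "pseudo_mod h m"] cq by force
    then have q0: "q \<noteq> 0"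
      using cq(1) h0 by auto
    have "degree h = degree m + degree q"
      using arg_cong[OF eq, of degree] cq(1) m(1) q0 by (simp add: degree_mult_eq)
    then have "degree q < degree h"
      using posdeg[OF m] by simp
    then have "\<not> h dvd q"
      using q0 divides_degree[of h q] by auto
    moreover have "h dvd m * q"
      using eq by (metis dvd_refl dvd_smult)
    ultimately have "h dvd m"
      using irreducible_imp_prime_elem[OF h(1)] prime_elem_dvd_mult_iff by blast
    then show ?thesis
      using divides_degree[of h m] m(1) min[OF h0 h(2)] by simp
  qed
  obtain s where s: "m = f * s"
    using dvd[OF f(1,3)] by blast
  then have "degree s = 0"
    using dvd[OF f(1,3)] m(1) by (auto simp: degree_mult_eq)
  then obtain c where c: "s = [:c:]"
    using degree_eq_zeroE by blast
  have "c \<noteq> 0"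
    using s c m(1) by auto
  have "g dvd f * [:c:]"
    using dvd[OF g(1,3)] s c by simp
  moreover have "\<not> g dvd [:c:]"
    using posdeg[of g] g divides_degree[of g "[:c:]"] \<open>c \<noteq> 0\<close> by auto
  ultimately have "g dvd f"
    using irreducible_imp_prime_elem[OF g(1)] prime_elem_dvd_mult_iff by blast
  then obtain t where t: "f = g * t" by blast
  then have "t dvd 1"
    using f(1) g(1) irreducibleD irreducible_not_unit by blast
  then obtain d where d: "t = [:d:]" "d dvd 1"
    by (auto simp: is_unit_poly_iff)
  then have "lead_coeff f = lead_coeff g * d"
    by (simp add: t)
  then have "d > 0"
    using f(2) g(2) by (simp add: zero_less_mult_iff)
  then have "d = 1"
    using d(2) by simp
  then show ?thesis
    by (simp add: t d)
qed

lemma minimal_int_poly_eqI: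
  assumes "irreducible f" "0 < lead_coeff f" "ipoly f x = 0"
  shows "minimal_int_poly x = f"
  unfolding minimal_int_poly_def
  by (rule the_equality) (use assms irreducible_common_root in blast)+

lemma proots_linear_factors: "proots (\<Prod>z\<leftarrow>zs. [:- z, 1:]) = mset (zs :: 'a::idom list)"
proof (induction zs)
  case (Cons a zs)
  have "(\<Prod>z\<leftarrow>zs. [:- z, 1:]) \<noteq> 0"
    by (auto simp: prod_list_zero_iff)
  then have "proots ([:- a, 1:] * (\<Prod>z\<leftarrow>zs. [:- z, 1:])) = proots [:- a, 1:] + proots (\<Prod>z\<leftarrow>zs. [:- z, 1:])"
    by (intro proots_mult) simp_all
  then show ?case
    using Cons by (simp del: mult_pCons_left)
qed simp

lemma ordered_roots_exist:
  assumes "f \<noteq> 0"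
  shows "\<exists>zs. ordered_roots f zs"
proof -
  let ?p = "map_poly of_int f :: complex poly"
  obtain as where as: "Polynomial.smult (coeff ?p (degree ?p)) (\<Prod>a\<leftarrow>as. [:- a, 1:]) = ?p"
    using fundamental_theorem_algebra_factorized by blast
  define zs where "zs = rev (sort_key cmod as)"
  have "mset (map (\<lambda>a. [:- a, 1:]) zs) = mset (map (\<lambda>a. [:- a, 1:]) as)"
    by (simp add: zs_def)
  then have "(\<Prod>a\<leftarrow>zs. [:- a, 1:]) = (\<Prod>a\<leftarrow>as. [:- a, 1:])"
    by (metis prod_mset_prod_list)
  moreover have "coeff ?p (degree ?p) = of_int (lead_coeff f)"
    by (simp add: degree_map_poly coeff_map_poly)
  moreover have "sorted_wrt (\<lambda>z z'. cmod z \<ge> cmod z') zs"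
    using sorted_sort_key[of cmod as] by (simp add: zs_def sorted_wrt_rev sorted_map)
  ultimately show ?thesis
    using as assms by (auto simp: ordered_roots_def)
qed

lemma ordered_roots_mset:
  assumes "ordered_roots f zs"
  shows "mset zs = proots (map_poly of_int f)"
proof -
  have "lead_coeff f \<noteq> 0"
    using assms by (simp add: ordered_roots_def)
  then have "proots (Polynomial.smult (of_int (lead_coeff f)) (\<Prod>z\<leftarrow>zs. [:- z, 1:])) = mset zs"
    by (simp add: proots_linear_factors)
  then show ?thesis
    using assms by (simp add: ordered_roots_def)
qed

lemma has_spectral_ratio_unique:
  assumes "has_spectral_ratio f r" "has_spectral_ratio f s"
  shows "r = s"
proof -
  obtain zs where zs: "ordered_roots f zs" "2 \<le> length zs" "r = cmod (zs ! 0 / zs ! 1)"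
    using assms(1) by (auto simp: has_spectral_ratio_def)
  obtain ws where ws: "ordered_roots f ws" "2 \<le> length ws" "s = cmod (ws ! 0 / ws ! 1)"
    using assms(2) by (auto simp: has_spectral_ratio_def)
  have "mset (rev (map cmod zs)) = mset (rev (map cmod ws))"
    using ordered_roots_mset[OF zs(1)] ordered_roots_mset[OF ws(1)] by simp
  moreover have "sorted (rev (map cmod zs))" "sorted (rev (map cmod ws))"
    using zs(1) ws(1) by (simp_all add: ordered_roots_def sorted_wrt_rev sorted_wrt_map)
  ultimately have "map cmod zs = map cmod ws"
    by (metis properties_for_sort rev_rev_ident)
  moreover have "zs \<noteq> []" "ws \<noteq> []"
    using zs(2) ws(2) by auto
  ultimately have "cmod (zs ! 0) = cmod (ws ! 0)" "cmod (zs ! 1) = cmod (ws ! 1)"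
    using zs(2) ws(2) nth_map[of 0 zs cmod] nth_map[of 0 ws cmod] nth_map[of 1 zs cmod] nth_map[of 1 ws cmod]
    by simp_all
  then show ?thesis
    by (simp add: zs(3) ws(3) norm_divide)
qed

lemma spectral_ratio_eqI: "has_spectral_ratio f r \<Longrightarrow> spectral_ratio f = r"
  unfolding spectral_ratio_def using has_spectral_ratio_unique by (intro the_equality)

lemma ordered_roots_facts:
  assumes "ordered_roots f zs" "lead_coeff f = 1"
  shows "length zs = degree f" "\<And>i. i < length zs \<Longrightarrow> ipoly f (zs ! i) = 0"
    "\<And>z. ipoly f z = 0 \<Longrightarrow> z \<in> set zs"
    "\<And>i j. i \<le> j \<Longrightarrow> j < length zs \<Longrightarrow> cmod (zs ! j) \<le> cmod (zs ! i)"
    "map_poly of_int f = (\<Prod>z\<leftarrow>zs. [:- z, 1:])"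
proof -
  show eq: "map_poly of_int f = (\<Prod>z\<leftarrow>zs. [:- z, 1:])"
    using assms by (simp add: ordered_roots_def)
  have "degree (\<Prod>z\<leftarrow>zs. [:- z, 1:]) = length zs"
  proof (induction zs)
    case (Cons a zs)
    have "(\<Prod>z\<leftarrow>zs. [:- z, 1:]) \<noteq> 0"
      by (auto simp: prod_list_zero_iff)
    then have "degree ([:- a, 1:] * (\<Prod>z\<leftarrow>zs. [:- z, 1:])) = Suc (degree (\<Prod>z\<leftarrow>zs. [:- z, 1:]))"
      by (subst degree_mult_eq) simp_all
    then show ?case
      using Cons by (simp del: mult_pCons_left)
  qed simp
  moreover have "degree (map_poly of_int f :: complex poly) = degree f"
    by (rule degree_map_poly) simp
  ultimately show "length zs = degree f"
    unfolding eq by simp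
  have root: "ipoly f z = 0 \<longleftrightarrow> z \<in> set zs" for z
    unfolding eq by (simp add: poly_prod_list prod_list_zero_iff image_iff)
  show "ipoly f (zs ! i) = 0" if "i < length zs" for i
    using that root by simp
  show "z \<in> set zs" if "ipoly f z = 0" for z
    using that root by simp
  show "cmod (zs ! j) \<le> cmod (zs ! i)" if "i \<le> j" "j < length zs" for i j
    using assms(1) that sorted_wrt_nth_less[of "\<lambda>z z'. cmod z \<ge> cmod z'" zs i j]
    by (cases "i = j") (auto simp: ordered_roots_def)
qed

definition pisot_poly :: "nat \<Rightarrow> int \<Rightarrow> int poly" where
  "pisot_poly M k = monom 1 (Suc M) - monom k M - 1"

definition inverse_poly :: "nat \<Rightarrow> int \<Rightarrow> int poly" where
  "inverse_poly M k = monom 1 (Suc M) - monom k 1 - 1"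

lemma ipoly_pisot_poly: "ipoly (pisot_poly M k) (x :: 'a::{comm_ring_1,ring_char_0}) = x ^ Suc M - of_int k * x ^ M - 1"
proof -
  have "map_poly of_int (pisot_poly M k) = monom (1::'a) (Suc M) - monom (of_int k) M - 1"
    unfolding pisot_poly_def by (rule poly_eqI) (simp add: coeff_map_poly)
  then show ?thesis by (simp add: poly_monom)
qed

lemma ipoly_inverse_poly: "ipoly (inverse_poly M k) (x :: 'a::{comm_ring_1,ring_char_0}) = x ^ Suc M - of_int k * x - 1"
proof -
  have "map_poly of_int (inverse_poly M k) = monom (1::'a) (Suc M) - monom (of_int k) 1 - 1"
    unfolding inverse_poly_def by (rule poly_eqI) (simp add: coeff_map_poly)
  then show ?thesis by (simp add: poly_monom)
qed

lemma monic_aux: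
  assumes "\<And>i. i > n \<Longrightarrow> coeff (p :: int poly) i = 0" "coeff p n = 1"
  shows "degree p = n" "lead_coeff p = 1"
proof -
  show "degree p = n"
    by (rule antisym[OF degree_le le_degree]) (use assms in auto)
  then show "lead_coeff p = 1"
    using assms by simp
qed

lemma pisot_poly_monic:
  assumes "M \<ge> 1"
  shows "degree (pisot_poly M k) = Suc M" "lead_coeff (pisot_poly M k) = 1"
proof -
  have *: "coeff (pisot_poly M k) i = 0" if "i > Suc M" for i
    using that by (simp add: pisot_poly_def)
  have **: "coeff (pisot_poly M k) (Suc M) = 1"
    by (simp add: pisot_poly_def)
  show "degree (pisot_poly M k) = Suc M" "lead_coeff (pisot_poly M k) = 1"
    using monic_aux[OF * **] by simp_all
qed

lemma inverse_poly_monic: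
  assumes "M \<ge> 1"
  shows "degree (inverse_poly M k) = Suc M" "lead_coeff (inverse_poly M k) = 1"
proof -
  have *: "coeff (inverse_poly M k) i = 0" if "i > Suc M" for i
    using that by (simp add: inverse_poly_def)
  have **: "coeff (inverse_poly M k) (Suc M) = 1"
    using assms by (simp add: inverse_poly_def)
  show "degree (inverse_poly M k) = Suc M" "lead_coeff (inverse_poly M k) = 1"
    using monic_aux[OF * **] by simp_all
qed

text \<open>
  A monic integer polynomial is irreducible if one of its roots is not a root of any nonzero integer
  polynomial of smaller degree.
\<close>

lemma irreducible_monicI:
  fixes x :: "'a::field_char_0"
  assumes p: "lead_coeff (p :: int poly) = 1" "degree p = Suc M" "ipoly p x = 0"
    and min: "\<And>g :: int poly. degree g \<le> M \<Longrightarrow> ipoly g x = 0 \<Longrightarrow> g = 0"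
  shows "irreducible p"
proof (rule irreducibleI)
  show "p \<noteq> 0" "\<not> p dvd 1"
    using p by (auto simp: is_unit_poly_iff)
  fix a b assume ab: "p = a * b"
  have unit: "t dvd 1" if st: "p = s * t" "ipoly s x = 0" for s t :: "int poly"
  proof -
    have nz: "s \<noteq> 0" "t \<noteq> 0"
      using st(1) \<open>p \<noteq> 0\<close> by auto
    then have "degree s > M"
      using min[of s] st(2) by force
    then have "degree t = 0"
      using arg_cong[OF st(1), of degree] p(2) nz by (simp add: degree_mult_eq)
    then obtain c where c: "t = [:c:]"
      using degree_eq_zeroE by blast
    have "lead_coeff p = lead_coeff s * lead_coeff t"
      by (simp only: st(1) lead_coeff_mult)
    moreover have "lead_coeff t = c"
      by (simp add: c)
    ultimately have "lead_coeff s * c = 1"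
      using p(1) by simp
    then show ?thesis
      by (metis c dvd_triv_right is_unit_const_poly_iff)
  qed
  have "ipoly a x = 0 \<or> ipoly b x = 0"
    using p(3) by (simp add: ab ipoly_mult)
  then show "a dvd 1 \<or> b dvd 1"
    using unit[of a b] unit[of b a] ab by (auto simp: mult.commute)
qed

context pisot
begin

lemma ipoly_low_degree:
  assumes "degree g \<le> M" "ipoly g \<mu> = 0"
  shows "g = 0"
proof (rule poly_eqI)
  fix i
  show "coeff g i = coeff 0 i"
    using powers_independent[of "coeff g" i] assms ipoly_eq_sum[OF assms(1), of \<mu>]
    by (cases "i \<le> M") (auto simp: coeff_eq_0)
qed

text \<open>
  The reciprocals \<open>- 1 / \<mu>\<close> occur as roots of the polynomials \<open>x\<^sup>M\<^sup>+\<^sup>1 - k x - 1\<close>; the independence of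
  the powers of \<open>\<mu>\<close> carries over to them by reversing the coefficients.
\<close>

lemma ipoly_low_degree_reciprocal:
  assumes "degree g \<le> M" "ipoly g (- 1 / \<mu>) = 0"
  shows "g = 0"
proof -
  define v where "v i = coeff g (M - i) * (- 1) ^ (M - i)" for i
  have "(\<Sum>i\<le>M. of_int (v i) * \<mu> ^ i) = (\<Sum>i\<le>M. of_int (v (M - i)) * \<mu> ^ (M - i))"
    by (rule sum.reindex_bij_witness[of _ "\<lambda>i. M - i" "\<lambda>i. M - i"]) auto
  also have "\<dots> = \<mu> ^ M * (\<Sum>i\<le>M. of_int (coeff g i) * (- 1 / \<mu>) ^ i)"
    unfolding sum_distrib_left
  proof (rule sum.cong)
    fix i assume i: "i \<in> {..M}"
    then have "\<mu> ^ M = \<mu> ^ (M - i) * \<mu> ^ i"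
      by (simp flip: power_add)
    moreover have "\<mu> ^ i \<noteq> 0"
      using \<mu>3 by simp
    moreover have "(- 1 / \<mu>) ^ i = (- 1) ^ i / \<mu> ^ i"
      by (rule power_divide)
    moreover have "of_int (v (M - i)) = real_of_int (coeff g i) * (- 1) ^ i"
      using i by (simp add: v_def)
    ultimately show "of_int (v (M - i)) * \<mu> ^ (M - i) = \<mu> ^ M * (of_int (coeff g i) * (- 1 / \<mu>) ^ i)"
      by (simp only:) (simp add: field_simps)
  qed simp
  also have "\<dots> = 0"
    using assms(2) ipoly_eq_sum[OF assms(1), of "- 1 / \<mu>"] by simp
  finally have v: "v i = 0" if "i \<le> M" for i
    using powers_independent that by blast
  show ?thesis
  proof (rule poly_eqI)
    fix i
    show "coeff g i = coeff 0 i"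
      using v[of "M - i"] assms(1) by (cases "i \<le> M") (auto simp: v_def coeff_eq_0)
  qed
qed

end

lemma (in pisot) irreducible_pisot_poly:
  assumes "\<epsilon> = 1"
  shows "irreducible (pisot_poly M k)" "ipoly (pisot_poly M k) \<mu> = 0"
proof -
  show r: "ipoly (pisot_poly M k) \<mu> = 0"
    using root assms unfolding ipoly_pisot_poly by simp
  show "irreducible (pisot_poly M k)"
    by (rule irreducible_monicI[OF pisot_poly_monic(2)[OF M] pisot_poly_monic(1)[OF M] r]) (rule ipoly_low_degree)
qed

lemma (in pisot) irreducible_inverse_poly:
  assumes \<epsilon>: "\<epsilon> = (- 1) ^ Suc M"
  shows "irreducible (inverse_poly M k)"
proof -
  have "\<mu> \<noteq> 0" using \<mu>3 by simp
  have "\<mu> ^ Suc M * ipoly (inverse_poly M k) (- 1 / \<mu>)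
      = (- 1) ^ Suc M + of_int k * \<mu> ^ M - \<mu> ^ Suc M"
  proof -
    have "\<mu> ^ Suc M * (- 1 / \<mu>) ^ Suc M = (- 1) ^ Suc M"
      using \<open>\<mu> \<noteq> 0\<close> by (simp only: power_mult_distrib[symmetric]) simp
    moreover have "\<mu> ^ Suc M * (of_int k * (- 1 / \<mu>)) = - of_int k * \<mu> ^ M"
      using \<open>\<mu> \<noteq> 0\<close> by simp
    ultimately show ?thesis
      unfolding ipoly_inverse_poly right_diff_distrib by (simp only:)
  qed
  also have "\<dots> = 0"
    using root \<epsilon> by simp
  finally have r: "ipoly (inverse_poly M k) (- 1 / \<mu>) = 0"
    using \<open>\<mu> \<noteq> 0\<close> by simp
  show ?thesis
    by (rule irreducible_monicI[OF inverse_poly_monic(2)[OF M] inverse_poly_monic(1)[OF M] r])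
      (rule ipoly_low_degree_reciprocal)
qed

text \<open>
  The spectral ratio of \<open>x\<^sup>M\<^sup>+\<^sup>1 - k x\<^sup>M - 1\<close> exceeds \<open>\<mu>\<close>, as \<open>\<mu>\<close> is a simple root and all other
  roots lie inside the unit disc.
\<close>

lemma (in pisot) spectral_ratio_pisot_poly:
  assumes \<epsilon>: "\<epsilon> = 1"
  shows "\<exists>r\<ge>\<mu>. has_spectral_ratio (pisot_poly M k) r"
proof -
  let ?f = "pisot_poly M k"
  have monic: "lead_coeff ?f = 1" "degree ?f = Suc M"
    using M pisot_poly_monic by auto
  then have "?f \<noteq> 0" by auto
  then obtain zs where zs: "ordered_roots ?f zs"
    using ordered_roots_exist by blast
  note facts = ordered_roots_facts[OF zs monic(1)]
  have len: "length zs = Suc M" "2 \<le> length zs"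
    using facts(1) monic M by auto
  have small: "cmod z < 1" if "ipoly ?f z = 0" "z \<noteq> of_real \<mu>" for z :: complex
    using conjugate_norm_less_1[of z] that \<epsilon> unfolding ipoly_pisot_poly
    by (simp add: algebra_simps)
  have "(of_real \<mu> :: complex) \<in> set zs"
  proof (rule facts(3))
    have "ipoly ?f (of_real \<mu> :: complex) = of_real (ipoly ?f \<mu>)"
      unfolding ipoly_pisot_poly by simp
    then show "ipoly ?f (of_real \<mu> :: complex) = 0"
      using irreducible_pisot_poly(2)[OF \<epsilon>] by simp
  qed
  then obtain i where i: "i < length zs" "zs ! i = of_real \<mu>"
    by (auto simp: in_set_conv_nth)
  then have "\<mu> \<le> cmod (zs ! 0)"
    using facts(4)[of 0 i] \<mu>3 by simp
  then have z0: "zs ! 0 = of_real \<mu>"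
    using small[of "zs ! 0"] facts(2)[of 0] len \<mu>3 by force
  have z1: "zs ! 1 \<noteq> of_real \<mu>"
  proof
    assume eq: "zs ! 1 = of_real \<mu>"
    obtain ws where ws: "zs = of_real \<mu> # of_real \<mu> # ws"
      using len(2) z0 eq by (cases zs; cases "tl zs") auto
    have "poly (pderiv (map_poly of_int ?f)) (complex_of_real \<mu>) = 0"
      unfolding facts(5) ws by (simp add: pderiv_mult pderiv_pCons del: mult_pCons_left)
    moreover have "pderiv (map_poly of_int ?f :: complex poly) = map_poly of_int (pderiv ?f)"
      by (rule poly_eqI) (simp add: coeff_pderiv coeff_map_poly)
    ultimately have "ipoly (pderiv ?f) (complex_of_real \<mu>) = 0"
      by simp
    moreover have "degree (pderiv ?f) \<le> M"
      using monic by (simp add: degree_pderiv)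
    ultimately have "complex_of_real (ipoly (pderiv ?f) \<mu>) = 0"
      by (simp add: ipoly_eq_sum)
    then have "pderiv ?f = 0"
      using \<open>degree (pderiv ?f) \<le> M\<close> by (intro ipoly_low_degree) simp_all
    then show False
      using monic(2) by (simp add: pderiv_eq_0_iff)
  qed
  have r1: "ipoly ?f (zs ! 1) = 0"
    using facts(2)[of 1] len by simp
  have "zs ! 1 \<noteq> 0"
    using r1 M unfolding ipoly_pisot_poly by (auto simp: power_0_left)
  moreover have "cmod (zs ! 1) < 1"
    by (rule small[OF r1 z1])
  ultimately have "\<mu> \<le> cmod (zs ! 0 / zs ! 1)"
    using \<mu>3 by (simp add: z0 norm_divide pos_le_divide_eq mult_left_le)
  then show ?thesis
    using zs len(2) \<open>zs ! 1 \<noteq> 0\<close> by (auto simp: has_spectral_ratio_def)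
qed

text \<open>
  A root of \<open>x\<^sup>M\<^sup>+\<^sup>1 - k x - 1\<close> has either modulus about \<open>k\<^sup>1\<^sup>/\<^sup>M\<close> or modulus at most \<open>2/k\<close>.  As the
  product of all roots has modulus 1, at least two roots are of the first kind if \<open>M \<ge> 2\<close>.
\<close>

lemma spectral_ratio_inverse_poly:
  assumes M: "M \<ge> 2" and k: "k \<ge> 6"
  shows "\<exists>r. has_spectral_ratio (inverse_poly M k) r \<and> 1 \<le> r \<and> r \<le> (of_int k + 1) / (of_int k - 1)"
proof -
  let ?f = "inverse_poly M k" and ?k = "of_int k :: real"
  have k6: "?k \<ge> 6" using k by simp
  have monic: "lead_coeff ?f = 1" "degree ?f = Suc M"
    using M inverse_poly_monic by auto
  then have "?f \<noteq> 0" by auto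
  then obtain zs where zs: "ordered_roots ?f zs"
    using ordered_roots_exist by blast
  note facts = ordered_roots_facts[OF zs monic(1)]
  have len: "length zs = Suc M" "2 \<le> length zs"
    using facts(1) monic M by auto
  have eq: "z ^ Suc M = of_int k * z + 1" if "ipoly ?f z = 0" for z :: complex
    using that unfolding ipoly_inverse_poly by (simp add: algebra_simps)
  have big: "?k - 1 \<le> cmod z ^ M" "cmod z ^ M \<le> ?k + 1" if z: "ipoly ?f z = 0" "cmod z \<ge> 1" for z :: complex
  proof -
    have nz: "z \<noteq> 0" using z(2) by auto
    have "z ^ M - of_int k = 1 / z"
      using eq[OF z(1)] nz by (simp add: field_simps)
    moreover have "1 / cmod z \<le> 1"
      using z(2) by (subst divide_le_eq_1_pos) auto
    ultimately have "cmod (z ^ M - of_int k) \<le> 1"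
      by (simp add: norm_divide)
    then have "\<bar>cmod z ^ M - ?k\<bar> \<le> 1"
      using norm_triangle_ineq3[of "z ^ M" "of_int k"] k6 by (simp add: norm_power)
    then show "?k - 1 \<le> cmod z ^ M" "cmod z ^ M \<le> ?k + 1"
      by linarith+
  qed
  have small: "cmod z \<le> 2 / ?k" if z: "ipoly ?f z = 0" "cmod z < 1" for z :: complex
  proof -
    have "?k * cmod z = cmod (z ^ Suc M - 1)"
      using eq[OF z(1)] k6 by (simp add: norm_mult)
    also have "\<dots> \<le> cmod z ^ Suc M + 1"
      using norm_triangle_ineq4[of "z ^ Suc M" 1] by (simp only: norm_power norm_one)
    also have "\<dots> \<le> 2"
      using z(2) power_le_one[of "cmod z" "Suc M"] by simp
    finally show ?thesis
      using k6 by (simp add: field_simps)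
  qed
  have prod: "(\<Prod>z\<leftarrow>zs. cmod z) = 1"
  proof -
    have "ipoly ?f (0 :: complex) = (\<Prod>z\<leftarrow>zs. - z)"
      unfolding facts(5) by (simp add: poly_prod_list comp_def)
    moreover have "ipoly ?f (0 :: complex) = - 1"
      unfolding ipoly_inverse_poly by simp
    moreover have "cmod (\<Prod>z\<leftarrow>ws. - z) = (\<Prod>z\<leftarrow>ws. cmod z)" for ws
      by (induction ws) (simp_all add: norm_mult)
    ultimately show ?thesis
      by (metis norm_minus_cancel norm_one)
  qed
  have z1: "cmod (zs ! 1) \<ge> 1"
  proof (rule ccontr)
    assume "\<not> ?thesis"
    then have lt: "cmod (zs ! i) < 1" if "1 \<le> i" "i < length zs" for i
      using facts(4)[of 1 i] that by linarith
    obtain z0 ws where ws: "zs = z0 # ws"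
      using len by (cases zs) auto
    have sm: "cmod z \<le> 2 / ?k" if "z \<in> set ws" for z
    proof -
      obtain i where i: "i < length ws" "z = ws ! i"
        using \<open>z \<in> set ws\<close> by (auto simp: in_set_conv_nth)
      then have "z = zs ! Suc i" "Suc i < length zs"
        by (simp_all add: ws)
      then show ?thesis
        using small lt[of "Suc i"] facts(2)[of "Suc i"] by simp
    qed
    have "(\<Prod>z\<leftarrow>ws. cmod z) \<le> (2 / ?k) ^ length ws"
      using sm
    proof (induction ws)
      case (Cons z ws)
      have "cmod z * (\<Prod>z\<leftarrow>ws. cmod z) \<le> (2 / ?k) * (2 / ?k) ^ length ws"
        using Cons k6 by (intro mult_mono prod_list_nonneg) auto
      then show ?case
        by simp
    qed simp
    also have "\<dots> \<le> (2 / ?k) ^ 2"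
      using len(1) ws M k6 by (intro power_decreasing) auto
    finally have P: "(\<Prod>z\<leftarrow>ws. cmod z) \<le> (2 / ?k) ^ 2" .
    have "cmod z0 \<le> ?k + 1"
    proof (cases "cmod z0 \<ge> 1")
      case True
      have "cmod z0 \<le> cmod z0 ^ M"
        using self_le_power[OF True] M by simp
      then show ?thesis
        using big(2)[of z0] facts(2)[of 0] True ws by simp
    qed (use k6 in linarith)
    then have "(\<Prod>z\<leftarrow>zs. cmod z) \<le> (?k + 1) * (2 / ?k) ^ 2"
      using P k6 unfolding ws by (auto intro!: mult_mono prod_list_nonneg)
    also have "\<dots> < 1"
    proof -
      have "(?k + 1) * 4 < 6 * ?k"
        using k6 by simp
      also have "6 * ?k \<le> ?k * ?k"
        using k6 by (intro mult_right_mono) auto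
      finally have "(?k + 1) * 4 < ?k * ?k" .
      then show ?thesis
        using k6 by (simp add: power2_eq_square field_simps)
    qed
    finally show False
      using prod by simp
  qed
  have z0: "cmod (zs ! 0) \<ge> cmod (zs ! 1)"
    using facts(4)[of 0 1] len by simp
  define r where "r = cmod (zs ! 0 / zs ! 1)"
  have r1: "1 \<le> r"
    unfolding r_def norm_divide using z0 z1 by (subst le_divide_eq_1_pos) linarith+
  have "r \<le> r ^ M"
    using self_le_power[OF r1] M by simp
  also have "\<dots> = cmod (zs ! 0) ^ M / cmod (zs ! 1) ^ M"
    by (simp add: r_def norm_divide power_divide)
  also have "\<dots> \<le> (?k + 1) / (?k - 1)"
    using big(2)[of "zs ! 0"] big(1)[of "zs ! 1"] facts(2)[of 0] facts(2)[of 1] len z0 z1 k6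
    by (intro frac_le) auto
  finally have "r \<le> (?k + 1) / (?k - 1)" .
  moreover have "zs ! 1 \<noteq> 0"
    using z1 by auto
  ultimately show ?thesis
    using zs len(2) r1 by (auto simp: has_spectral_ratio_def r_def)
qed

lemma inverse_poly_positive_root:
  assumes "M \<ge> 2" "k \<ge> 6"
  shows "\<exists>x>1. ipoly (inverse_poly M k) (x :: real) = 0"
proof -
  let ?k = "of_int k :: real"
  have "\<exists>x\<ge>1. x \<le> ?k \<and> ipoly (inverse_poly M k) x = 0"
  proof (rule IVT')
    show "ipoly (inverse_poly M k) (1::real) \<le> 0"
      using assms unfolding ipoly_inverse_poly by simp
    have "?k ^ 3 \<le> ?k ^ Suc M"
      using assms by (intro power_increasing) auto
    moreover have "?k * ?k + 1 \<le> ?k ^ 3"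
    proof -
      have k6: "?k \<ge> 6" using assms by simp
      then have "6 * (?k * ?k) \<le> ?k * (?k * ?k)" "6 * 6 \<le> ?k * ?k"
        by (intro mult_right_mono mult_mono; simp)+
      moreover have "?k ^ 3 = ?k * (?k * ?k)"
        by (simp add: power3_eq_cube)
      ultimately show ?thesis
        by linarith
    qed
    ultimately show "0 \<le> ipoly (inverse_poly M k) ?k"
      unfolding ipoly_inverse_poly by linarith
    show "continuous_on {1..?k} (ipoly (inverse_poly M k))"
      by (intro continuous_intros)
  qed (use assms in simp)
  then obtain x :: real where x: "x \<ge> 1" "ipoly (inverse_poly M k) x = 0" by blast
  have "x \<noteq> 1"
    using x(2) assms unfolding ipoly_inverse_poly by auto
  then show ?thesis
    using x by (intro exI[of _ x]) auto
qed


section \<open>Representatives on the rose\<close>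

definition rose :: "nat \<Rightarrow> (nat, nat) pre_digraph" where
  "rose N = \<lparr>verts = {0}, arcs = {..<N}, tail = \<lambda>_. 0, head = \<lambda>_. 0\<rparr>"

lemma rose_sel [simp]:
  "verts (rose N) = {0}" "arcs (rose N) = {..<N}" "tail (rose N) e = 0" "head (rose N) e = 0"
  by (simp_all add: rose_def)

lemma init_vertex_rose [simp]: "init_vertex (rose N) x = 0" "term_vertex (rose N) x = 0"
  by (simp_all add: init_vertex_def term_vertex_def)

lemma edge_path_rose: "edge_path (rose N) 0 p 0 \<longleftrightarrow> p \<in> words N"
  by (induction p) auto

lemma fundamental_group_rose: "fundamental_group (rose N) 0 = free_group N"
  by (simp add: fundamental_group_eq free_group_eq edge_path_rose)

lemma marked_graph_rose:
  assumes N: "N \<ge> 1" and \<tau>: "\<tau> \<in> auto (free_group N)"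
  shows "marked_graph N (rose N) 0 \<tau>"
proof -
  have fin: "fin_digraph (rose N)"
    by unfold_locales auto
  then interpret fin_digraph "rose N" .
  have "Digraph_Component.connected (rose N)"
    by (auto simp: Digraph_Component.connected_def strongly_connected_def reachable_def)
  moreover have "2 \<le> card {x :: letter. fst x < N}"
  proof -
    have "{x :: letter. fst x < N} = {..<N} \<times> UNIV"
      by auto
    then show ?thesis
      using N by (simp add: card_cartesian_product)
  qed
  moreover have "\<tau> \<in> iso (free_group N) (fundamental_group (rose N) 0)"
    using auto_hom[OF \<tau>] auto_bij[OF \<tau>] by (simp add: iso_def fundamental_group_rose)
  ultimately show ?thesis
    using fin by (simp add: marked_graph_def)
qed

lemma topological_representative_rose:
  assumes N: "N \<ge> 1" and \<tau>: "\<tau> \<in> auto (free_group N)" and \<alpha>: "\<alpha> \<in> \<phi>"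
    and f: "\<And>i. i < N \<Longrightarrow> f i \<in> words N \<and> f i \<noteq> [] \<and> reduced_word (f i)"
    and eq: "\<And>x. x \<in> carrier (free_group N) \<Longrightarrow> \<tau> (\<alpha> x) = word_map N f (\<tau> x)"
  shows "topological_representative N \<phi> (rose N) (\<lambda>v. v) f"
  unfolding topological_representative_def
proof (intro conjI exI bexI ballI)
  show "graph_map (rose N) (\<lambda>v. v) f"
    using f by (auto simp: graph_map_def edge_path_rose)
  show "marked_graph N (rose N) 0 \<tau>"
    by (rule marked_graph_rose[OF N \<tau>])
  show "\<alpha> \<in> \<phi>" by (rule \<alpha>)
  show "edge_path (rose N) 0 [] 0" by simp
  fix x assume x: "x \<in> carrier (free_group N)"
  show "\<tau> (\<alpha> x) = reduce_word ([] @ path_image f (\<tau> x) @ inv_word [])"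
    using eq[OF x] auto_closed[OF \<tau> x] by (simp add: word_map_apply)
qed

text \<open>
  A class of reduced words that contains the single edges and is mapped into itself makes a map of
  the rose a train track map.
\<close>

lemma train_track_roseI:
  assumes step: "\<And>w. w \<in> words N \<Longrightarrow> P w \<Longrightarrow> P (path_image f w)"
    and base: "\<And>i. i < N \<Longrightarrow> P [(i, True)]" and red: "\<And>w. w \<in> words N \<Longrightarrow> P w \<Longrightarrow> reduced_word w"
    and f: "\<And>i. i < N \<Longrightarrow> f i \<in> words N"
  shows "train_track (rose N) f"
  unfolding train_track_def
proof (intro ballI allI impI)
  fix e n assume "e \<in> arcs (rose N)"
  then have e: "e < N" by simp
  have "P ((path_image f ^^ n) [(e, True)]) \<and> (path_image f ^^ n) [(e, True)] \<in> words N"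
    using e step base path_image_words[OF _ f] by (induction n) auto
  then show "reduced_word ((path_image f ^^ n) [(e, True)])"
    using red by blast
qed

lemma transition_matrix_rose: "transition_matrix (rose N) f = mat N N (\<lambda>(i, j). real (edge_count (f j) i))"
  by (simp add: transition_matrix_def)

lemma PF_eigenvalue_roseI:
  assumes N: "N \<ge> 1" and pos: "\<And>i. i < N \<Longrightarrow> 0 < w i"
    and eig: "\<And>i. i < N \<Longrightarrow> (\<Sum>j<N. real (edge_count (f j) i) * w j) = l * w i"
  shows "PF_eigenvalue (transition_matrix (rose N) f) l"
  unfolding PF_eigenvalue_def
proof (intro exI[of _ "vec N w"] conjI)
  have "vec N w \<noteq> 0\<^sub>v N"
  proof
    assume "vec N w = 0\<^sub>v N"
    then have "vec N w $ 0 = 0\<^sub>v N $ 0"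
      by (rule arg_cong)
    then show False
      using pos[of 0] N by simp
  qed
  then show "eigenvector (transition_matrix (rose N) f) (vec N w) l"
    using eig by (auto simp: eigenvector_def transition_matrix_rose scalar_prod_def atLeast0LessThan intro!: eq_vecI)
  show "\<forall>i<dim_row (transition_matrix (rose N) f). 0 < vec N w $ i"
    using pos by (simp add: transition_matrix_rose)
qed

text \<open>A nonnegative matrix is irreducible if its digraph of nonzero entries is strongly connected.\<close>

lemma irreducible_matI:
  assumes A: "A \<in> carrier_mat n n" and nonneg: "\<And>i j. i < n \<Longrightarrow> j < n \<Longrightarrow> 0 \<le> A $$ (i, j)"
    and conn: "\<And>i j. i < n \<Longrightarrow> j < n \<Longrightarrow> (j, i) \<in> {(j, i). i < n \<and> j < n \<and> 0 < A $$ (i, j)}\<^sup>+"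
  shows "irreducible_mat A"
proof -
  have nn: "i < n \<and> j < n \<longrightarrow> 0 \<le> (A ^\<^sub>m k) $$ (i, j)" for i j k
  proof (induction k arbitrary: j)
    case (Suc k)
    then show ?case
      using A nonneg by (auto simp: scalar_prod_def intro!: sum_nonneg mult_nonneg_nonneg)
  qed (use A in auto)
  have "\<exists>k\<ge>1. 0 < (A ^\<^sub>m k) $$ (i, j)" if "(j, i) \<in> {(j, i). i < n \<and> j < n \<and> 0 < A $$ (i, j)}\<^sup>+" for i j
    using that
  proof (induction rule: converse_trancl_induct)
    case (base j)
    then show ?case
      using A by (intro exI[of _ 1]) auto
  next
    case (step j m)
    then obtain k where k: "k \<ge> 1" "0 < (A ^\<^sub>m k) $$ (i, m)" by blast
    have im: "i < n"
      using step(2) by (auto elim: tranclE)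
    have jm: "j < n" "m < n" "0 < A $$ (m, j)"
      using step(1) by auto
    have "0 < (A ^\<^sub>m k) $$ (i, m) * A $$ (m, j)"
      using k jm by simp
    also have "\<dots> \<le> (\<Sum>l<n. (A ^\<^sub>m k) $$ (i, l) * A $$ (l, j))"
      using nn nonneg im jm
      by (intro member_le_sum[where f = "\<lambda>l. (A ^\<^sub>m k) $$ (i, l) * A $$ (l, j)"]) auto
    also have "\<dots> = (A ^\<^sub>m Suc k) $$ (i, j)"
      using im jm A by (simp add: scalar_prod_def atLeast0LessThan)
    finally show ?case
      by (intro exI[of _ "Suc k"]) simp
  qed
  then show ?thesis
    using conn A by (simp add: irreducible_mat_def)
qed

lemma cycle_trancl:
  assumes "\<And>i. i < N \<Longrightarrow> (i, Suc i mod N) \<in> R" "i < N" "j < N"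
  shows "(i, j) \<in> R\<^sup>+"
proof -
  have "(i, (i + Suc n) mod N) \<in> R\<^sup>+" for n
  proof (induction n)
    case 0
    then show ?case using assms by auto
  next
    case (Suc n)
    have "((i + Suc n) mod N, Suc ((i + Suc n) mod N) mod N) \<in> R"
      using assms by (intro assms(1)) auto
    then have "((i + Suc n) mod N, (i + Suc (Suc n)) mod N) \<in> R"
      by (simp add: mod_Suc_eq)
    then show ?case
      using Suc by (rule trancl_into_trancl[rotated])
  qed
  from this[of "N + j - i - 1"] show ?thesis
    using assms by (simp add: Suc_diff_Suc[symmetric] mod_add_self1 split: nat_diff_split)
qed

lemma irreducible_roseI:
  assumes "(\<forall>i<N. edge_count (f i) (Suc i mod N) > 0) \<or> (\<forall>i<N. edge_count (f (Suc i mod N)) i > 0)"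
  shows "irreducible_mat (transition_matrix (rose N) f)"
proof (rule irreducible_matI[of _ N])
  let ?A = "transition_matrix (rose N) f"
  let ?R = "{(j, i). i < N \<and> j < N \<and> 0 < ?A $$ (i, j)}"
  show "?A \<in> carrier_mat N N"
    by (simp add: transition_matrix_rose)
  show "0 \<le> ?A $$ (i, j)" if "i < N" "j < N" for i j
    using that by (simp add: transition_matrix_rose)
  fix i j assume ij: "i < N" "j < N"
  from assms show "(j, i) \<in> ?R\<^sup>+"
  proof
    assume "\<forall>i<N. edge_count (f i) (Suc i mod N) > 0"
    then have R: "(i, Suc i mod N) \<in> ?R" if "i < N" for i
      using that by (simp add: transition_matrix_rose)
    show ?thesis
      by (rule cycle_trancl[of N], erule R, rule ij(2), rule ij(1))
  next
    assume "\<forall>i<N. edge_count (f (Suc i mod N)) i > 0"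
    then have R: "(i, Suc i mod N) \<in> ?R\<inverse>" if "i < N" for i
      using that by (simp add: transition_matrix_rose)
    have "(i, j) \<in> (?R\<inverse>)\<^sup>+"
      by (rule cycle_trancl[of N], erule R, rule ij(1), rule ij(2))
    then show ?thesis
      by (simp only: trancl_converse converse_iff)
  qed
qed

lemma stretch_factor_rose:
  assumes N: "N \<ge> 1" and \<alpha>: "\<alpha> \<in> auto (free_group N)" and \<tau>: "\<tau> \<in> auto (free_group N)"
    and f: "\<And>i. i < N \<Longrightarrow> f i \<in> words N \<and> f i \<noteq> [] \<and> reduced_word (f i)"
    and eq: "\<And>x. x \<in> carrier (free_group N) \<Longrightarrow> \<tau> (\<alpha> x) = word_map N f (\<tau> x)"
    and tt: "train_track (rose N) f" and irr: "irreducible_mat (transition_matrix (rose N) f)"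
    and pf: "PF_eigenvalue (transition_matrix (rose N) f) l"
  shows "stretch_factor N (outer (free_group N) \<alpha>) = l"
proof -
  interpret group "free_group N" by (rule group_free_group)
  show ?thesis
  proof (rule stretch_factor_eqI[OF _ _ pf])
    show "outer (free_group N) \<alpha> \<in> carrier (Out (free_group N))"
      using \<alpha> by (simp add: carrier_Out)
    show "irreducible_train_track_rep N (outer (free_group N) \<alpha>) (rose N) (\<lambda>v. v) f"
      using topological_representative_rose[OF N \<tau> outer_self[OF \<alpha>] f eq] tt irr
      by (simp add: irreducible_train_track_rep_def)
  qed
qed

lemma stretch_factor_rose_standard:
  assumes N: "N \<ge> 1" and \<alpha>: "word_map N f \<in> auto (free_group N)"
    and f: "\<And>i. i < N \<Longrightarrow> f i \<in> words N \<and> f i \<noteq> [] \<and> reduced_word (f i)"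
    and tt: "train_track (rose N) f" and irr: "irreducible_mat (transition_matrix (rose N) f)"
    and pf: "PF_eigenvalue (transition_matrix (rose N) f) l"
  shows "stretch_factor N (outer (free_group N) (word_map N f)) = l"
proof (rule stretch_factor_rose[OF N \<alpha> _ f _ tt irr pf])
  show "(\<lambda>x\<in>carrier (free_group N). x) \<in> auto (free_group N)"
    by (rule group.id_in_auto[OF group_free_group])
  show "(\<lambda>x\<in>carrier (free_group N). x) (word_map N f x) = word_map N f ((\<lambda>x\<in>carrier (free_group N). x) x)"
    if "x \<in> carrier (free_group N)" for x
    using that auto_closed[OF \<alpha> that] by simp
qed


section \<open>The family in rank at least three\<close>

text \<open>
  The automorphism \<open>x\<^sub>0 \<mapsto> x\<^sub>1 \<mapsto> \<dots> \<mapsto> x\<^sub>M \<mapsto> x\<^sub>0 x\<^sub>M\<^sup>k\<close> of the free group of rank \<open>M + 1\<close> and its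
  inverse.
\<close>

definition fam :: "nat \<Rightarrow> nat \<Rightarrow> nat \<Rightarrow> letter list" where
  "fam M k i = (if i < M then [(Suc i, True)] else (0, True) # replicate k (M, True))"

definition fam_inv :: "nat \<Rightarrow> nat \<Rightarrow> nat \<Rightarrow> letter list" where
  "fam_inv M k i = (if i = 0 then (M, True) # replicate k (M - 1, False) else [(i - 1, True)])"

lemma replicate_words [simp]: "replicate n x \<in> words N \<longleftrightarrow> n = 0 \<or> fst x < N"
  by (induction n) auto

lemma reduced_word_replicate [simp]: "reduced_word (replicate n x)"
proof (induction n)
  case (Suc n)
  then show ?case by (cases n) (auto simp: reduced_word_Cons)
qed simp

lemma inv_word_replicate: "inv_word (replicate n x) = replicate n (inv_letter x)"
  by (simp add: inv_word_def)

lemma path_image_replicate: "path_image f (replicate n x) = concat (replicate n (path_image f [x]))"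
  by (induction n) (simp_all add: path_image_Cons)

lemma count_list_replicate [simp]: "count_list (replicate n x) y = (if x = y then n else 0)"
  by (induction n) auto

lemma fam_words: "i < Suc M \<Longrightarrow> fam M k i \<in> words (Suc M)"
  by (auto simp: fam_def)

lemma fam_reduced: "reduced_word (fam M k i)" "fam M k i \<noteq> []"
  by (auto simp: fam_def reduced_word_Cons inv_letter_def hd_replicate)

lemma fam_inv_words: "M \<ge> 1 \<Longrightarrow> i < Suc M \<Longrightarrow> fam_inv M k i \<in> words (Suc M)"
  by (auto simp: fam_inv_def)

lemma concat_replicate_singleton: "concat (replicate n [x]) = replicate n x"
  by (induction n) auto

lemma fam_inverse:
  assumes M: "M \<ge> 1" and i: "i < Suc M"
  shows "fg (path_image (fam M k) (fam_inv M k i)) = fg [(i, True)]"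
    and "fg (path_image (fam_inv M k) (fam M k i)) = fg [(i, True)]"
proof -
  have 1: "path_image (fam M k) (replicate k (M - Suc 0, False)) = inv_word (replicate k (M, True))"
    using M by (simp add: path_image_replicate path_image_single fam_def inv_word_replicate
        inv_letter_def concat_replicate_singleton)
  have 2: "path_image (fam_inv M k) (replicate k (M, True)) = inv_word (replicate k (M - Suc 0, False))"
    using M by (simp add: path_image_replicate path_image_single fam_inv_def inv_word_replicate
        inv_letter_def concat_replicate_singleton)
  show "fg (path_image (fam M k) (fam_inv M k i)) = fg [(i, True)]"
  proof (cases "i = 0")
    case True
    then have "path_image (fam M k) (fam_inv M k i)
        = fam M k M @ inv_word (replicate k (M, True))"
      by (simp add: fam_inv_def path_image_Cons 1)
    then show ?thesis
      using True by (simp add: fam_def fg_Cons[of _ "replicate k (M, True) @ _"])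
  next
    case False
    then have "i - 1 < M" "Suc (i - 1) = i"
      using i by auto
    then show ?thesis
      using False by (simp add: fam_inv_def path_image_single fam_def)
  qed
  show "fg (path_image (fam_inv M k) (fam M k i)) = fg [(i, True)]"
  proof (cases "i < M")
    case True
    then show ?thesis
      by (simp add: fam_inv_def path_image_single fam_def)
  next
    case False
    then have "path_image (fam_inv M k) (fam M k i)
        = fam_inv M k 0 @ inv_word (replicate k (M - Suc 0, False))"
      by (simp add: fam_def path_image_Cons 2)
    moreover have "i = M"
      using False i by simp
    ultimately show ?thesis
      by (simp add: fam_inv_def fg_Cons[of _ "replicate k (M - Suc 0, False) @ _"])
  qed
qed

lemma fam_auto:
  assumes "M \<ge> 1"
  shows "word_map (Suc M) (fam M k) \<in> auto (free_group (Suc M))"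
    and "word_map (Suc M) (fam_inv M k) \<in> auto (free_group (Suc M))"
  using word_map_auto[of "Suc M" "fam M k" "fam_inv M k"] word_map_auto[of "Suc M" "fam_inv M k" "fam M k"]
    fam_words fam_inv_words fam_inverse assms by auto

lemma fam_train_track: "train_track (rose (Suc M)) (fam M k)"
proof (rule train_track_roseI[where P = "\<lambda>w. \<forall>x\<in>set w. snd x"])
  show "\<forall>x\<in>set (path_image (fam M k) w). snd x" if "\<forall>x\<in>set w. snd x" for w
    using that by (induction w) (auto simp: path_image_Cons fam_def)
  show "reduced_word w" if "\<forall>x\<in>set w. snd x" for w
    using that
  proof (induction w)
    case (Cons x w)
    then show ?case
      by (cases w) (auto simp: reduced_word_Cons)
  qed simp
qed (auto simp: fam_words)

text \<open>
  The inverse is a train track map as well.  The derivative of the map permutes its \<open>M + 1\<close> gates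
  cyclically: directions are in the same gate if and only if the following function, into the
  integers modulo \<open>M + 1\<close>, takes the same value on them.  A path is legal if it crosses from one
  gate to a different one at each vertex.
\<close>

definition gate :: "nat \<Rightarrow> letter \<Rightarrow> nat" where
  "gate M x = (if snd x then fst x else if fst x = 0 then M else fst x - 1)"

definition legal :: "nat \<Rightarrow> letter list \<Rightarrow> bool" where
  "legal M w = successively (\<lambda>x y. gate M (inv_letter x) \<noteq> gate M y) w"

lemma legal_Nil [simp]: "legal M []"
  by (simp add: legal_def)

lemma legal_Cons: "legal M (x # w) \<longleftrightarrow> legal M w \<and> (w \<noteq> [] \<longrightarrow> gate M (inv_letter x) \<noteq> gate M (hd w))"
  by (cases w) (auto simp: legal_def)

lemma legal_append:
  "legal M (u @ w) \<longleftrightarrow> legal M u \<and> legal M w \<and>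
     (u \<noteq> [] \<longrightarrow> w \<noteq> [] \<longrightarrow> gate M (inv_letter (last u)) \<noteq> gate M (hd w))"
  by (auto simp: legal_def successively_append_iff)

lemma legal_reduced: "legal M w \<Longrightarrow> reduced_word w"
  by (induction w) (auto simp: legal_Cons reduced_word_Cons)

lemma fam_inv_legal:
  assumes M: "M \<ge> 2" and w: "w \<in> words (Suc M)" "legal M w"
  shows "legal M (path_image (fam_inv M k) w)"
proof -
  let ?F = "path_image (fam_inv M k)"
  define pre where "pre g = (if g = 0 then M else g - 1)" for g :: nat
  have pre_inj: "pre g = pre h \<longleftrightarrow> g = h" if "g \<le> M" "h \<le> M" for g h
    using that by (auto simp: pre_def)
  have gate_le: "gate M x \<le> M" if "fst x < Suc M" for x
    using that by (auto simp: gate_def)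
  have rep: "legal M (replicate n (M - 1, b))" for n b
  proof (induction n)
    case (Suc n)
    then show ?case
      using M by (cases n) (auto simp: legal_Cons gate_def)
  qed (simp add: legal_def)
  have ne: "?F [x] \<noteq> []" for x
    by (cases x) (auto simp: path_image_Cons fam_inv_def)
  have hd: "gate M (hd (?F [x])) = pre (gate M x)" if "fst x < Suc M" for x
    using that M
    by (cases "snd x"; cases "fst x"; cases k) (auto simp: path_image_Cons fam_inv_def gate_def pre_def inv_word_replicate hd_append)
  have leg: "legal M (?F [x])" if "fst x < Suc M" for x
  proof -
    have "legal M (fam_inv M k i)" if "i < Suc M" for i
      using rep[of k False] that M by (cases k) (auto simp: fam_inv_def legal_Cons gate_def)
    moreover have "legal M (inv_word (fam_inv M k i))" if "i < Suc M" for i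
      using rep[of k True] that M
      by (cases k) (auto simp: fam_inv_def inv_word_replicate legal_append legal_Cons gate_def last_replicate inv_letter_def
          simp flip: replicate_append_same)
    ultimately show ?thesis
      using that by (auto simp: path_image_Cons)
  qed
  have inv: "?F [inv_letter x] = inv_word (?F [x])" for x
    using path_image_inv_word[of "fam_inv M k" "[x]"] by simp
  have last: "inv_letter (last (?F [x])) = hd (?F [inv_letter x])" for x
    using ne[of x] unfolding inv by (simp add: inv_word_def hd_rev last_map)
  show ?thesis
    using w
  proof (induction w)
    case (Cons x w)
    have split: "?F (x # w) = ?F [x] @ ?F w"
      using path_image_simps(2)[of "fam_inv M k" "[x]" w] by simp
    show ?case
    proof (cases w)
      case Nil
      then show ?thesis
        using leg Cons.prems by simp
    next
      case (Cons y v)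
      have "hd (?F w) = hd (?F [y])"
        using path_image_simps(2)[of "fam_inv M k" "[y]" v] ne[of y] by (simp add: Cons)
      moreover have "gate M (inv_letter x) \<noteq> gate M y"
        using Cons.prems Cons by (simp add: legal_Cons)
      ultimately have "gate M (inv_letter (last (?F [x]))) \<noteq> gate M (hd (?F w))"
        using Cons.prems Cons hd[of y] hd[of "inv_letter x"] last[of x] pre_inj gate_le by auto
      then show ?thesis
        unfolding split legal_append using leg Cons.IH Cons.prems by (simp add: legal_Cons)
    qed
  qed (simp add: legal_def)
qed

lemma fam_inv_train_track: "M \<ge> 2 \<Longrightarrow> train_track (rose (Suc M)) (fam_inv M k)"
  by (rule train_track_roseI[where P = "legal M"])
    (auto simp: fam_inv_legal legal_reduced fam_inv_words, simp add: legal_def)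

lemma Suc_mod_Suc: "i < Suc M \<Longrightarrow> Suc i mod Suc M = (if i < M then Suc i else 0)"
  by (auto simp: mod_Suc)

lemma fam_irreducible: "irreducible_mat (transition_matrix (rose (Suc M)) (fam M k))"
  by (rule irreducible_roseI) (auto simp: Suc_mod_Suc fam_def)

lemma fam_inv_irreducible: "irreducible_mat (transition_matrix (rose (Suc M)) (fam_inv M k))"
  by (rule irreducible_roseI) (auto simp: Suc_mod_Suc fam_inv_def)

lemma fam_PF:
  assumes M: "M \<ge> 1" and \<mu>: "\<mu> > 0" "\<mu> ^ Suc M = real k * \<mu> ^ M + 1"
  shows "PF_eigenvalue (transition_matrix (rose (Suc M)) (fam M k)) \<mu>"
proof (rule PF_eigenvalue_roseI[where w = "\<lambda>i. if i < M then \<mu> ^ (M - i) else \<mu> ^ Suc M"])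
  let ?w = "\<lambda>i. if i < M then \<mu> ^ (M - i) else \<mu> ^ Suc M"
  fix i assume i: "i < Suc M"
  have "(\<Sum>j<M. real (edge_count (fam M k j) i) * ?w j) = (\<Sum>j<M. if i = Suc j then ?w j else 0)"
    by (rule sum.cong) (auto simp: fam_def)
  also have "\<dots> = (if i = 0 then 0 else ?w (i - 1))"
  proof (cases i)
    case (Suc l)
    then show ?thesis using i by simp
  qed simp
  finally have "(\<Sum>j<Suc M. real (edge_count (fam M k j) i) * ?w j)
      = (if i = 0 then 0 else ?w (i - 1)) + real (edge_count (fam M k M) i) * \<mu> ^ Suc M"
    by simp
  also have "\<dots> = \<mu> * ?w i"
  proof -
    consider "i = 0" | "0 < i" "i < M" | "i = M" "0 < i"
      using i by linarith
    then show ?thesis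
    proof cases
      case 2
      then have "M - (i - 1) = Suc (M - i)" by simp
      then show ?thesis using 2 by (simp add: fam_def)
    next
      case 3
      then have "M - (i - 1) = 1" by simp
      then have "(if i = 0 then 0 else ?w (i - 1)) + real (edge_count (fam M k M) i) * \<mu> ^ Suc M
          = \<mu> * (real k * \<mu> ^ M + 1)"
        using 3 by (simp add: fam_def algebra_simps)
      then show ?thesis
        using 3 \<mu>(2) by simp
    qed (use M in \<open>simp add: fam_def\<close>)
  qed
  finally show "(\<Sum>j<Suc M. real (edge_count (fam M k j) i) * ?w j) = \<mu> * ?w i" .
qed (use \<mu>(1) in simp_all)

lemma fam_inv_PF:
  assumes M: "M \<ge> 1" and \<mu>: "\<mu> > 0" "\<mu> ^ Suc M = real k * \<mu> + 1"
  shows "PF_eigenvalue (transition_matrix (rose (Suc M)) (fam_inv M k)) \<mu>"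
proof (rule PF_eigenvalue_roseI[where w = "\<lambda>i. if i < M then \<mu> ^ Suc i else 1"])
  let ?w = "\<lambda>i. if i < M then \<mu> ^ Suc i else 1"
  fix i assume i: "i < Suc M"
  have "(\<Sum>j<M. real (edge_count (fam_inv M k (Suc j)) i) * ?w (Suc j)) = (\<Sum>j<M. if i = j then ?w (Suc j) else 0)"
    by (rule sum.cong) (auto simp: fam_inv_def)
  also have "\<dots> = (if i < M then ?w (Suc i) else 0)"
    by simp
  finally have "(\<Sum>j<Suc M. real (edge_count (fam_inv M k j) i) * ?w j)
      = real (edge_count (fam_inv M k 0) i) * ?w 0 + (if i < M then ?w (Suc i) else 0)"
    by (subst sum.lessThan_Suc_shift) simp
  also have "\<dots> = \<mu> * ?w i"
  proof -
    consider "Suc i < M" | "Suc i = M" | "i = M"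
      using i by linarith
    then show ?thesis
    proof cases
      case 2
      then have "real (edge_count (fam_inv M k 0) i) * ?w 0 + (if i < M then ?w (Suc i) else 0) = real k * \<mu> + 1"
        using M by (auto simp: fam_inv_def)
      then show ?thesis
        using 2 \<mu>(2) by auto
    qed (use M in \<open>auto simp: fam_inv_def\<close>)
  qed
  finally show "(\<Sum>j<Suc M. real (edge_count (fam_inv M k j) i) * ?w j) = \<mu> * ?w i" .
qed (use \<mu>(1) in simp_all)

text \<open>
  If a power of \<open>\<phi>\<close> were reducible, there would be a nonzero functional \<open>u\<close> and an element \<open>h\<close> with
  nonzero abelianization such that \<open>u\<close> vanishes on arbitrarily high images of \<open>h\<close>.  But the values
  of \<open>u\<close> on the iterated images of \<open>x\<^sub>0\<close> solve the recurrence with the dominating root, and those on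
  the images of \<open>h\<close> are integer combinations of windows of this solution.
\<close>

lemma fam_fully_irreducible:
  assumes p: "pisot M (int k) 1 \<mu>"
  shows "out_fully_irreducible (free_group (Suc M)) (outer (free_group (Suc M)) (word_map (Suc M) (fam M k)))"
  unfolding out_fully_irreducible_def
proof (intro allI impI, rule ccontr)
  interpret pisot M "int k" 1 \<mu> by (rule p)
  let ?F = "free_group (Suc M)"
  let ?\<alpha> = "word_map (Suc M) (fam M k)"
  interpret FG: group ?F by (rule group_free_group)
  have \<alpha>: "?\<alpha> \<in> auto ?F"
    by (rule fam_auto(1)[OF M])
  fix n :: nat assume n: "1 \<le> n" and red: "\<not> out_irreducible ?F (outer ?F ?\<alpha> [^]\<^bsub>Out ?F\<^esub> n)"
  obtain \<beta> where \<beta>: "\<beta> \<in> auto ?F" "outer ?F ?\<alpha> [^]\<^bsub>Out ?F\<^esub> n = outer ?F \<beta>"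
      "\<forall>x\<in>carrier ?F. \<beta> x = (?\<alpha> ^^ n) x"
    using FG.outer_pow[OF \<alpha>] by blast
  have "\<not> out_irreducible ?F (outer ?F \<beta>)"
    using red \<beta>(2) by simp
  then obtain u h m where u: "\<exists>i<Suc M. u i \<noteq> 0" and h: "h \<in> carrier ?F"
    and hab: "\<exists>i<Suc M. esum (\<lambda>l. if l = i then 1 else 0) h \<noteq> 0" and m: "m \<ge> 1"
    and zero: "\<forall>j. esum u ((\<beta> ^^ (m * j)) h) = 0"
    using not_out_irreducible_abelianization[OF \<beta>(1)] by blast
  have closed: "(?\<alpha> ^^ t) x \<in> carrier ?F" if "x \<in> carrier ?F" for t x
    using that by (induction t) (auto simp: auto_closed[OF \<alpha>] simp del: free_group_sel(1))
  have \<beta>_pow: "(\<beta> ^^ t) x = (?\<alpha> ^^ (n * t)) x" if "x \<in> carrier ?F" for t x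
    using that
  proof (induction t)
    case (Suc t)
    have "(\<beta> ^^ Suc t) x = (?\<alpha> ^^ n) ((?\<alpha> ^^ (n * t)) x)"
      using Suc \<beta>(3) closed by simp
    then show ?case
      by (simp add: funpow_add)
  qed simp
  define a where "a t = esum u ((?\<alpha> ^^ t) [(0, True)])" for t
  have add: "esum u ((?\<alpha> ^^ t) (reduce_word (x @ y))) = esum u ((?\<alpha> ^^ t) x) + esum u ((?\<alpha> ^^ t) y)"
    if "x \<in> carrier ?F" "y \<in> carrier ?F" for t x y
    using that
  proof (induction t arbitrary: x y)
    case (Suc t)
    have "?\<alpha> (reduce_word (x @ y)) = reduce_word (?\<alpha> x @ ?\<alpha> y)"
      using auto_hom[OF \<alpha>] Suc.prems by (simp add: hom_def)
    then show ?case
      using Suc.IH[of "?\<alpha> x" "?\<alpha> y"] auto_closed[OF \<alpha>] Suc.prems by (simp add: funpow_swap1 del: free_group_sel(1))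
  qed simp
  have expand: "esum u ((?\<alpha> ^^ t) w) = esum (\<lambda>i. esum u ((?\<alpha> ^^ t) [(i, True)])) w" if "w \<in> carrier ?F" for t w
    using additive_eq_esum[of "Suc M" "\<lambda>x. esum u ((?\<alpha> ^^ t) x)" w, OF add] that by simp
  have gen: "(?\<alpha> ^^ i) [(0, True)] = [(i, True)]" if "i \<le> M" for i
    using that by (induction i) (simp_all add: word_map_apply path_image_single fam_def)
  have a_gen: "esum u ((?\<alpha> ^^ t) [(i, True)]) = a (t + i)" if "i \<le> M" for t i
    using gen[OF that] by (simp add: a_def funpow_add)
  have esum_rep: "esum c (replicate l (i, True)) = int l * c i" for c l i
    by (induction l) (simp_all add: algebra_simps)
  have rec: "recur (\<lambda>t. real_of_int (a t))"
    unfolding recur_def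
  proof
    fix t
    have "(?\<alpha> ^^ (t + Suc M)) [(0, True)] = (?\<alpha> ^^ t) ((?\<alpha> ^^ Suc M) [(0, True)])"
      by (simp only: funpow_add comp_apply)
    also have "(?\<alpha> ^^ Suc M) [(0, True)] = ?\<alpha> [(M, True)]"
      using gen[of M] by simp
    also have "?\<alpha> [(M, True)] = (0, True) # replicate k (M, True)"
      using fam_reduced(1)[of M k M] by (simp add: word_map_apply path_image_single) (simp add: fam_def)
    finally have "a (t + Suc M) = esum (\<lambda>i. esum u ((?\<alpha> ^^ t) [(i, True)])) ((0, True) # replicate k (M, True))"
      unfolding a_def using fam_reduced(1)[of M k M] by (simp only:) (rule expand, simp add: fam_def)
    also have "\<dots> = a t + int k * a (t + M)"
      using a_gen[of 0 t] a_gen[of M t] by (simp add: esum_rep)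
    finally show "real_of_int (a (t + Suc M)) = of_int (int k) * real_of_int (a (t + M)) + of_int 1 * real_of_int (a t)"
      by simp
  qed
  define v where "v i = esum (\<lambda>l. if l = i then 1 else 0) h" for i
  have window: "esum u ((?\<alpha> ^^ t) h) = (\<Sum>i\<le>M. v i * a (t + i))" for t
  proof -
    have "esum u ((?\<alpha> ^^ t) h) = (\<Sum>i<Suc M. esum u ((?\<alpha> ^^ t) [(i, True)]) * v i)"
      unfolding expand[OF h] v_def using h by (intro esum_expand) simp
    then show ?thesis
      using a_gen by (simp add: lessThan_Suc_atMost mult.commute)
  qed
  obtain i where "i \<le> M" "a i \<noteq> 0"
    using u gen by (auto simp: a_def less_Suc_eq_le)
  moreover obtain j where "j \<le> M" "v j \<noteq> 0"
    using hab by (auto simp: v_def less_Suc_eq_le)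
  moreover have "n * m \<ge> 1"
    using n m by simp
  ultimately obtain l where "(\<Sum>i\<le>M. v i * a (n * m * l + i)) \<noteq> 0"
    using window_eventually_nonzero[OF rec] by blast
  then have "esum u ((?\<alpha> ^^ (n * (m * l))) h) \<noteq> 0"
    by (simp add: window mult.assoc)
  then show False
    using zero \<beta>_pow[OF h] by simp
qed

lemma fam_spectral_ratios:
  assumes M: "M \<ge> 2" and k: "k \<ge> 6"
  defines "F \<equiv> free_group (Suc M)"
  defines "\<phi> \<equiv> outer F (word_map (Suc M) (fam M k))"
  shows "\<phi> \<in> carrier (Out F)" "out_fully_irreducible F \<phi>"
    "\<exists>r\<ge>real k - 1. has_spectral_ratio (minimal_int_poly (stretch_factor (Suc M) \<phi>)) r"
    "\<exists>r\<ge>1. r \<le> (real k + 1) / (real k - 1) \<and>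
       has_spectral_ratio (minimal_int_poly (stretch_factor (Suc M) (inv\<^bsub>Out F\<^esub> \<phi>))) r"
proof -
  interpret FG: group F
    unfolding F_def by (rule group_free_group)
  have M1: "M \<ge> 1" using M by simp
  have auto: "word_map (Suc M) (fam M k) \<in> auto F" "word_map (Suc M) (fam_inv M k) \<in> auto F"
    unfolding F_def using fam_auto[OF M1] by auto
  show "\<phi> \<in> carrier (Out F)"
    using auto by (simp add: \<phi>_def FG.carrier_Out)
  obtain \<mu> where \<mu>: "pisot M (int k) 1 \<mu>" "real k - 1 \<le> \<mu>"
    using pisot_exists[of M 1 "int k"] M k by auto
  interpret P: pisot M "int k" 1 \<mu> by (rule \<mu>(1))
  show "out_fully_irreducible F \<phi>"
    unfolding F_def \<phi>_def by (rule fam_fully_irreducible[OF \<mu>(1)])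
  have "stretch_factor (Suc M) \<phi> = \<mu>"
    unfolding \<phi>_def F_def
    using fam_words fam_reduced P.\<mu>3 P.root
    by (intro stretch_factor_rose_standard fam_train_track fam_irreducible fam_PF M1 auto[unfolded F_def]) auto
  moreover have "minimal_int_poly \<mu> = pisot_poly M (int k)"
    using P.irreducible_pisot_poly pisot_poly_monic(2)[OF M1] by (intro minimal_int_poly_eqI) auto
  ultimately show "\<exists>r\<ge>real k - 1. has_spectral_ratio (minimal_int_poly (stretch_factor (Suc M) \<phi>)) r"
    using P.spectral_ratio_pisot_poly \<mu>(2) by (metis order_trans)
  have "compose (carrier F) (word_map (Suc M) (fam_inv M k)) (word_map (Suc M) (fam M k)) = (\<lambda>x\<in>carrier F. x)"
    unfolding F_def using word_map_compose[of "Suc M" "fam M k" "fam_inv M k"] fam_words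
      word_map_eqI[of "Suc M" "\<lambda>i. path_image (fam_inv M k) (fam M k i)" "\<lambda>i. [(i, True)]"] fam_inverse(2)[OF M1]
    by (simp add: word_map_id)
  then have inv: "inv\<^bsub>Out F\<^esub> \<phi> = outer F (word_map (Suc M) (fam_inv M k))"
    unfolding \<phi>_def using auto by (intro FG.outer_inverse)
  obtain x :: real where x: "x > 1" "ipoly (inverse_poly M (int k)) x = 0"
    using inverse_poly_positive_root[of M "int k"] M k by auto
  have "x ^ Suc M = real k * x + 1"
    using x(2) unfolding ipoly_inverse_poly by simp
  moreover have "legal M (fam_inv M k i)" if "i < Suc M" for i
    using fam_inv_legal[OF M, of "[(i, True)]" k] that by (simp add: path_image_single legal_def)
  moreover have "fam_inv M k i \<noteq> []" for i
    by (simp add: fam_inv_def)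
  ultimately have "stretch_factor (Suc M) (inv\<^bsub>Out F\<^esub> \<phi>) = x"
    unfolding inv unfolding F_def using fam_inv_words[OF M1] x(1)
    by (intro stretch_factor_rose_standard fam_inv_train_track fam_inv_irreducible fam_inv_PF M1 M auto[unfolded F_def])
      (auto intro: legal_reduced)
  moreover have "\<exists>\<nu>. pisot M (int k) ((- 1) ^ Suc M) \<nu>"
    using pisot_exists[of M "(- 1) ^ Suc M" "int k"] M1 k by (auto simp: power_abs)
  then have "minimal_int_poly x = inverse_poly M (int k)"
    using pisot.irreducible_inverse_poly inverse_poly_monic(2)[OF M1] x(2) by (intro minimal_int_poly_eqI) auto
  ultimately show "\<exists>r\<ge>1. r \<le> (real k + 1) / (real k - 1) \<and>
       has_spectral_ratio (minimal_int_poly (stretch_factor (Suc M) (inv\<^bsub>Out F\<^esub> \<phi>))) r"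
    using spectral_ratio_inverse_poly[OF M, of "int k"] k by auto
qed

theorem family_exists:
  assumes N: "N \<ge> 3"
  shows "\<exists>\<phi> :: nat \<Rightarrow> (letter list \<Rightarrow> letter list) set.
            (\<forall>k. \<phi> k \<in> carrier (Out (free_group N)) \<and>
                 out_fully_irreducible (free_group N) (\<phi> k) \<and>
                 out_spectral_ratio_defined N (\<phi> k) \<and>
                 out_spectral_ratio_defined N (inv\<^bsub>Out (free_group N)\<^esub> (\<phi> k))) \<and>
            filterlim (\<lambda>k. out_spectral_ratio N (\<phi> k)) at_top sequentially \<and>
            (\<lambda>k. out_spectral_ratio N (inv\<^bsub>Out (free_group N)\<^esub> (\<phi> k))) \<longlonglongrightarrow> 1"
proof -
  define M where "M = N - 1"
  have M: "M \<ge> 2" "N = Suc M"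
    using N by (auto simp: M_def)
  define \<phi> where "\<phi> k = outer (free_group N) (word_map N (fam M (k + 6)))" for k
  note fam = fam_spectral_ratios[OF M(1), of "_ + 6", folded M(2), folded \<phi>_def, simplified]
  have defined: "out_spectral_ratio_defined N (\<phi> k)" "out_spectral_ratio_defined N (inv\<^bsub>Out (free_group N)\<^esub> (\<phi> k))" for k
    using fam(3,4)[of k] by (auto simp: out_spectral_ratio_defined_def spectral_ratio_defined_def)
  have big: "real k + 5 \<le> out_spectral_ratio N (\<phi> k)" for k
    using fam(3)[of k] by (auto simp: out_spectral_ratio_def dest: spectral_ratio_eqI)
  have near: "1 \<le> out_spectral_ratio N (inv\<^bsub>Out (free_group N)\<^esub> (\<phi> k))"
    "out_spectral_ratio N (inv\<^bsub>Out (free_group N)\<^esub> (\<phi> k)) \<le> (real k + 7) / (real k + 5)" for k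
    using fam(4)[of k] by (auto simp: out_spectral_ratio_def algebra_simps dest: spectral_ratio_eqI)
  have "filterlim (\<lambda>k. out_spectral_ratio N (\<phi> k)) at_top sequentially"
    by (rule filterlim_at_top_mono[OF filterlim_real_sequentially])
      (use order_trans[OF _ big] in \<open>auto intro!: always_eventually\<close>)
  moreover have "(\<lambda>k. out_spectral_ratio N (inv\<^bsub>Out (free_group N)\<^esub> (\<phi> k))) \<longlonglongrightarrow> 1"
  proof (rule tendsto_sandwich[where f = "\<lambda>_. 1" and h = "\<lambda>k. (real k + 7) / (real k + 5)"])
    show "(\<lambda>k. (real k + 7) / (real k + 5)) \<longlonglongrightarrow> 1"
    proof -
      have "filterlim (\<lambda>k. real k + 5) at_infinity sequentially"
        by (rule filterlim_at_top_imp_at_infinity)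
          (rule filterlim_at_top_mono[OF filterlim_real_sequentially], auto intro: always_eventually)
      then have "(\<lambda>k. 2 / (real k + 5)) \<longlonglongrightarrow> 0"
        by (rule tendsto_divide_0[OF tendsto_const])
      then have "(\<lambda>k. 1 + 2 / (real k + 5)) \<longlonglongrightarrow> 1 + 0"
        by (intro tendsto_add tendsto_const)
      moreover have "1 + 2 / (real k + 5) = (real k + 7) / (real k + 5)" for k
        by (simp add: field_simps)
      ultimately show ?thesis by simp
    qed
  qed (use near in auto)
  ultimately show ?thesis
    using fam(1,2) defined by (intro exI[of _ \<phi>]) auto
qed


section \<open>Rank one\<close>

lemma reduced_word_rank_one:
  "reduced_word w \<Longrightarrow> w \<in> words 1 \<Longrightarrow> \<exists>b. w = replicate (length w) (0, b)"
proof (induction w)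
  case (Cons x w)
  then obtain b where b: "w = replicate (length w) (0, b)"
    by (auto simp: reduced_word_Cons)
  have x0: "fst x = 0"
    using Cons.prems by simp
  show ?case
  proof (cases "w = []")
    case True
    then show ?thesis
      using x0 by (intro exI[of _ "snd x"]) (simp add: prod_eq_iff)
  next
    case False
    then have "hd w = (0, b)"
      by (subst b) (simp add: hd_replicate)
    moreover have "hd w \<noteq> inv_letter x"
      using Cons.prems False by (simp add: reduced_word_Cons)
    ultimately have "x = (0, b)"
      using x0 by (auto simp: inv_letter_def prod_eq_iff)
    then show ?thesis
      using b by (intro exI[of _ b]) simp
  qed
qed simp

lemma spectral_ratio_undefined_linear:
  assumes "lead_coeff f = 1" "degree f \<le> 1"
  shows "\<not> spectral_ratio_defined f"
  using ordered_roots_facts(1)[OF _ assms(1)] assms(2)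
  by (auto simp: spectral_ratio_defined_def has_spectral_ratio_def)

text \<open>In rank one the stretch factor is an integer, so it has no conjugates at all.\<close>

lemma rank_one_no_spectral_ratio:
  assumes \<phi>: "\<phi> \<in> carrier (Out (free_group 1))"
  shows "\<not> out_spectral_ratio_defined 1 \<phi>"
proof -
  let ?F = "free_group 1"
  interpret group ?F by (rule group_free_group)
  obtain \<alpha> where \<alpha>: "\<alpha> \<in> auto ?F" "\<phi> = outer ?F \<alpha>"
    using \<phi> unfolding carrier_Out by blast
  define f where "f i = \<alpha> [(i, True)]" for i :: nat
  have \<alpha>f: "\<alpha> = word_map 1 f"
    unfolding f_def by (rule hom_eq_word_map[OF auto_hom[OF \<alpha>(1)] auto_ext[OF \<alpha>(1)]])
  have f0: "f 0 \<in> carrier ?F"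
    unfolding f_def by (rule auto_closed[OF \<alpha>(1)]) simp
  have "f 0 \<noteq> []"
  proof
    assume "f 0 = []"
    moreover have "\<alpha> [] = []"
      by (simp add: \<alpha>f word_map_apply)
    ultimately have "\<alpha> [(0, True)] = \<alpha> []"
      by (simp add: f_def)
    then show False
      using inj_onD[OF bij_betw_imp_inj_on[OF auto_bij[OF \<alpha>(1)]], of "[(0, True)]" "[]"] by simp
  qed
  moreover obtain b where b: "f 0 = replicate (length (f 0)) (0, b)"
    using reduced_word_rank_one f0 by auto
  ultimately obtain n where n: "f 0 = replicate n (0, b)" "n > 0"
    by auto
  have "train_track (rose 1) f"
  proof (rule train_track_roseI[where P = "\<lambda>w. \<exists>n b. w = replicate n (0, b)"])
    fix w :: "letter list" assume "\<exists>n b. w = replicate n (0, b)"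
    then obtain m c where w: "w = replicate m (0, c)" by blast
    have "path_image f w = replicate (m * n) (0, if c then b else \<not> b)"
      unfolding w by (induction m) (auto simp: path_image_Cons n inv_word_replicate inv_letter_def replicate_add)
    then show "\<exists>n b. path_image f w = replicate n (0, b)" by blast
  next
    show "\<exists>n b. [(i, True)] = replicate n (0, b)" if "i < 1" for i :: nat
      using that by (intro exI[of _ 1] exI[of _ True]) simp
  qed (use f0 in auto)
  moreover have "irreducible_mat (transition_matrix (rose 1) f)"
    using n by (intro irreducible_roseI) simp
  moreover have "PF_eigenvalue (transition_matrix (rose 1) f) (real n)"
    using n by (intro PF_eigenvalue_roseI[where w = "\<lambda>_. 1"]) auto
  ultimately have "stretch_factor 1 \<phi> = real n"
    unfolding \<alpha>(2) \<alpha>f using f0 \<open>f 0 \<noteq> []\<close> \<alpha>(1)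
    by (intro stretch_factor_rose_standard) (auto simp: \<alpha>f)
  moreover have "minimal_int_poly (real n) = [:- int n, 1:]"
  proof (rule minimal_int_poly_eqI)
    show root: "ipoly [:- int n, 1:] (real n) = 0"
      by (simp add: map_poly_pCons)
    show "irreducible [:- int n, 1:]"
    proof (rule irreducible_monicI[OF _ _ root])
      fix g :: "int poly" assume g: "degree g \<le> 0" "ipoly g (real n) = 0"
      then obtain c where "g = [:c:]"
        using degree_eq_zeroE by blast
      moreover have "coeff g 0 = 0"
        using ipoly_eq_sum[OF g(1), of "real n"] g(2) by simp
      ultimately show "g = 0"
        by simp
    qed simp_all
  qed simp
  ultimately show ?thesis
    using spectral_ratio_undefined_linear[of "[:- int n, 1:]"] by (simp add: out_spectral_ratio_defined_def)
qed


section \<open>Relations between generators in rank two\<close>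

text \<open>The part of \<open>x\<close> that cancels in the product \<open>x y\<close>.\<close>

definition cancels :: "letter list \<Rightarrow> letter list \<Rightarrow> letter list \<Rightarrow> bool" where
  "cancels x y p \<longleftrightarrow> (\<exists>x' y'. x = x' @ p \<and> y = inv_word p @ y' \<and> reduced_word (x' @ y'))"

lemma cancels_exists:
  assumes "reduced_word x" "reduced_word y"
  shows "\<exists>p. cancels x y p"
  using assms
proof (induction x arbitrary: y rule: rev_induct)
  case Nil
  then show ?case
    by (intro exI[of _ "[]"]) (simp add: cancels_def)
next
  case (snoc l x)
  show ?case
  proof (cases "y \<noteq> [] \<and> hd y = inv_letter l")
    case True
    then obtain z where z: "y = inv_letter l # z"
      by (metis list.exhaust_sel)
    obtain p x' y' where "x = x' @ p" "z = inv_word p @ y'" "reduced_word (x' @ y')"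
      using snoc.IH[of z] snoc.prems by (auto simp: z reduced_word_append reduced_word_Cons cancels_def)
    then show ?thesis
      unfolding cancels_def by (intro exI[of _ "p @ [l]"] exI[of _ x'] exI[of _ y']) (simp add: z)
  next
    case False
    then have "reduced_word ((x @ [l]) @ y)"
      unfolding reduced_word_append[of "x @ [l]" y] using snoc.prems by auto
    then show ?thesis
      unfolding cancels_def by (intro exI[of _ "[]"] exI[of _ "x @ [l]"] exI[of _ y]) simp
  qed
qed

lemma cancels_length:
  assumes "cancels x y p"
  shows "length (reduce_word (x @ y)) + 2 * length p = length x + length y"
proof -
  obtain x' y' where *: "x = x' @ p" "y = inv_word p @ y'" "reduced_word (x' @ y')"
    using assms by (auto simp: cancels_def)
  have "reduce_word (x @ y) = reduce_word (x' @ y')"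
    by (rule reduce_word_eqI) (simp add: * fg_arith del: add_uminus_conv_diff)
  then show ?thesis
    using *(3) by (simp add: *)
qed

text \<open>
  A word that cancels half of itself against itself would be its own inverse in the middle.
\<close>

lemma cancels_self:
  assumes x: "reduced_word x" "x \<noteq> []" and c: "cancels x x p"
  shows "2 * length p < length x"
proof (rule ccontr)
  assume half: "\<not> 2 * length p < length x"
  define n where "n = length x"
  obtain x' y' where *: "x = x' @ p" "x = inv_word p @ y'"
    using c unfolding cancels_def by blast
  have mirror: "x ! i = inv_letter (x ! (n - 1 - i))" if i: "i < length p" for i
  proof -
    have "x ! i = inv_word p ! i"
      using i by (subst *(2)) (simp add: nth_append)
    also have "\<dots> = inv_letter (p ! (length p - 1 - i))"
      using i by (simp add: inv_word_def rev_nth)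
    also have "p ! (length p - 1 - i) = x ! (n - 1 - i)"
    proof -
      have "n - 1 - i = length x' + (length p - 1 - i)"
        using i by (simp add: n_def *(1))
      then show ?thesis
        by (simp only: *(1) nth_append_length_plus)
    qed
    finally show ?thesis .
  qed
  have n: "n > 0" "n \<le> 2 * length p"
    using x(2) half by (auto simp: n_def)
  show False
  proof (cases "even n")
    case True
    then obtain m where m: "n = 2 * m" by blast
    then have m1: "m - 1 < length p" "n - 1 - (m - 1) = m" "Suc (m - 1) = m" "m < length x"
      using n by (auto simp: n_def[symmetric])
    have "Suc (m - 1) < length x \<longrightarrow> x ! Suc (m - 1) \<noteq> inv_letter (x ! (m - 1))"
      using x(1) unfolding reduced_word_def successively_conv_nth by blast
    then have "x ! m \<noteq> inv_letter (x ! (m - 1))"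
      unfolding m1(3) using m1(4) by blast
    then show False
      using mirror[OF m1(1)] unfolding m1(2) by simp
  next
    case False
    then obtain m where m: "n = 2 * m + 1" by (elim oddE)
    then have "x ! m = inv_letter (x ! m)"
      using mirror[of m] n by simp
    then show False by simp
  qed
qed

text \<open>
  If adjacent factors never cancel a factor completely, every factor contributes at least one
  letter to the reduced form of the product.
\<close>

lemma length_product_ge:
  assumes nz: "\<And>x. x \<in> X \<Longrightarrow> x \<noteq> [] \<and> reduced_word x"
    and small: "\<And>x y z p q. x \<in> X \<Longrightarrow> y \<in> X \<Longrightarrow> z \<in> X \<Longrightarrow> R x y \<Longrightarrow> R y z \<Longrightarrow>
       cancels x y p \<Longrightarrow> cancels y z q \<Longrightarrow> length p + length q < length y"
    and half: "\<And>x y p. x \<in> X \<Longrightarrow> y \<in> X \<Longrightarrow> R x y \<Longrightarrow> cancels x y p \<Longrightarrow> length p < length x \<and> length p < length y"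
    and xs: "set xs \<subseteq> X" "successively R xs"
  shows "length xs \<le> length (reduce_word (concat xs))"
proof (cases xs)
  case (Cons x0 rest)
  have "\<exists>x' p t. x = x' @ p \<and> reduce_word (concat (x # ys)) = x' @ t \<and> reduced_word (x' @ t) \<and> length ys \<le> length t \<and>
      x' \<noteq> [] \<and> (ys = [] \<longrightarrow> p = []) \<and> (ys \<noteq> [] \<longrightarrow> cancels x (hd ys) p)"
    if "set (x # ys) \<subseteq> X" "successively R (x # ys)" for x ys
    using that
  proof (induction ys arbitrary: x)
    case Nil
    then show ?case
      using nz[of x] by (intro exI[of _ x] exI[of _ "[]"]) simp
  next
    case (Cons y ys)
    have yy: "set (y # ys) \<subseteq> X" "successively R (y # ys)"
      using Cons.prems by auto
    obtain y1 p t where IH: "y = y1 @ p" "reduce_word (concat (y # ys)) = y1 @ t" "reduced_word (y1 @ t)"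
        "length ys \<le> length t" "y1 \<noteq> []" "ys = [] \<longrightarrow> p = []" "ys \<noteq> [] \<longrightarrow> cancels y (hd ys) p"
      using Cons.IH[OF yy] by (elim exE conjE) (rule that)
    have x: "x \<in> X" "y \<in> X" "R x y"
      using Cons.prems by auto
    obtain q where q: "cancels x y q"
      using cancels_exists nz x by blast
    then obtain x' y' where d: "x = x' @ q" "y = inv_word q @ y'" "reduced_word (x' @ y')"
      by (auto simp: cancels_def)
    have len: "length q + length p < length y"
    proof (cases ys)
      case Nil
      then show ?thesis
        using IH half[OF x q] by simp
    next
      case (Cons z zs)
      then have "z \<in> X" "R y z"
        using Cons.prems by auto
      then show ?thesis
        using small[OF x(1,2) _ x(3) _ q, of z p] IH(7) Cons by simp
    qed
    have "length q < length y1"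
      using len IH(1) by simp
    then obtain y2 where y2: "y1 = inv_word q @ y2" "y2 \<noteq> []"
    proof -
      have "y1 @ p = inv_word q @ y'"
        using IH(1) d(2) by simp
      then consider us where "y1 = inv_word q @ us" | us where "y1 @ us = inv_word q"
        unfolding append_eq_append_conv2 by blast
      then show ?thesis
      proof cases
        case (1 us)
        then show ?thesis
          using \<open>length q < length y1\<close> by (intro that[of us]) auto
      next
        case (2 us)
        have "length y1 + length us = length q"
          using arg_cong[OF 2, of length] by (simp only: length_append inv_word_simps)
        then show ?thesis
          using \<open>length q < length y1\<close> by simp
      qed
    qed
    then have y': "y' = y2 @ p"
      using IH(1) d(2) by simp
    have "reduced_word (x' @ (y2 @ t))"
      using d(3) IH(3) y2 unfolding y' by (auto simp: reduced_word_append)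
    moreover have "reduce_word (concat (x # y # ys)) = reduce_word (x' @ (y2 @ t))"
    proof (rule reduce_word_eqI)
      have "fg (concat (x # y # ys)) = fg x + fg (y1 @ t)"
        by (simp flip: IH(2))
      then show "fg (concat (x # y # ys)) = fg (x' @ (y2 @ t))"
        by (simp add: d(1) y2(1) fg_arith del: add_uminus_conv_diff)
    qed
    moreover have "length (y # ys) \<le> length (y2 @ t)"
      using IH(4) y2(2) by (cases y2) auto
    moreover have "x' \<noteq> []"
      using half[OF x q] d(1) by auto
    ultimately show ?case
      using q d(1) by (intro exI[of _ x'] exI[of _ q] exI[of _ "y2 @ t"]) simp
  qed
  from this[of x0 rest] obtain x' t where "reduce_word (concat xs) = x' @ t" "length rest \<le> length t" "x' \<noteq> []"
    using xs Cons by auto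
  then show ?thesis
    using Cons by (cases x') auto
qed simp


section \<open>A normal form up to conjugation\<close>

text \<open>
  The outer automorphism group of the free group of rank two, presented by \<open>s\<close> (swapping the
  generators), \<open>d\<close> (inverting \<open>a\<close>) and \<open>e\<close> (\<open>a \<mapsto> ab\<close>).  With \<open>f = s e s\<close> and the central
  involution \<open>\<iota> = (d s)\<^sup>2\<close>, the relations make it possible to move \<open>s\<close>, \<open>d\<close> and \<open>\<iota>\<close> to the
  right and to replace \<open>f e\<^sup>-\<^sup>1\<close> and \<open>e f\<^sup>-\<^sup>1\<close> by words that are positive in \<open>e\<close> and \<open>f\<close>.
\<close>

locale rank_two_relations = group G for G (structure) +
  fixes s d e
  assumes closed [simp]: "s \<in> carrier G" "d \<in> carrier G" "e \<in> carrier G"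
    and ss: "s \<otimes> s = \<one>" and dd: "d \<otimes> d = \<one>"
    and eded: "e \<otimes> (d \<otimes> (e \<otimes> d)) = \<one>"
    and ii: "d \<otimes> (s \<otimes> (d \<otimes> (s \<otimes> (d \<otimes> (s \<otimes> (d \<otimes> s)))))) = \<one>"
    and ie: "(d \<otimes> (s \<otimes> (d \<otimes> s))) \<otimes> e = e \<otimes> (d \<otimes> (s \<otimes> (d \<otimes> s)))"
    and braid: "s \<otimes> (e \<otimes> s) = e \<otimes> (s \<otimes> (d \<otimes> e))"
begin

definition "f = s \<otimes> (e \<otimes> s)"
definition "\<iota> = d \<otimes> (s \<otimes> (d \<otimes> s))"

lemma f_closed [simp]: "f \<in> carrier G" and \<iota>_closed [simp]: "\<iota> \<in> carrier G"
  by (simp_all add: f_def \<iota>_def)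

lemma ext: "x \<otimes> y = z \<Longrightarrow> x \<in> carrier G \<Longrightarrow> y \<in> carrier G \<Longrightarrow> w \<in> carrier G \<Longrightarrow> x \<otimes> (y \<otimes> w) = z \<otimes> w"
  by (simp flip: m_assoc)

lemma inv_cancel [simp]:
  "x \<in> carrier G \<Longrightarrow> w \<in> carrier G \<Longrightarrow> inv x \<otimes> (x \<otimes> w) = w"
  "x \<in> carrier G \<Longrightarrow> w \<in> carrier G \<Longrightarrow> x \<otimes> (inv x \<otimes> w) = w"
  by (simp_all flip: m_assoc)

lemma ss' [simp]: "w \<in> carrier G \<Longrightarrow> s \<otimes> (s \<otimes> w) = w"
  and dd' [simp]: "w \<in> carrier G \<Longrightarrow> d \<otimes> (d \<otimes> w) = w"
  using ext[OF ss] ext[OF dd] by simp_all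

declare ss [simp] dd [simp]

lemma \<iota>\<iota> [simp]: "\<iota> \<otimes> \<iota> = \<one>"
  using ii by (simp add: \<iota>_def m_assoc)

lemma \<iota>\<iota>' [simp]: "w \<in> carrier G \<Longrightarrow> \<iota> \<otimes> (\<iota> \<otimes> w) = w"
  using ext[OF \<iota>\<iota>] by simp

lemma inv_s [simp]: "inv s = s" and inv_d [simp]: "inv d = d" and inv_\<iota> [simp]: "inv \<iota> = \<iota>"
  by (rule inv_equality; simp)+

lemma ds: "d \<otimes> s = s \<otimes> (d \<otimes> \<iota>)"
  by (simp add: \<iota>_def)

lemma \<iota>s: "\<iota> \<otimes> s = s \<otimes> \<iota>"
proof -
  have "inv \<iota> = s \<otimes> (d \<otimes> (s \<otimes> d))"
    unfolding \<iota>_def by (simp add: inv_mult_group m_assoc del: inv_\<iota>)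
  then have "\<iota> = s \<otimes> (d \<otimes> (s \<otimes> d))" by simp
  then have "s \<otimes> \<iota> = d \<otimes> (s \<otimes> d)" by simp
  also have "\<dots> = \<iota> \<otimes> s"
    by (simp add: \<iota>_def m_assoc)
  finally show ?thesis by simp
qed

lemma \<iota>d: "\<iota> \<otimes> d = d \<otimes> \<iota>"
proof -
  have "inv \<iota> = s \<otimes> (d \<otimes> (s \<otimes> d))"
    unfolding \<iota>_def by (simp add: inv_mult_group m_assoc del: inv_\<iota>)
  then have i: "\<iota> = s \<otimes> (d \<otimes> (s \<otimes> d))" by simp
  have "\<iota> \<otimes> d = s \<otimes> (d \<otimes> s)"
    by (subst i) (simp add: m_assoc)
  then show ?thesis
    by (simp add: \<iota>_def)
qed

lemma \<iota>e: "\<iota> \<otimes> e = e \<otimes> \<iota>"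
  using ie by (simp add: \<iota>_def)

lemma \<iota>f: "\<iota> \<otimes> f = f \<otimes> \<iota>"
  unfolding f_def by (simp add: m_assoc ext[OF \<iota>s] ext[OF \<iota>e] \<iota>s)

lemma se: "s \<otimes> e = f \<otimes> s" and sf: "s \<otimes> f = e \<otimes> s"
  by (simp_all add: f_def m_assoc)

lemma de: "d \<otimes> e = inv e \<otimes> d"
proof -
  have "inv e \<otimes> (e \<otimes> (d \<otimes> (e \<otimes> d))) = inv e"
    using eded by simp
  then have "d \<otimes> (e \<otimes> d) = inv e"
    by simp
  then have "(d \<otimes> (e \<otimes> d)) \<otimes> d = inv e \<otimes> d" by simp
  then show ?thesis by (simp add: m_assoc)
qed

lemma inv_f: "inv f = s \<otimes> (inv e \<otimes> s)"
  by (simp add: f_def inv_mult_group m_assoc)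

lemma inverse_swap: "x \<in> carrier G \<Longrightarrow> y \<in> carrier G \<Longrightarrow> z \<in> carrier G \<Longrightarrow> z \<otimes> x = y \<otimes> z \<Longrightarrow> z \<otimes> inv x = inv y \<otimes> z"
proof -
  assume c: "x \<in> carrier G" "y \<in> carrier G" "z \<in> carrier G" and eq: "z \<otimes> x = y \<otimes> z"
  have "inv y \<otimes> ((z \<otimes> x) \<otimes> inv x) = inv y \<otimes> ((y \<otimes> z) \<otimes> inv x)"
    by (simp only: eq)
  moreover have "inv y \<otimes> ((z \<otimes> x) \<otimes> inv x) = inv y \<otimes> z"
    using c by (simp add: m_assoc)
  moreover have "inv y \<otimes> ((y \<otimes> z) \<otimes> inv x) = z \<otimes> inv x"
    using c by (simp add: m_assoc)
  ultimately show ?thesis by (simp only:)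
qed

lemma se_inv: "s \<otimes> inv e = inv f \<otimes> s" and sf_inv: "s \<otimes> inv f = inv e \<otimes> s"
  and \<iota>e_inv: "\<iota> \<otimes> inv e = inv e \<otimes> \<iota>" and \<iota>f_inv: "\<iota> \<otimes> inv f = inv f \<otimes> \<iota>"
  using inverse_swap se sf \<iota>e \<iota>f by simp_all

lemma de_inv: "d \<otimes> inv e = e \<otimes> d"
  using inverse_swap[OF _ _ _ de] by simp

lemma df: "d \<otimes> f = inv f \<otimes> d"
  unfolding inv_f unfolding f_def
  by (simp add: m_assoc ext[OF ds] ds ext[OF \<iota>e] ext[OF \<iota>s] ext[OF de] \<iota>s ext[OF \<iota>d] \<iota>d ext[OF \<iota>e_inv])

lemma df_inv: "d \<otimes> inv f = f \<otimes> d"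
  using inverse_swap[OF _ _ _ df] by simp

lemma fe_inv: "f \<otimes> inv e = e \<otimes> (s \<otimes> d)"
  using braid by (simp add: f_def inv_solve_right' m_assoc flip: f_def)

lemmas moves = ds \<iota>s \<iota>d \<iota>e \<iota>f se sf de df se_inv sf_inv \<iota>e_inv \<iota>f_inv de_inv df_inv

lemmas move_right = moves moves[THEN ext, simplified] m_assoc

lemma ef_inv: "e \<otimes> inv f = f \<otimes> (s \<otimes> (d \<otimes> \<iota>))"
proof -
  have "e \<otimes> inv f = s \<otimes> (f \<otimes> inv e) \<otimes> s"
    by (simp add: move_right)
  also have "\<dots> = f \<otimes> (s \<otimes> (d \<otimes> \<iota>))"
    unfolding fe_inv by (simp add: move_right)
  finally show ?thesis .
qed

definition gen :: "bool \<Rightarrow> 'a" where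
  "gen b = (if b then e else f)"

definition val :: "bool list \<Rightarrow> 'a" where
  "val w = foldr (\<lambda>b x. gen b \<otimes> x) w \<one>"

definition tailpart :: "bool \<Rightarrow> bool \<Rightarrow> bool \<Rightarrow> 'a" where
  "tailpart j k i = (if j then s else \<one>) \<otimes> ((if k then d else \<one>) \<otimes> (if i then \<iota> else \<one>))"

lemma gen_closed [simp]: "gen b \<in> carrier G"
  by (simp add: gen_def)

lemma val_closed [simp]: "val w \<in> carrier G"
  by (induction w) (auto simp: val_def)

lemma val_simps [simp]: "val [] = \<one>" "val (b # w) = gen b \<otimes> val w"
  by (simp_all add: val_def)

lemma val_append: "val (u @ w) = val u \<otimes> val w"
  by (induction u) (simp_all add: m_assoc)

lemma tailpart_closed [simp]: "tailpart j k i \<in> carrier G"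
  by (simp add: tailpart_def)

definition good :: "'a set" where
  "good = {val w \<otimes> tailpart j k i | w j k i. True}"

definition spanned :: "'a set" where
  "spanned = good \<union> (\<lambda>x. d \<otimes> x) ` good"

lemma tailpart_mult:
  "tailpart j k i \<otimes> tailpart j2 k2 i2 = tailpart (j \<noteq> j2) (k \<noteq> k2) ((i \<noteq> i2) \<noteq> (k \<and> j2))"
  by (cases j; cases k; cases i; cases j2; cases k2; cases i2) (simp_all add: tailpart_def move_right)

lemma tailpart_gen:
  "tailpart j k i \<otimes> gen b = (if k then inv (gen (b \<noteq> j)) else gen (b \<noteq> j)) \<otimes> tailpart j k i"
  by (cases j; cases k; cases i; cases b) (simp_all add: tailpart_def gen_def move_right)

lemma tailpart_val:
  "tailpart j False i \<otimes> val w = val (map (\<lambda>b. b \<noteq> j) w) \<otimes> tailpart j False i"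
proof (induction w)
  case (Cons b w)
  have "tailpart j False i \<otimes> val (b # w) = (tailpart j False i \<otimes> gen b) \<otimes> val w"
    by (simp add: m_assoc)
  also have "\<dots> = gen (b \<noteq> j) \<otimes> (tailpart j False i \<otimes> val w)"
    unfolding tailpart_gen by (simp add: m_assoc)
  finally show ?case
    using Cons by (simp add: m_assoc)
qed simp

lemma gen_inv_gen:
  "gen b \<otimes> inv (gen c) = (if b = c then \<one> else gen (\<not> b)) \<otimes> tailpart (b \<noteq> c) (b \<noteq> c) (b \<and> \<not> c)"
  by (cases b; cases c) (simp_all add: gen_def tailpart_def fe_inv ef_inv)

lemma goodI: "val w \<otimes> tailpart j k i \<in> good"
  by (auto simp: good_def)

lemma good_carrier: "x \<in> good \<Longrightarrow> x \<in> carrier G"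
  by (auto simp: good_def)

lemma good_mult_tailpart:
  assumes "x \<in> good"
  shows "x \<otimes> tailpart j k i \<in> good"
proof -
  obtain w j' k' i' where "x = val w \<otimes> tailpart j' k' i'"
    using assms by (auto simp: good_def)
  then show ?thesis
    by (simp add: m_assoc tailpart_mult goodI)
qed

lemma spanned_mult_tailpart: "x \<in> spanned \<Longrightarrow> x \<otimes> tailpart j k i \<in> spanned"
  using good_mult_tailpart good_carrier by (auto simp: spanned_def m_assoc)

lemma good_mult_e:
  assumes "x \<in> good"
  shows "x \<otimes> e \<in> spanned"
proof -
  obtain w j k i where x: "x = val w \<otimes> tailpart j k i"
    using assms by (auto simp: good_def)
  have xe: "x \<otimes> e = val w \<otimes> ((if k then inv (gen (\<not> j)) else gen (\<not> j)) \<otimes> tailpart j k i)"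
    using tailpart_gen[of j k i True] by (simp add: x m_assoc gen_def)
  show ?thesis
  proof (cases k)
    case False
    then have "x \<otimes> e = val (w @ [\<not> j]) \<otimes> tailpart j k i"
      using xe by (simp add: val_append m_assoc)
    then show ?thesis
      using goodI by (simp add: spanned_def)
  next
    case k: True
    show ?thesis
    proof (cases w rule: rev_cases)
      case Nil
      have "inv (gen b) = d \<otimes> (gen b \<otimes> d)" for b
        by (cases b) (simp_all add: gen_def move_right)
      then have "x \<otimes> e = d \<otimes> (gen (\<not> j) \<otimes> (tailpart False True False \<otimes> tailpart j k i))"
        using xe k Nil by (simp add: m_assoc) (simp add: tailpart_def)
      also have "\<dots> \<in> spanned"
        using goodI[of "[\<not> j]"] by (simp add: tailpart_mult spanned_def)
      finally show ?thesis .
    next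
      case (snoc v b)
      have "x \<otimes> e = val v \<otimes> ((gen b \<otimes> inv (gen (\<not> j))) \<otimes> tailpart j k i)"
        using xe k snoc by (simp add: val_append m_assoc)
      also have "\<dots> = val (v @ (if b = (\<not> j) then [] else [\<not> b]))
          \<otimes> (tailpart (b \<noteq> (\<not> j)) (b \<noteq> (\<not> j)) (b \<and> \<not> (\<not> j)) \<otimes> tailpart j k i)"
        unfolding gen_inv_gen by (simp add: val_append m_assoc)
      also have "\<dots> \<in> spanned"
        using goodI by (simp add: spanned_def tailpart_mult)
      finally show ?thesis .
    qed
  qed
qed

lemma spanned_mult_e:
  assumes "x \<in> spanned"
  shows "x \<otimes> e \<in> spanned"
proof (cases "x \<in> good")
  case False
  then obtain y where y: "y \<in> good" "x = d \<otimes> y"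
    using assms by (auto simp: spanned_def)
  have "d \<otimes> z \<in> spanned" if "z \<in> spanned" for z
    using that good_carrier by (auto simp: spanned_def)
  then have "d \<otimes> (y \<otimes> e) \<in> spanned"
    using good_mult_e[OF y(1)] by blast
  then show ?thesis
    using y good_carrier by (simp add: m_assoc)
qed (rule good_mult_e)

lemma spanned_mult_s: "x \<in> spanned \<Longrightarrow> x \<otimes> s \<in> spanned"
  and spanned_mult_d: "x \<in> spanned \<Longrightarrow> x \<otimes> d \<in> spanned"
  using spanned_mult_tailpart[of x True False False] spanned_mult_tailpart[of x False True False]
  by (simp_all add: tailpart_def)

lemma spanned_one: "\<one> \<in> spanned"
  using goodI[of "[]" False False False] by (simp add: tailpart_def spanned_def)

lemma spanned_cancel:
  assumes "x \<in> carrier G"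
  shows "x \<otimes> s \<in> spanned \<Longrightarrow> x \<in> spanned" "x \<otimes> d \<in> spanned \<Longrightarrow> x \<in> spanned"
    "x \<otimes> e \<in> spanned \<Longrightarrow> x \<in> spanned" "x \<otimes> inv e \<in> spanned \<Longrightarrow> x \<in> spanned"
proof -
  show "x \<otimes> s \<in> spanned \<Longrightarrow> x \<in> spanned" "x \<otimes> d \<in> spanned \<Longrightarrow> x \<in> spanned"
    using spanned_mult_s[of "x \<otimes> s"] spanned_mult_d[of "x \<otimes> d"] assms by (simp_all add: m_assoc)
  show "x \<otimes> inv e \<in> spanned \<Longrightarrow> x \<in> spanned"
    using spanned_mult_e[of "x \<otimes> inv e"] assms by (simp add: m_assoc)
  assume "x \<otimes> e \<in> spanned"
  then have "x \<otimes> e \<otimes> d \<otimes> e \<otimes> d \<in> spanned"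
    by (rule spanned_mult_d[OF spanned_mult_e[OF spanned_mult_d]])
  moreover have "x \<otimes> e \<otimes> d \<otimes> e \<otimes> d = x \<otimes> (e \<otimes> (d \<otimes> (e \<otimes> d)))"
    using assms by (simp add: m_assoc)
  moreover have "\<dots> = x"
    unfolding eded using assms by simp
  ultimately show "x \<in> spanned"
    by (simp only:)
qed

definition conjugate :: "'a \<Rightarrow> 'a \<Rightarrow> bool" where
  "conjugate x y \<longleftrightarrow> (\<exists>\<chi>\<in>carrier G. x = \<chi> \<otimes> (y \<otimes> inv \<chi>))"

lemma conjugate_refl: "x \<in> carrier G \<Longrightarrow> conjugate x x"
  unfolding conjugate_def by (intro bexI[of _ \<one>]) auto

lemma conjugate_trans: "z \<in> carrier G \<Longrightarrow> conjugate x y \<Longrightarrow> conjugate y z \<Longrightarrow> conjugate x z"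
  unfolding conjugate_def
proof (elim bexE)
  fix \<chi> \<psi> assume "z \<in> carrier G" "\<chi> \<in> carrier G" "x = \<chi> \<otimes> (y \<otimes> inv \<chi>)" "\<psi> \<in> carrier G" "y = \<psi> \<otimes> (z \<otimes> inv \<psi>)"
  then show "\<exists>\<chi>\<in>carrier G. x = \<chi> \<otimes> (z \<otimes> inv \<chi>)"
    by (intro bexI[of _ "\<chi> \<otimes> \<psi>"]) (simp_all add: m_assoc inv_mult_group)
qed

lemma conjugate_rotate: "x \<in> carrier G \<Longrightarrow> y \<in> carrier G \<Longrightarrow> conjugate (x \<otimes> y) (y \<otimes> x)"
  unfolding conjugate_def by (intro bexI[of _ x]) (simp_all add: m_assoc)

lemma conjugate_pow:
  assumes "conjugate x y" "y \<in> carrier G" "y [^] (n::nat) = \<one>"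
  shows "x [^] n = \<one>"
proof -
  obtain \<chi> where \<chi>: "\<chi> \<in> carrier G" "x = \<chi> \<otimes> (y \<otimes> inv \<chi>)"
    using assms(1) by (auto simp: conjugate_def)
  have "x [^] m = \<chi> \<otimes> (y [^] m \<otimes> inv \<chi>)" for m :: nat
  proof (induction m)
    case (Suc m)
    have "x [^] Suc m = (\<chi> \<otimes> (y [^] m \<otimes> inv \<chi>)) \<otimes> (\<chi> \<otimes> (y \<otimes> inv \<chi>))"
      using Suc \<chi>(2) by simp
    also have "\<dots> = \<chi> \<otimes> (y [^] m \<otimes> ((inv \<chi> \<otimes> \<chi>) \<otimes> (y \<otimes> inv \<chi>)))"
      using \<chi>(1) assms(2) by (simp add: m_assoc del: l_inv)
    finally show ?case
      using \<chi>(1) assms(2) by (simp add: m_assoc)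
  qed (use \<chi> in simp)
  then show ?thesis
    using assms \<chi> by simp
qed

lemma short_words_order:
  "tailpart j True i [^] (12::nat) = \<one>"
  "(gen b \<otimes> tailpart j True i) [^] (12::nat) = \<one>"
proof -
  have pow: "x [^] (12::nat) = \<one>" if "x \<in> carrier G" "x [^] (n::nat) = \<one>" "n * m = 12" for x n m
    using that by (metis nat_pow_pow nat_pow_one)
  show "tailpart j True i [^] (12::nat) = \<one>"
    by (rule pow[of _ 4 3]; cases j; cases i) (simp_all add: tailpart_def numeral_eq_Suc move_right)
  have esd3: "x [^] (6::nat) = \<one>" if "x \<otimes> (x \<otimes> x) \<otimes> (x \<otimes> (x \<otimes> x)) = \<one>" "x \<in> carrier G" for x
    using that by (simp add: numeral_eq_Suc m_assoc)
  show "(gen b \<otimes> tailpart j True i) [^] (12::nat) = \<one>"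
  proof (cases j)
    case False
    then show ?thesis
      by (intro pow[of _ 4 3]; cases i; cases b) (simp_all add: tailpart_def gen_def numeral_eq_Suc move_right)
  next
    case True
    then show ?thesis
      by (intro pow[of _ 6 2] esd3; cases i; cases b)
        (simp_all add: tailpart_def gen_def move_right fe_inv ef_inv fe_inv[THEN ext, simplified] ef_inv[THEN ext, simplified])
  qed
qed

text \<open>
  Every element is conjugate to \<open>w s\<^sup>j \<iota>\<^sup>i\<close> with \<open>w\<close> positive in \<open>e\<close> and \<open>f\<close>, or has finite order:
  if a factor \<open>d\<close> is left, rotate the first letter of \<open>w\<close> to the end.  Passing \<open>d\<close> it is inverted,
  and then it either cancels the last letter of \<open>w\<close> or uses up \<open>d\<close>.
\<close>

lemma conjugate_positive:
  assumes "x \<in> spanned"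
  shows "(\<exists>w j i. conjugate x (val w \<otimes> tailpart j False i)) \<or> x [^] (12::nat) = \<one>"
proof -
  define P where "P x \<longleftrightarrow> (\<exists>w j i. conjugate x (val w \<otimes> tailpart j False i)) \<or> x [^] (12::nat) = \<one>" for x
  have P_conj: "P x" if "conjugate x y" "y \<in> carrier G" "P y" for x y
    using that conjugate_trans conjugate_pow unfolding P_def
    by (metis m_closed val_closed tailpart_closed)
  have P_pos: "P (val w \<otimes> tailpart j False i)" for w j i
    unfolding P_def
    by (rule disjI1, rule exI[of _ w], rule exI[of _ j], rule exI[of _ i], rule conjugate_refl) simp
  have P_d: "P (val w \<otimes> tailpart j True i)" for w j i
  proof (induction w arbitrary: j i rule: length_induct)
    case (1 w)
    show ?case
    proof (cases w)
      case Nil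
      then show ?thesis
        by (simp add: P_def short_words_order)
    next
      case (Cons b v)
      show ?thesis
      proof (cases v rule: rev_cases)
        case Nil
        then show ?thesis
          by (simp add: P_def short_words_order Cons)
      next
        case (snoc u c)
        let ?y = "val v \<otimes> tailpart j True i"
        have "conjugate (val w \<otimes> tailpart j True i) (?y \<otimes> gen b)"
          using conjugate_rotate[of "gen b" ?y] by (simp add: Cons m_assoc)
        moreover have "?y \<otimes> gen b = val u \<otimes> ((gen c \<otimes> inv (gen (b \<noteq> j))) \<otimes> tailpart j True i)"
          using tailpart_gen[of j True i b] by (simp add: snoc val_append m_assoc)
        moreover have "P (val u \<otimes> ((gen c \<otimes> inv (gen (b \<noteq> j))) \<otimes> tailpart j True i))"
        proof (cases "c = (b \<noteq> j)")
          case True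
          then have "val u \<otimes> ((gen c \<otimes> inv (gen (b \<noteq> j))) \<otimes> tailpart j True i) = val u \<otimes> tailpart j True i"
            by simp
          then show ?thesis
            using 1 by (simp add: Cons snoc)
        next
          case False
          then have "val u \<otimes> ((gen c \<otimes> inv (gen (b \<noteq> j))) \<otimes> tailpart j True i)
              = val (u @ [\<not> c]) \<otimes> (tailpart True True (c \<and> \<not> (b \<noteq> j)) \<otimes> tailpart j True i)"
            unfolding gen_inv_gen by (cases c; cases b; cases j) (simp_all add: val_append m_assoc)
          then show ?thesis
            using P_pos by (simp add: tailpart_mult)
        qed
        ultimately show ?thesis
          using P_conj by simp
      qed
    qed
  qed
  have P_good: "P x" if "x \<in> good" for x
    using that P_d P_pos by (auto simp: good_def) (metis (full_types))
  have "P x"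
  proof (cases "x \<in> good")
    case False
    then obtain y where y: "y \<in> good" "x = d \<otimes> y"
      using assms by (auto simp: spanned_def)
    have "y \<otimes> d \<in> good"
      using good_mult_tailpart[OF y(1), of False True False] by (simp add: tailpart_def)
    then show ?thesis
      using P_conj[OF conjugate_rotate[of d y]] P_good y good_carrier by simp
  qed (rule P_good)
  then show ?thesis
    by (simp add: P_def)
qed

lemma inv_val: "inv (val w) = d \<otimes> (val (rev w) \<otimes> d)"
proof (induction w)
  case (Cons b w)
  have "inv (gen b) = d \<otimes> (gen b \<otimes> d)"
    by (cases b) (simp_all add: gen_def move_right)
  then show ?case
    using Cons by (simp add: inv_mult_group val_append m_assoc)
qed simp

lemma conjugate_inverse:
  "conjugate (inv (val w \<otimes> tailpart j False i)) (val (map (\<lambda>b. b \<noteq> j) (rev w)) \<otimes> tailpart j False (i \<noteq> j))"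
proof -
  have it: "inv (tailpart j False i) = tailpart j False i"
    by (rule inv_equality) (simp_all add: tailpart_mult, simp add: tailpart_def)
  have "inv (val w \<otimes> tailpart j False i) = d \<otimes> ((d \<otimes> tailpart j False i) \<otimes> (d \<otimes> (val (rev w) \<otimes> d)))"
    by (simp add: inv_mult_group it inv_val m_assoc)
  also have "\<dots> = d \<otimes> (((d \<otimes> tailpart j False i \<otimes> d) \<otimes> val (rev w)) \<otimes> d)"
    by (simp add: m_assoc)
  also have "d \<otimes> tailpart j False i \<otimes> d = tailpart j False (i \<noteq> j)"
    using tailpart_mult[of False True False j False i] tailpart_mult[of j True "i \<noteq> j" False True False]
    by (simp add: tailpart_def) 
  also have "tailpart j False (i \<noteq> j) \<otimes> val (rev w)
      = val (map (\<lambda>b. b \<noteq> j) (rev w)) \<otimes> tailpart j False (i \<noteq> j)"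
    by (rule tailpart_val)
  finally show ?thesis
    unfolding conjugate_def by (intro bexI[of _ d]) simp_all
qed

end


section \<open>Nielsen reduction in rank two\<close>

abbreviation "F2 \<equiv> free_group 2"

definition on_gens :: "letter list \<Rightarrow> letter list \<Rightarrow> nat \<Rightarrow> letter list" where
  "on_gens u v i = (if i = 0 then u else v)"

definition "swap_gens = on_gens [(1, True)] [(0, True)]"
definition "invert_gen = on_gens [(0, False)] [(1, True)]"
definition "transvect = on_gens [(0, True), (1, True)] [(1, True)]"

abbreviation out_map :: "(nat \<Rightarrow> letter list) \<Rightarrow> (letter list \<Rightarrow> letter list) set" where
  "out_map f \<equiv> outer F2 (word_map 2 f)"

lemma less_2_iff: "i < (2::nat) \<longleftrightarrow> i = 0 \<or> i = 1"
  by auto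

lemmas compute_words = on_gens_def swap_gens_def invert_gen_def transvect_def path_image_Cons
  inv_letter_def reduce_word_Cons cancel_Cons_def

lemma F2_autos:
  "word_map 2 swap_gens \<in> auto F2" "word_map 2 invert_gen \<in> auto F2" "word_map 2 transvect \<in> auto F2"
  by (rule word_map_auto[of 2 _ swap_gens], auto simp: less_2_iff compute_words fg_eq_iff)
    (rule word_map_auto[of 2 _ invert_gen], auto simp: less_2_iff compute_words fg_eq_iff,
      rule word_map_auto[of 2 _ "on_gens [(0, True), (1, False)] [(1, True)]"],
      auto simp: less_2_iff compute_words fg_eq_iff)

lemma out_map_mult:
  assumes "word_map 2 f \<in> auto F2" "word_map 2 g \<in> auto F2" "\<And>i. i < 2 \<Longrightarrow> g i \<in> words 2"
  shows "out_map f \<otimes>\<^bsub>Out F2\<^esub> out_map g = out_map (\<lambda>i. path_image f (g i))"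
    and "word_map 2 (\<lambda>i. path_image f (g i)) \<in> auto F2"
proof -
  interpret group F2 by (rule group_free_group)
  show "out_map f \<otimes>\<^bsub>Out F2\<^esub> out_map g = out_map (\<lambda>i. path_image f (g i))"
    using outer_mult[OF assms(1,2)] word_map_compose[of 2 g f] assms(3) by simp
  show "word_map 2 (\<lambda>i. path_image f (g i)) \<in> auto F2"
    using auto_compose[OF assms(1,2)] word_map_compose[of 2 g f] assms(3) by simp
qed

lemma out_map_eqI:
  assumes h: "h \<in> words 2" and g: "word_map 2 g \<in> auto F2" "\<And>i. i < 2 \<Longrightarrow> g i \<in> words 2"
    and fg: "\<And>i. i < 2 \<Longrightarrow> fg (f i) = fg (h @ g i @ inv_word h)"
  shows "out_map f = out_map g"
proof -
  interpret group F2 by (rule group_free_group)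
  let ?h = "reduce_word h"
  have hc: "?h \<in> carrier F2"
    using h by (simp add: words_reduce)
  have conj: "fg (path_image f x) = fg (h @ path_image g x @ inv_word h)" if "x \<in> words 2" for x
    using that
  proof (induction x)
    case (Cons l x)
    then show ?case
      using fg[of "fst l"] by (simp add: path_image_Cons fg_arith del: add_uminus_conv_diff)
  qed simp
  have "word_map 2 f = compose (carrier F2) (inner_aut F2 ?h) (word_map 2 g)"
  proof
    fix x
    show "word_map 2 f x = compose (carrier F2) (inner_aut F2 ?h) (word_map 2 g) x"
      using conj[of x] auto_closed[OF g(1), of x] h
      by (auto simp: compose_def inner_aut_def word_map_def inv_free_group words_reduce fg_arith path_image_words[OF _ g(2)]
          intro!: reduce_word_eqI simp del: add_uminus_conv_diff)
  qed
  then have "word_map 2 f \<in> outer F2 (word_map 2 g)"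
    using hc by (auto simp: outer_def2[OF g(1)])
  then show ?thesis
    by (rule outer_eqI[OF g(1)])
qed

text \<open>
  The relations above hold in \<open>Out F\<^sub>2\<close>; three of them only up to an inner
  automorphism, by a power of \<open>b\<close>.
\<close>

lemma F2_gens_words:
  "i < 2 \<Longrightarrow> swap_gens i \<in> words 2" "i < 2 \<Longrightarrow> invert_gen i \<in> words 2" "i < 2 \<Longrightarrow> transvect i \<in> words 2"
  by (auto simp: less_2_iff compute_words)

lemma out_map_cong: "(\<And>i. i < 2 \<Longrightarrow> fg (f i) = fg (g i)) \<Longrightarrow> out_map f = out_map g"
  using word_map_eqI[of 2 f g] by simp

lemma out_map_one: "\<one>\<^bsub>Out F2\<^esub> = out_map (\<lambda>i. [(i, True)])"
  unfolding word_map_id by (rule group.outer_one[OF group_free_group])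

lemma id_auto: "word_map 2 (\<lambda>i. [(i, True)]) \<in> auto F2"
  unfolding word_map_id by (rule group.id_in_auto[OF group_free_group])

interpretation R: rank_two_relations "Out F2" "out_map swap_gens" "out_map invert_gen" "out_map transvect"
proof -
  interpret group F2 by (rule group_free_group)
  note mult = out_map_mult F2_autos F2_gens_words path_image_words[where N = 2 and M = 2]
  show "rank_two_relations (Out F2) (out_map swap_gens) (out_map invert_gen) (out_map transvect)"
  proof (intro rank_two_relations.intro group_Out rank_two_relations_axioms.intro)
    show "out_map swap_gens \<in> carrier (Out F2)" "out_map invert_gen \<in> carrier (Out F2)"
      "out_map transvect \<in> carrier (Out F2)"
      using F2_autos by (auto simp: carrier_Out)
    show "out_map swap_gens \<otimes>\<^bsub>Out F2\<^esub> out_map swap_gens = \<one>\<^bsub>Out F2\<^esub>"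
      "out_map invert_gen \<otimes>\<^bsub>Out F2\<^esub> out_map invert_gen = \<one>\<^bsub>Out F2\<^esub>"
      unfolding out_map_one
      by (simp_all add: mult) (rule out_map_cong; auto simp: less_2_iff compute_words)+
    show "out_map transvect \<otimes>\<^bsub>Out F2\<^esub> (out_map invert_gen \<otimes>\<^bsub>Out F2\<^esub> (out_map transvect \<otimes>\<^bsub>Out F2\<^esub> out_map invert_gen))
        = \<one>\<^bsub>Out F2\<^esub>"
      unfolding out_map_one
      by (simp add: mult, rule out_map_eqI[of "[(1, False)]", OF _ id_auto])
        (auto simp: less_2_iff compute_words fg_eq_iff)
    show "out_map invert_gen \<otimes>\<^bsub>Out F2\<^esub> (out_map swap_gens \<otimes>\<^bsub>Out F2\<^esub> (out_map invert_gen \<otimes>\<^bsub>Out F2\<^esub>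
       (out_map swap_gens \<otimes>\<^bsub>Out F2\<^esub> (out_map invert_gen \<otimes>\<^bsub>Out F2\<^esub> (out_map swap_gens \<otimes>\<^bsub>Out F2\<^esub>
       (out_map invert_gen \<otimes>\<^bsub>Out F2\<^esub> out_map swap_gens)))))) = \<one>\<^bsub>Out F2\<^esub>"
      unfolding out_map_one
      by (simp add: mult, rule out_map_cong) (auto simp: less_2_iff compute_words)
    let ?i = "out_map invert_gen \<otimes>\<^bsub>Out F2\<^esub> (out_map swap_gens \<otimes>\<^bsub>Out F2\<^esub> (out_map invert_gen \<otimes>\<^bsub>Out F2\<^esub> out_map swap_gens))"
    show "?i \<otimes>\<^bsub>Out F2\<^esub> out_map transvect = out_map transvect \<otimes>\<^bsub>Out F2\<^esub> ?i"
      by (simp add: mult, rule out_map_eqI[of "[(1, True)]"], simp, simp add: mult, simp add: mult)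
        (auto simp: less_2_iff compute_words fg_eq_iff)
    show "out_map swap_gens \<otimes>\<^bsub>Out F2\<^esub> (out_map transvect \<otimes>\<^bsub>Out F2\<^esub> out_map swap_gens)
        = out_map transvect \<otimes>\<^bsub>Out F2\<^esub> (out_map swap_gens \<otimes>\<^bsub>Out F2\<^esub> (out_map invert_gen \<otimes>\<^bsub>Out F2\<^esub> out_map transvect))"
      by (simp add: mult, rule out_map_eqI[of "[(1, True)]"], simp, simp add: mult, simp add: mult)
        (auto simp: less_2_iff compute_words fg_eq_iff)
  qed
qed


text \<open>Renaming the generators by a signed permutation.\<close>

lemma signed_permutation:
  assumes lm: "fst l < 2" "fst m < 2" "fst l \<noteq> fst m"
  shows "word_map 2 (on_gens [l] [m]) \<in> auto F2" (is ?auto)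
    and "\<exists>j k i. out_map (on_gens [l] [m]) = R.tailpart j k i" (is ?tail)
proof -
  interpret group F2 by (rule group_free_group)
  note mult = out_map_mult F2_autos F2_gens_words path_image_words[where N = 2 and M = 2]
  let ?s = "out_map swap_gens" and ?d = "out_map invert_gen"
  have tails: "\<exists>j k i. \<one>\<^bsub>Out F2\<^esub> = R.tailpart j k i" "\<exists>j k i. ?s = R.tailpart j k i" "\<exists>j k i. ?d = R.tailpart j k i"
    by (rule exI[of _ False], rule exI[of _ False], rule exI[of _ False], simp add: R.tailpart_def)
      (rule exI[of _ True], rule exI[of _ False], rule exI[of _ False], simp add: R.tailpart_def,
       rule exI[of _ False], rule exI[of _ True], rule exI[of _ False], simp add: R.tailpart_def)
  have T: "\<exists>j k i. x \<otimes>\<^bsub>Out F2\<^esub> y = R.tailpart j k i"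
    if "\<exists>j k i. x = R.tailpart j k i" "\<exists>j k i. y = R.tailpart j k i" for x y
    using that by (elim exE) (auto simp: R.tailpart_mult)
  \<comment> \<open>the four signed permutations that keep the order of the generators, then the other four\<close>
  have keep: "word_map 2 (on_gens [(0, bl)] [(1, bm)]) \<in> auto F2 \<and>
      (\<exists>j k i. out_map (on_gens [(0, bl)] [(1, bm)]) = R.tailpart j k i)" for bl bm
  proof -
    have 1: "word_map 2 (on_gens [(0, True)] [(1, True)]) = word_map 2 (\<lambda>i. [(i, True)])"
      by (rule word_map_eqI) (auto simp: less_2_iff compute_words)
    have 2: "on_gens [(0, False)] [(1, True)] = invert_gen"
      by (simp add: invert_gen_def)
    have 3: "word_map 2 (on_gens [(0, True)] [(1, False)])
        = word_map 2 (\<lambda>i. path_image swap_gens (path_image invert_gen (swap_gens i)))"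
      by (rule word_map_eqI) (auto simp: less_2_iff compute_words)
    have 4: "word_map 2 (on_gens [(0, False)] [(1, False)])
        = word_map 2 (\<lambda>i. path_image invert_gen (path_image swap_gens (path_image invert_gen (swap_gens i))))"
      by (rule word_map_eqI) (auto simp: less_2_iff compute_words)
    have 5: "out_map (\<lambda>i. path_image swap_gens (path_image invert_gen (swap_gens i)))
        = ?s \<otimes>\<^bsub>Out F2\<^esub> (?d \<otimes>\<^bsub>Out F2\<^esub> ?s)"
      and 6: "out_map (\<lambda>i. path_image invert_gen (path_image swap_gens (path_image invert_gen (swap_gens i))))
        = ?d \<otimes>\<^bsub>Out F2\<^esub> (?s \<otimes>\<^bsub>Out F2\<^esub> (?d \<otimes>\<^bsub>Out F2\<^esub> ?s))"
      by (simp_all add: mult)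
    let ?P = "\<lambda>f. word_map 2 f \<in> auto F2 \<and> (\<exists>j k i. out_map f = R.tailpart j k i)"
    have "?P (on_gens [(0, True)] [(1, True)])"
      unfolding 1 using id_auto tails(1) by (simp only: out_map_one)
    moreover have "?P (on_gens [(0, False)] [(1, True)])"
      unfolding 2 using F2_autos(2) tails(3) by (rule conjI)
    moreover have "?P (on_gens [(0, True)] [(1, False)])"
      unfolding 3 5 by (rule conjI, simp add: mult, intro T tails)
    moreover have "?P (on_gens [(0, False)] [(1, False)])"
      unfolding 4 6 by (rule conjI, simp add: mult, intro T tails)
    ultimately show ?thesis
      by (cases bl; cases bm) simp_all
  qed
  have swap: "word_map 2 (on_gens [(1, bl)] [(0, bm)]) = word_map 2 (\<lambda>i. path_image (on_gens [(0, bm)] [(1, bl)]) (swap_gens i))" for bl bm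
    by (rule word_map_eqI) (auto simp: less_2_iff compute_words)
  have swapped: "word_map 2 (on_gens [(1, bl)] [(0, bm)]) \<in> auto F2 \<and>
      (\<exists>j k i. out_map (on_gens [(1, bl)] [(0, bm)]) = R.tailpart j k i)" for bl bm
  proof -
    have "out_map (on_gens [(0, bm)] [(1, bl)]) \<otimes>\<^bsub>Out F2\<^esub> ?s = out_map (on_gens [(1, bl)] [(0, bm)])"
      unfolding swap using keep[of bm bl] by (intro out_map_mult(1) F2_autos F2_gens_words) auto
    moreover have "\<exists>j k i. out_map (on_gens [(0, bm)] [(1, bl)]) \<otimes>\<^bsub>Out F2\<^esub> ?s = R.tailpart j k i"
      using keep[of bm bl] by (intro T tails) blast
    moreover have "word_map 2 (on_gens [(1, bl)] [(0, bm)]) \<in> auto F2"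
      unfolding swap using keep[of bm bl] by (intro out_map_mult(2) F2_autos F2_gens_words) auto
    ultimately show ?thesis by simp
  qed
  have "fst l = 0 \<and> fst m = 1 \<or> fst l = 1 \<and> fst m = 0"
    using lm by auto
  then show ?auto ?tail
    using keep[of "snd l" "snd m"] swapped[of "snd l" "snd m"] by (metis prod.collapse)+
qed


lemma spanned_tailpart_iff:
  assumes "x \<in> carrier (Out F2)"
  shows "x \<otimes>\<^bsub>Out F2\<^esub> R.tailpart j k i \<in> R.spanned \<longleftrightarrow> x \<in> R.spanned"
proof
  assume "x \<otimes>\<^bsub>Out F2\<^esub> R.tailpart j k i \<in> R.spanned"
  then have "x \<otimes>\<^bsub>Out F2\<^esub> R.tailpart j k i \<otimes>\<^bsub>Out F2\<^esub> R.tailpart j k (i \<noteq> (k \<and> j)) \<in> R.spanned"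
    by (rule R.spanned_mult_tailpart)
  then have "x \<otimes>\<^bsub>Out F2\<^esub> R.tailpart False False False \<in> R.spanned"
    using assms by (cases i; cases j; cases k) (simp_all add: R.m_assoc R.tailpart_mult)
  then show "x \<in> R.spanned"
    using assms by (simp add: R.tailpart_def)
qed (rule R.spanned_mult_tailpart)

text \<open>
  Nielsen's argument.  Among the automorphisms whose class is not spanned, take one for which the
  images of the generators are shortest.  Multiplying one of these images by the other does not
  shorten it, so at most half of each factor cancels in a product of two of them; and if a factor
  were used up by its two neighbours, a conjugation followed by such a multiplication would shorten
  the images.  Hence no reduced word gets shorter, and the inverse automorphism sends letters to
  letters: it is a signed permutation.
\<close>

lemma all_spanned:
  assumes "\<alpha>0 \<in> auto F2"
  shows "outer F2 \<alpha>0 \<in> R.spanned"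
proof (rule ccontr)
  interpret group F2 by (rule group_free_group)
  define \<mu> where "\<mu> \<alpha> = length (\<alpha> [(0, True)]) + length (\<alpha> [(1, True)])" for \<alpha> :: "letter list \<Rightarrow> letter list"
  define bad where "bad \<alpha> \<longleftrightarrow> \<alpha> \<in> auto F2 \<and> outer F2 \<alpha> \<notin> R.spanned" for \<alpha>
  define minimal where "minimal \<alpha> \<longleftrightarrow> bad \<alpha> \<and> (\<forall>\<beta>. bad \<beta> \<longrightarrow> \<mu> \<alpha> \<le> \<mu> \<beta>)" for \<alpha>
  assume "outer F2 \<alpha>0 \<notin> R.spanned"
  then have "bad \<alpha>0"
    using assms by (simp add: bad_def)
  then obtain \<alpha> where min\<alpha>: "minimal \<alpha>"
    unfolding minimal_def using ex_has_least_nat[of bad \<alpha>0 \<mu>] by blast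
  have letter_carrier: "[l] \<in> carrier F2" if "fst l < 2" for l
    using that by simp
  have outC: "outer F2 \<beta> \<in> carrier (Out F2)" if "\<beta> \<in> auto F2" for \<beta>
    using that by (simp add: carrier_Out)
  have inv_img: "\<beta> [inv_letter l] = inv_word (\<beta> [l])" if "\<beta> \<in> auto F2" "fst l < 2" for \<beta> l
  proof -
    interpret \<beta>: group_hom F2 F2 \<beta>
      using auto_hom[OF that(1)] by (simp add: group_hom_def group_hom_axioms_def group_free_group)
    have "\<beta> (inv\<^bsub>F2\<^esub> [l]) = inv\<^bsub>F2\<^esub> (\<beta> [l])"
      using letter_carrier[OF that(2)] by (rule \<beta>.hom_inv)
    then show ?thesis
      using auto_closed[OF that(1) letter_carrier[OF that(2)]] that(2) by (simp add: inv_free_group)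
  qed
  have len_letter: "length (\<beta> [inv_letter l]) = length (\<beta> [l])" if "\<beta> \<in> auto F2" "fst l < 2" for \<beta> l
    using inv_img[OF that] by simp
  \<comment> \<open>renaming the generators reduces statements about two letters to the two generators\<close>
  have rename: "minimal (compose (carrier F2) \<beta> (word_map 2 (on_gens [l] [m]))) \<and>
      compose (carrier F2) \<beta> (word_map 2 (on_gens [l] [m])) [(0, True)] = \<beta> [l] \<and>
      compose (carrier F2) \<beta> (word_map 2 (on_gens [l] [m])) [(1, True)] = \<beta> [m]"
    if \<beta>: "minimal \<beta>" and lm: "fst l < 2" "fst m < 2" "fst l \<noteq> fst m" for \<beta> l m
  proof -
    let ?\<sigma> = "word_map 2 (on_gens [l] [m])"
    let ?\<gamma> = "compose (carrier F2) \<beta> ?\<sigma>"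
    have \<beta>a: "\<beta> \<in> auto F2" and \<beta>s: "outer F2 \<beta> \<notin> R.spanned"
      using \<beta> by (auto simp: minimal_def bad_def)
    have vals: "?\<gamma> [(0, True)] = \<beta> [l]" "?\<gamma> [(1, True)] = \<beta> [m]"
      using lm by (simp_all add: compose_def word_map_apply path_image_single on_gens_def)
    have lens: "length (\<beta> [x]) = length (\<beta> [(fst x, True)])" if "fst x < 2" for x
    proof (cases "snd x")
      case False
      then have "x = inv_letter (fst x, True)"
        by (simp add: prod_eq_iff)
      then show ?thesis
        using len_letter[OF \<beta>a, of "(fst x, True)"] that by simp
    qed (metis prod.collapse)
    have "fst l = 0 \<and> fst m = 1 \<or> fst l = 1 \<and> fst m = 0"
      using lm by auto
    then have "\<mu> ?\<gamma> = \<mu> \<beta>"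
      unfolding \<mu>_def vals lens[OF lm(1)] lens[OF lm(2)] by (elim disjE conjE) (simp_all only: add.commute)
    moreover have "bad ?\<gamma>"
    proof -
      obtain j k i where t: "out_map (on_gens [l] [m]) = R.tailpart j k i"
        using signed_permutation(2)[OF lm] by blast
      have "outer F2 ?\<gamma> = outer F2 \<beta> \<otimes>\<^bsub>Out F2\<^esub> R.tailpart j k i"
        using outer_mult[OF \<beta>a signed_permutation(1)[OF lm]] by (simp add: t)
      then show ?thesis
        using auto_compose[OF \<beta>a signed_permutation(1)[OF lm]] spanned_tailpart_iff[OF outC[OF \<beta>a]] \<beta>s
        by (simp add: bad_def)
    qed
    ultimately show ?thesis
      using \<beta> vals by (simp add: minimal_def)
  qed
  \<comment> \<open>first move: replace the first image by its product with the second\<close>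
  have move1: "length (\<beta> [(0, True)]) \<le> length (reduce_word (\<beta> [(0, True)] @ \<beta> [(1, True)]))" if \<beta>: "minimal \<beta>" for \<beta>
  proof -
    have \<beta>a: "\<beta> \<in> auto F2" and \<beta>s: "outer F2 \<beta> \<notin> R.spanned"
      using \<beta> by (auto simp: minimal_def bad_def)
    let ?\<gamma> = "compose (carrier F2) \<beta> (word_map 2 transvect)"
    have "outer F2 ?\<gamma> = outer F2 \<beta> \<otimes>\<^bsub>Out F2\<^esub> out_map transvect"
      using outer_mult[OF \<beta>a F2_autos(3)] by simp
    then have "bad ?\<gamma>"
      using R.spanned_cancel(3)[OF outC[OF \<beta>a]] \<beta>s auto_compose[OF \<beta>a F2_autos(3)] by (auto simp: bad_def)
    then have "\<mu> \<beta> \<le> \<mu> ?\<gamma>"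
      using \<beta> by (simp add: minimal_def)
    moreover have "?\<gamma> [(0, True)] = \<beta> ([(0, True)] \<otimes>\<^bsub>F2\<^esub> [(1, True)])" "?\<gamma> [(1, True)] = \<beta> [(1, True)]"
      by (simp_all add: compose_def word_map_apply path_image_single compute_words)
    moreover have "\<beta> ([(0, True)] \<otimes>\<^bsub>F2\<^esub> [(1, True)]) = reduce_word (\<beta> [(0, True)] @ \<beta> [(1, True)])"
      using hom_mult[OF auto_hom[OF \<beta>a], of "[(0, True)]" "[(1, True)]"] by simp
    ultimately show ?thesis
      by (simp add: \<mu>_def)
  qed
  have \<alpha>a: "\<alpha> \<in> auto F2" and \<alpha>s: "outer F2 \<alpha> \<notin> R.spanned"
    using min\<alpha> by (auto simp: minimal_def bad_def)
  have inj: "x = y" if "\<alpha> x = \<alpha> y" "x \<in> carrier F2" "y \<in> carrier F2" for x y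
    using inj_onD[OF bij_betw_imp_inj_on[OF auto_bij[OF \<alpha>a]]] that by blast
  have img: "\<alpha> [l] \<noteq> []" "reduced_word (\<alpha> [l])" "\<alpha> [l] \<in> words 2" if "fst l < 2" for l
  proof -
    show "reduced_word (\<alpha> [l])" "\<alpha> [l] \<in> words 2"
      using auto_closed[OF \<alpha>a letter_carrier[OF that]] by auto
    have "\<alpha> [] = []"
      using group_hom.hom_one[of F2 F2 \<alpha>] auto_hom[OF \<alpha>a] group_free_group
      by (simp add: group_hom_def group_hom_axioms_def)
    then show "\<alpha> [l] \<noteq> []"
      using inj[of "[l]" "[]"] that by auto
  qed
  have half: "2 * length p \<le> length (\<alpha> [l])" "2 * length p \<le> length (\<alpha> [m])"
    if lm: "fst l < 2" "fst m < 2" "fst l \<noteq> fst m" and p: "cancels (\<alpha> [l]) (\<alpha> [m]) p" for l m p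
  proof -
    have "length (\<alpha> [l]) \<le> length (reduce_word (\<alpha> [l] @ \<alpha> [m]))"
      using rename[OF min\<alpha> lm] move1 by metis
    then show "2 * length p \<le> length (\<alpha> [m])"
      using cancels_length[OF p] by linarith
    have "length (\<alpha> [inv_letter m]) \<le> length (reduce_word (\<alpha> [inv_letter m] @ \<alpha> [inv_letter l]))"
      using rename[OF min\<alpha>, of "inv_letter m" "inv_letter l"] lm move1 by (metis fst_inv_letter)
    also have "\<alpha> [inv_letter m] @ \<alpha> [inv_letter l] = inv_word (\<alpha> [l] @ \<alpha> [m])"
      using inv_img[OF \<alpha>a] lm by simp
    finally have "length (\<alpha> [m]) \<le> length (reduce_word (\<alpha> [l] @ \<alpha> [m]))"
      using len_letter[OF \<alpha>a lm(2)] by (simp add: reduce_word_inv_word del: inv_word_simps(3))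
    then show "2 * length p \<le> length (\<alpha> [l])"
      using cancels_length[OF p] by linarith
  qed
  have weak: "2 * length p \<le> length (\<alpha> [l]) \<and> 2 * length p \<le> length (\<alpha> [m]) \<and>
      (l = m \<longrightarrow> 2 * length p < length (\<alpha> [l]))"
    if lm: "fst l < 2" "fst m < 2" "m \<noteq> inv_letter l" and p: "cancels (\<alpha> [l]) (\<alpha> [m]) p" for l m p
  proof (cases "fst l = fst m")
    case True
    then have "l = m"
      using lm(3) by (auto simp: prod_eq_iff inv_letter_def)
    then show ?thesis
      using cancels_self[OF img(2,1)[OF lm(1)]] p by fastforce
  next
    case False
    then show ?thesis
      using half[OF lm(1,2) False p] by auto
  qed
  \<comment> \<open>second move: no factor is used up by its two neighbours\<close>
  have triple: "length p + length q < length (\<alpha> [m])"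
    if l: "fst l < 2" and m: "fst m < 2" and n: "fst n < 2" and lm: "m \<noteq> inv_letter l" and mn: "n \<noteq> inv_letter m"
      and p: "cancels (\<alpha> [l]) (\<alpha> [m]) p" and q: "cancels (\<alpha> [m]) (\<alpha> [n]) q" for l m n p q
  proof (rule ccontr)
    assume "\<not> ?thesis"
    then have len: "2 * length p = length (\<alpha> [m])" "2 * length q = length (\<alpha> [m])" "l \<noteq> m" "m \<noteq> n"
      using weak[OF l m lm p] weak[OF m n mn q] by auto
    have fl: "fst l \<noteq> fst m" "fst n \<noteq> fst m"
      using lm mn len by (auto simp: prod_eq_iff inv_letter_def)
    define x y where "x = \<alpha> [l]" and "y = \<alpha> [m]"
    obtain x' y' where 1: "x = x' @ p" "y = inv_word p @ y'"
      using p unfolding cancels_def x_def y_def by blast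
    obtain y'' z' where 2: "y = y'' @ q" "\<alpha> [n] = inv_word q @ z'"
      using q unfolding cancels_def y_def by blast
    have lenpq: "length p = length q" "length y' = length q" "length y'' = length p"
      using len 1 2 by (auto simp: y_def[symmetric])
    have y: "y = inv_word p @ q"
      using 1(2) 2(1) lenpq by (metis append_eq_append_conv)
    have pne: "p \<noteq> []"
      using len(1) img(1)[OF m] by auto
    have "fst n = fst l"
      using fl l m n by (auto simp: less_2_iff)
    then consider "n = inv_letter l" | "n = l"
      by (auto simp: prod_eq_iff inv_letter_def)
    then show False
    proof cases
      case 1
      then have "inv_word p @ inv_word x' = inv_word q @ z'"
        using inv_img[OF \<alpha>a l] 2(2) \<open>x = x' @ p\<close> by (simp add: x_def)
      then have "inv_word p = inv_word q"
        using lenpq(1) by (metis append_eq_append_conv inv_word_simps(5))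
      then have "p = q"
        by (metis inv_word_simps(4))
      then have "fg y = 0"
        by (simp add: y)
      then show False
        using img(1,2)[OF m] by (metis y_def fg_Nil reduced_eqI reduced_word_Nil)
    next
      case 2
      have "x = inv_word q @ z'"
        using \<open>\<alpha> [n] = inv_word q @ z'\<close> 2 by (simp add: x_def)
      have "length (inv_word q) \<le> length x'"
        using half(1)[OF l m fl(1) p] \<open>x = x' @ p\<close> lenpq(1) by (simp add: x_def)
      then obtain m' where "x' = inv_word q @ m'"
        using \<open>x = inv_word q @ z'\<close> \<open>x = x' @ p\<close>
        by (metis append_eq_append_conv_if append_take_drop_id)
      then have x: "x = inv_word q @ m' @ p"
        using \<open>x = x' @ p\<close> by simp
      obtain \<beta> where \<beta>: "minimal \<beta>" "\<beta> [(0, True)] = x" "\<beta> [(1, True)] = y"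
        using rename[OF min\<alpha> l m fl(1)] by (auto simp: x_def y_def)
      have \<beta>a: "\<beta> \<in> auto F2" and \<beta>s: "outer F2 \<beta> \<notin> R.spanned"
        using \<beta>(1) by (auto simp: minimal_def bad_def)
      define T where "T = on_gens [(1, True), (0, True)] [(1, True)]"
      have Teq: "out_map T = out_map transvect"
        by (rule out_map_eqI[of "[(1, True)]"], simp, rule F2_autos, erule F2_gens_words)
          (auto simp: T_def less_2_iff compute_words fg_eq_iff)
      have Ta: "word_map 2 T \<in> auto F2"
        unfolding T_def
        by (rule word_map_auto[of 2 _ "on_gens [(1, False), (0, True)] [(1, True)]"])
          (auto simp: less_2_iff compute_words fg_eq_iff)
      have px: "p \<in> words 2"
        using img(3)[OF l] 1(1) by (simp add: x_def[symmetric])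
      define h where "h = reduce_word p"
      have h: "h \<in> carrier F2"
        using px by (simp add: h_def words_reduce)
      let ?\<delta> = "compose (carrier F2) \<beta> (word_map 2 T)"
      let ?\<gamma> = "compose (carrier F2) (inner_aut F2 h) ?\<delta>"
      have \<delta>a: "?\<delta> \<in> auto F2"
        by (rule auto_compose[OF \<beta>a Ta])
      have "?\<gamma> \<in> outer F2 ?\<delta>"
        unfolding outer_def2[OF \<delta>a] using h by blast
      then have "?\<gamma> \<in> auto F2" "outer F2 ?\<gamma> = outer F2 ?\<delta>"
        using outer_memD[OF \<delta>a] outer_eqI[OF \<delta>a] by auto
      moreover have "outer F2 ?\<delta> = outer F2 \<beta> \<otimes>\<^bsub>Out F2\<^esub> out_map transvect"
        using outer_mult[OF \<beta>a Ta] Teq by simp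
      ultimately have "bad ?\<gamma>"
        using R.spanned_cancel(3)[OF outC[OF \<beta>a]] \<beta>s by (auto simp: bad_def)
      then have "\<mu> \<beta> \<le> \<mu> ?\<gamma>"
        using \<beta>(1) by (simp add: minimal_def)
      have \<delta>0: "?\<delta> [(0, True)] = reduce_word (y @ x)"
        using hom_mult[OF auto_hom[OF \<beta>a], of "[(1, True)]" "[(0, True)]"] \<beta>
        by (simp add: compose_def word_map_apply path_image_single T_def on_gens_def reduced_word_Cons inv_letter_def reduce_word_Cons cancel_Cons_def)
      have \<delta>1: "?\<delta> [(1, True)] = y"
        using \<beta> by (simp add: compose_def word_map_apply path_image_single T_def on_gens_def)
      have inner: "?\<gamma> w = reduce_word (h @ ?\<delta> w @ inv_word h)" if "w \<in> carrier F2" for w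
      proof -
        have "?\<gamma> w = inner_aut F2 h (?\<delta> w)"
          by (rule compose_eq[OF that])
        also have "\<dots> = reduce_word (h @ ?\<delta> w @ inv_word h)"
          using auto_closed[OF \<delta>a that] h by (simp add: inner_aut_def inv_free_group)
        finally show ?thesis .
      qed
      have c01: "[(0, True)] \<in> carrier F2" "[(1, True)] \<in> carrier F2"
        by simp_all
      have "?\<gamma> [(0, True)] = reduce_word m'"
        unfolding inner[OF c01(1)] \<delta>0
        by (rule reduce_word_eqI) (simp add: h_def x y fg_arith del: add_uminus_conv_diff)
      moreover have "?\<gamma> [(1, True)] = reduce_word (q @ inv_word p)"
        unfolding inner[OF c01(2)] \<delta>1
        by (rule reduce_word_eqI) (simp add: h_def y fg_arith del: add_uminus_conv_diff)
      ultimately have "\<mu> ?\<gamma> \<le> length m' + (length q + length p)"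
        using length_reduce_word[of m'] length_reduce_word[of "q @ inv_word p"] by (simp add: \<mu>_def)
      moreover have "\<mu> \<beta> = length q + length m' + length p + (length p + length q)"
        unfolding \<mu>_def \<beta>(2,3) unfolding x y by simp
      moreover have "length p > 0"
        using pne by simp
      ultimately show False
        using \<open>\<mu> \<beta> \<le> \<mu> ?\<gamma>\<close> by linarith
    qed
  qed
  define X where "X = {\<alpha> [l] | l. fst l < 2}"
  define Rel where "Rel x y \<longleftrightarrow> (\<exists>l m. fst l < 2 \<and> fst m < 2 \<and> m \<noteq> inv_letter l \<and> x = \<alpha> [l] \<and> y = \<alpha> [m])" for x y
  have growth: "length z \<le> length (\<alpha> z)" if z: "z \<in> carrier F2" for z
  proof -
    have \<alpha>z: "\<alpha> z = reduce_word (concat (map (\<lambda>l. \<alpha> [l]) z))"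
    proof -
      have "path_image (\<lambda>i. \<alpha> [(i, True)]) w = concat (map (\<lambda>l. \<alpha> [l]) w)" if "w \<in> words 2" for w
        using that
      proof (induction w)
        case (Cons l w)
        have "(if snd l then \<alpha> [(fst l, True)] else inv_word (\<alpha> [(fst l, True)])) = \<alpha> [l]"
        proof (cases "snd l")
          case False
          then have "l = inv_letter (fst l, True)"
            by (simp add: prod_eq_iff)
          then show ?thesis
            using inv_img[OF \<alpha>a, of "(fst l, True)"] Cons.prems False by simp
        qed (metis prod.collapse)
        then show ?case
          using Cons by (simp add: path_image_Cons)
      qed simp
      moreover have "\<alpha> z = reduce_word (path_image (\<lambda>i. \<alpha> [(i, True)]) z)"
        using hom_free_group_path_image[of \<alpha> 2 "words 2" z] auto_hom[OF \<alpha>a] z by (simp add: free_group_eq)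
      ultimately show ?thesis
        using z by simp
    qed
    have "length (map (\<lambda>l. \<alpha> [l]) z) \<le> length (reduce_word (concat (map (\<lambda>l. \<alpha> [l]) z)))"
    proof (rule length_product_ge[where X = X and R = Rel])
      show "x \<noteq> [] \<and> reduced_word x" if "x \<in> X" for x
        using that img by (auto simp: X_def)
      show "length p < length x \<and> length p < length y" if "Rel x y" "cancels x y p" for x y p
      proof -
        obtain l m where lm: "fst l < 2" "fst m < 2" "m \<noteq> inv_letter l" "x = \<alpha> [l]" "y = \<alpha> [m]"
          using \<open>Rel x y\<close> by (auto simp: Rel_def)
        have "length x > 0" "length y > 0"
          using img(1) lm by auto
        moreover have "2 * length p \<le> length x" "2 * length p \<le> length y"
          using weak[OF lm(1-3), of p] that(2) unfolding lm(4,5) by blast+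
        ultimately show ?thesis
          by linarith
      qed
      show "length p + length q < length y"
        if "Rel x y" "Rel y z" "cancels x y p" "cancels y z q" for x y z p q
      proof -
        obtain l m where lm: "fst l < 2" "fst m < 2" "m \<noteq> inv_letter l" "x = \<alpha> [l]" "y = \<alpha> [m]"
          using \<open>Rel x y\<close> by (auto simp: Rel_def)
        obtain m' n where mn: "fst m' < 2" "fst n < 2" "n \<noteq> inv_letter m'" "y = \<alpha> [m']" "z = \<alpha> [n]"
          using \<open>Rel y z\<close> by (auto simp: Rel_def)
        have "[m] = [m']"
          using inj[of "[m]" "[m']"] lm mn by simp
        then show ?thesis
          using triple[OF lm(1,2) mn(2) lm(3)] lm mn that(3,4) by simp
      qed
      show "set (map (\<lambda>l. \<alpha> [l]) z) \<subseteq> X"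
        using z by (fastforce simp: X_def words_def image_subset_iff)
      have "successively (\<lambda>l m. fst l < 2 \<and> fst m < 2 \<and> m \<noteq> inv_letter l) z"
        using z by (auto simp: reduced_word_def words_def successively_conv_nth image_subset_iff)
      then show "successively Rel (map (\<lambda>l. \<alpha> [l]) z)"
        unfolding successively_map by (rule successively_mono) (unfold Rel_def, blast)
    qed
    then show ?thesis
      by (simp add: \<alpha>z)
  qed
  have surj: "\<exists>l. fst l < 2 \<and> \<alpha> [l] = [(i, True)]" if i: "i < 2" for i
  proof -
    define m where "m = (i, True)"
    have m: "fst m < 2"
      using i by (simp add: m_def)
    have "[m] \<in> \<alpha> ` carrier F2"
      using auto_bij[OF \<alpha>a] letter_carrier[OF m] unfolding bij_betw_def by blast
    then obtain z where z: "z \<in> carrier F2" "\<alpha> z = [m]"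
      by (metis imageE)
    then have "length z \<le> 1"
      using growth[OF z(1)] by simp
    moreover have "z \<noteq> []"
    proof
      assume "z = []"
      then show False
        using z(2) group_hom.hom_one[of F2 F2 \<alpha>] auto_hom[OF \<alpha>a] group_free_group
        by (simp add: group_hom_def group_hom_axioms_def)
    qed
    ultimately obtain l where "z = [l]"
      by (cases z) auto
    then show ?thesis
      using z by (intro exI[of _ l]) (simp add: m_def)
  qed
  obtain l where l: "fst l < 2" "\<alpha> [l] = [(0, True)]"
    using surj[OF pos2] by blast
  have one_2: "1 < (2::nat)"
    by simp
  obtain m where m: "fst m < 2" "\<alpha> [m] = [(1, True)]"
    using surj[OF one_2] by blast
  have "fst l \<noteq> fst m"
  proof
    assume "fst l = fst m"
    then have "m = l \<or> m = inv_letter l"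
      by (auto simp: prod_eq_iff inv_letter_def)
    then show False
      using l m inv_img[OF \<alpha>a l(1)] by (auto simp: inv_letter_def)
  qed
  note ren = rename[OF min\<alpha> l(1) m(1) this]
  let ?\<gamma> = "compose (carrier F2) \<alpha> (word_map 2 (on_gens [l] [m]))"
  have \<gamma>a: "?\<gamma> \<in> auto F2"
    using ren by (simp add: minimal_def bad_def)
  have "?\<gamma> = word_map 2 (\<lambda>i. ?\<gamma> [(i, True)])"
    by (rule hom_eq_word_map[OF auto_hom[OF \<gamma>a] auto_ext[OF \<gamma>a]])
  also have "\<dots> = word_map 2 (\<lambda>i. [(i, True)])"
    by (rule word_map_eqI) (use ren l m in \<open>auto simp: less_2_iff\<close>)
  finally have "outer F2 ?\<gamma> = \<one>\<^bsub>Out F2\<^esub>"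
    by (simp only: out_map_one)
  then show False
    using ren R.spanned_one by (simp add: minimal_def bad_def)
qed


section \<open>Reducible outer automorphisms\<close>

context group
begin

lemma auto_inverse:
  assumes \<chi>: "\<chi> \<in> auto G"
  obtains \<tau> where "\<tau> \<in> auto G" "\<And>x. x \<in> carrier G \<Longrightarrow> \<tau> (\<chi> x) = x" "\<And>x. x \<in> carrier G \<Longrightarrow> \<chi> (\<tau> x) = x"
proof -
  interpret A: group "AutoGroup G" by (rule AutoGroup)
  have c: "\<chi> \<in> carrier (AutoGroup G)"
    using \<chi> by (simp add: AutoGroup_sel)
  define \<tau> where "\<tau> = inv\<^bsub>AutoGroup G\<^esub> \<chi>"
  have \<tau>: "\<tau> \<in> auto G"
    using A.inv_closed[OF c] by (simp add: \<tau>_def AutoGroup_sel)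
  have "compose (carrier G) \<tau> \<chi> = (\<lambda>x\<in>carrier G. x)" "compose (carrier G) \<chi> \<tau> = (\<lambda>x\<in>carrier G. x)"
    using A.l_inv[OF c] A.r_inv[OF c] \<chi> \<tau> by (simp_all add: \<tau>_def[symmetric] AutoGroup_sel)
  then have "compose (carrier G) \<tau> \<chi> x = (\<lambda>x\<in>carrier G. x) x" "compose (carrier G) \<chi> \<tau> x = (\<lambda>x\<in>carrier G. x) x" for x
    by simp_all
  then show ?thesis
    by (intro that[of \<tau>] \<tau>) (metis compose_eq restrict_apply')+
qed

lemma internal_free_product_image:
  assumes \<chi>: "\<chi> \<in> auto G" and ifp: "internal_free_product G I H"
  shows "internal_free_product G I (\<lambda>i. \<chi> ` H i)"
proof -
  interpret \<chi>: group_hom G G \<chi>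
    using auto_hom[OF \<chi>] by (simp add: group_hom_def group_hom_axioms_def is_group)
  obtain \<tau> where \<tau>: "\<tau> \<in> auto G" "\<And>x. x \<in> carrier G \<Longrightarrow> \<tau> (\<chi> x) = x" "\<And>x. x \<in> carrier G \<Longrightarrow> \<chi> (\<tau> x) = x"
    by (rule auto_inverse[OF \<chi>], rule that)
  have sub: "subgroup (H i) G" if "i \<in> I" for i
    using ifp that by (simp add: internal_free_product_def)
  have carr: "h \<in> carrier G" if "i \<in> I" "h \<in> H i" for i h
    using subgroup.mem_carrier[OF sub] that by blast
  let ?NF = "normal_forms G I H" and ?NF' = "normal_forms G I (\<lambda>i. \<chi> ` H i)"
  let ?m = "map (apsnd \<chi>)" and ?m' = "map (apsnd \<tau>)"
  have nontrivial: "\<chi> h \<noteq> \<one>" if "i \<in> I" "h \<in> H i" "h \<noteq> \<one>" for i h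
  proof
    assume "\<chi> h = \<one>"
    then have "\<tau> (\<chi> h) = \<tau> (\<chi> \<one>)"
      by simp
    then show False
      using \<tau>(2)[OF carr[OF that(1,2)]] \<tau>(2)[OF one_closed] that(3) by simp
  qed
  have bij_m: "bij_betw ?m ?NF ?NF'"
  proof (rule bij_betw_byWitness[where f' = ?m'])
    show "\<forall>w\<in>?NF. ?m' (?m w) = w"
      by (auto simp: normal_forms_def intro!: map_idI \<tau>(2) carr)
    show "\<forall>w\<in>?NF'. ?m (?m' w) = w"
      by (auto simp: normal_forms_def intro!: map_idI) (fastforce simp: \<tau>(2) carr)
    show "?m ` ?NF \<subseteq> ?NF'"
      using nontrivial by (fastforce simp: normal_forms_def successively_map)
    show "?m' ` ?NF' \<subseteq> ?NF"
    proof (rule image_subsetI)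
      fix w assume w: "w \<in> ?NF'"
      have "i \<in> I \<and> \<tau> h \<in> H i \<and> \<tau> h \<noteq> \<one>" if "(i, h) \<in> set w" for i h
      proof -
        have ih: "i \<in> I" "h \<in> \<chi> ` H i" "h \<noteq> \<one>"
          using w that by (auto simp: normal_forms_def)
        then obtain g where g: "g \<in> H i" "h = \<chi> g"
          by blast
        then show ?thesis
          using ih \<tau>(2)[OF carr[OF ih(1) g(1)]] by auto
      qed
      then show "?m' w \<in> ?NF"
        using w by (auto simp: normal_forms_def successively_map)
    qed
  qed
  have bij: "bij_betw (nf_prod G) ?NF (carrier G)"
    using ifp by (simp add: internal_free_product_def nf_prod_def[abs_def])
  have img: "nf_prod G w \<in> carrier G \<and> nf_prod G (?m w) = \<chi> (nf_prod G w)"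
    if "\<forall>(i, h)\<in>set w. i \<in> I \<and> h \<in> H i" for w
    using that by (induction w) (auto simp: carr)
  have "bij_betw (\<chi> \<circ> nf_prod G) ?NF (carrier G)"
    by (rule bij_betw_trans[OF bij auto_bij[OF \<chi>]])
  moreover have "(nf_prod G \<circ> ?m) w = (\<chi> \<circ> nf_prod G) w" if "w \<in> ?NF" for w
    using that img[of w] by (auto simp: normal_forms_def)
  ultimately have "bij_betw (nf_prod G \<circ> ?m) ?NF (carrier G)"
    using bij_betw_cong[of ?NF "nf_prod G \<circ> ?m" "\<chi> \<circ> nf_prod G" "carrier G"] by blast
  then have "bij_betw (nf_prod G) ?NF' (carrier G)"
    using bij_betw_comp_iff[OF bij_m] by blast
  moreover have "subgroup (\<chi> ` H i) G" if "i \<in> I" for i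
    by (rule \<chi>.subgroup_img_is_subgroup[OF sub[OF that]])
  ultimately show ?thesis
    by (simp add: internal_free_product_def nf_prod_def[abs_def])
qed

lemma out_act_conj_class:
  assumes \<beta>: "\<beta> \<in> auto G" and A: "A \<subseteq> carrier G"
  shows "out_act (outer G \<beta>) (conj_class G A) = conj_class G (\<beta> ` A)"
proof -
  have move: "compose (carrier G) (inner_aut G g) \<beta> ` inner_aut G h ` A = inner_aut G (g \<otimes> \<beta> h) ` \<beta> ` A"
    if "g \<in> carrier G" "h \<in> carrier G" for g h
  proof -
    have "compose (carrier G) (inner_aut G g) \<beta> (inner_aut G h x) = inner_aut G (g \<otimes> \<beta> h) (\<beta> x)" if x: "x \<in> A" for x
    proof -
      have xc: "x \<in> carrier G"
        using x A by blast
      have 1: "\<beta> (inner_aut G h x) = inner_aut G (\<beta> h) (\<beta> x)"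
        using fun_cong[OF auto_inner_aut[OF \<beta> \<open>h \<in> carrier G\<close>], of x] xc by (simp add: compose_def)
      have "inner_aut G h x \<in> carrier G"
        using auto_closed[OF inner_aut_auto[OF \<open>h \<in> carrier G\<close>] xc] .
      then have "compose (carrier G) (inner_aut G g) \<beta> (inner_aut G h x) = inner_aut G g (inner_aut G (\<beta> h) (\<beta> x))"
        by (simp add: compose_def 1)
      also have "\<dots> = compose (carrier G) (inner_aut G g) (inner_aut G (\<beta> h)) (\<beta> x)"
        using auto_closed[OF \<beta> xc] by (simp add: compose_def)
      finally show ?thesis
        using inner_aut_mult[OF \<open>g \<in> carrier G\<close> auto_closed[OF \<beta> \<open>h \<in> carrier G\<close>]] by simp
    qed
    then show ?thesis
      by (auto simp: image_image intro!: image_cong)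
  qed
  have "out_act (outer G \<beta>) (conj_class G A)
      = (\<Union>g\<in>carrier G. \<Union>h\<in>carrier G. {compose (carrier G) (inner_aut G g) \<beta> ` inner_aut G h ` A})"
    by (auto simp: out_act_def conj_class_def outer_def2[OF \<beta>])
  also have "\<dots> = (\<Union>g\<in>carrier G. \<Union>h\<in>carrier G. {inner_aut G (g \<otimes> \<beta> h) ` \<beta> ` A})"
    by (intro SUP_cong refl) (simp only: move)
  also have "\<dots> = conj_class G (\<beta> ` A)"
  proof -
    have "\<exists>g'\<in>carrier G. \<exists>h\<in>carrier G. inner_aut G g ` \<beta> ` A = inner_aut G (g' \<otimes> \<beta> h) ` \<beta> ` A"
      if "g \<in> carrier G" for g
    proof -
      have "\<beta> \<one> = \<one>"
        using hom_one[OF auto_hom[OF \<beta>] is_group is_group] .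
      then show ?thesis
        using that by (intro bexI[of _ g] bexI[of _ \<one>]) simp_all
    qed
    then show ?thesis
      using auto_closed[OF \<beta>] by (auto simp: conj_class_def)
  qed
  finally show ?thesis .
qed

text \<open>An automorphism conjugate to one that preserves a proper free factor is reducible.\<close>

lemma not_out_irreducible_conjugate:
  assumes \<chi>: "\<chi> \<in> auto G" and \<beta>: "\<beta> \<in> auto G" and eq: "\<And>x. x \<in> carrier G \<Longrightarrow> \<chi> (m x) = \<beta> (\<chi> x)"
    and ifp: "internal_free_product G {0..1::nat} H" and H1: "H 1 \<noteq> {\<one>}" "H 1 \<noteq> carrier G"
    and m: "m ` H 1 = H 1"
  shows "\<not> out_irreducible G (outer G \<beta>)"
proof -
  let ?H = "\<lambda>i::nat. \<chi> ` H i"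
  have "subgroup (H 1) G"
    using ifp by (simp add: internal_free_product_def)
  then have sub: "H 1 \<subseteq> carrier G" "\<one> \<in> H 1"
    by (simp_all add: subgroup.subset subgroup.one_closed)
  have inj: "inj_on \<chi> (carrier G)" and surj: "\<chi> ` carrier G = carrier G"
    using auto_bij[OF \<chi>] by (auto simp: bij_betw_def)
  have one: "\<chi> \<one> = \<one>"
    using hom_one[OF auto_hom[OF \<chi>] is_group is_group] .
  have "?H 1 \<noteq> {\<one>}"
  proof
    assume "?H 1 = {\<one>}"
    then have "\<chi> ` H 1 = \<chi> ` {\<one>}"
      by (simp add: one)
    then show False
      using inj_on_image_eq_iff[OF inj sub(1), of "{\<one>}"] H1(1) by simp
  qed
  moreover have "?H 1 \<noteq> carrier G"
    using inj_on_image_eq_iff[OF inj sub(1), of "carrier G"] surj H1(2) by simp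
  moreover have "out_act (outer G \<beta>) (conj_class G (?H 1)) = conj_class G (?H 1)"
  proof -
    have "\<beta> ` \<chi> ` H 1 = (\<lambda>x. \<chi> (m x)) ` H 1"
      unfolding image_image using eq sub(1) by (intro image_cong refl) (metis subsetD)
    also have "\<dots> = \<chi> ` m ` H 1"
      by (simp add: image_image)
    finally have "\<beta> ` ?H 1 = ?H 1"
      using m by simp
    moreover have "?H 1 \<subseteq> carrier G"
      using sub(1) surj by blast
    ultimately show ?thesis
      using out_act_conj_class[OF \<beta>, of "?H 1"] by simp
  qed
  moreover have "internal_free_product G {0..1} ?H"
    by (rule internal_free_product_image[OF \<chi> ifp])
  ultimately show ?thesis
    unfolding out_irreducible_def not_not
    by (intro exI[of _ "1::nat"] exI[of _ ?H]) (simp add: bij_betw_def)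
qed

end

definition petal :: "nat \<Rightarrow> letter list set" where
  "petal i = {w. reduced_word w \<and> fst ` set w \<subseteq> {i}}"

text \<open>
  The normal form of a reduced word is its decomposition into maximal powers of generators.  A
  syllable is recovered as the longest prefix in one generator.  The index map \<open>\<pi>\<close> allows for either
  generator of a free group of rank two to be the distinguished factor.
\<close>

lemma internal_free_product_petals:
  assumes \<pi>: "bij_betw \<pi> I {..<N}"
  shows "internal_free_product (free_group N) I (\<lambda>i. petal (\<pi> i))"
proof -
  interpret group "free_group N" by (rule group_free_group)
  let ?G = "free_group N" and ?H = "\<lambda>i. petal (\<pi> i)"
  let ?NF = "normal_forms ?G I ?H"
  have inj: "i = j" if "\<pi> i = \<pi> j" "i \<in> I" "j \<in> I" for i j
    using \<pi> that by (auto simp: bij_betw_def inj_on_def)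
  have lt: "\<pi> i < N" if "i \<in> I" for i
    using bij_betwE[OF \<pi>] that by auto
  have carr: "h \<in> carrier ?G" if "i \<in> I" "h \<in> petal (\<pi> i)" for i h
    using that lt[OF that(1)] by (auto simp: petal_def words_def)
  have sub: "subgroup (?H i) ?G" if i: "i \<in> I" for i
  proof (rule subgroupI)
    show "?H i \<subseteq> carrier ?G"
      using carr i by blast
    have "[] \<in> ?H i"
      by (simp add: petal_def)
    then show "?H i \<noteq> {}"
      by blast
    show "inv\<^bsub>?G\<^esub> h \<in> ?H i" if "h \<in> ?H i" for h
      using carr[OF i that] that by (auto simp: inv_free_group petal_def)
    show "h \<otimes>\<^bsub>?G\<^esub> k \<in> ?H i" if "h \<in> ?H i" "k \<in> ?H i" for h k
      using that set_reduce_word[of "h @ k"] by (fastforce simp: petal_def)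
  qed
  have NF_Cons: "(i, h) # w \<in> ?NF \<longleftrightarrow>
      i \<in> I \<and> h \<in> ?H i \<and> h \<noteq> [] \<and> w \<in> ?NF \<and> (w \<noteq> [] \<longrightarrow> fst (hd w) \<noteq> i)" for i h w
    by (cases w) (auto simp: normal_forms_def)
  let ?c = "\<lambda>w :: (_ \<times> letter list) list. concat (map snd w)"
  have NF: "reduced_word (?c w) \<and> ?c w \<in> words N \<and> nf_prod ?G w = ?c w \<and>
      (w \<noteq> [] \<longrightarrow> ?c w \<noteq> [] \<and> fst (hd (?c w)) = \<pi> (fst (hd w)) \<and> fst (hd w) \<in> I)" if "w \<in> ?NF" for w
    using that
  proof (induction w)
    case (Cons s w)
    obtain i h where s: "s = (i, h)"
      by (cases s)
    have ih: "i \<in> I" "h \<in> ?H i" "h \<noteq> []" "w \<in> ?NF" "w \<noteq> [] \<Longrightarrow> fst (hd w) \<noteq> i"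
      using Cons.prems by (auto simp: s NF_Cons)
    have IH: "reduced_word (?c w)" "?c w \<in> words N" "nf_prod ?G w = ?c w"
      "w \<noteq> [] \<Longrightarrow> ?c w \<noteq> [] \<and> fst (hd (?c w)) = \<pi> (fst (hd w)) \<and> fst (hd w) \<in> I"
      using Cons.IH[OF ih(4)] by auto
    have h: "reduced_word h" "h \<in> words N" "\<forall>x\<in>set h. fst x = \<pi> i"
      using carr[OF ih(1,2)] ih(2) by (auto simp: petal_def)
    have "fst (hd (?c w)) \<noteq> fst (last h)" if "w \<noteq> []"
      using IH(4)[OF that] h(3) ih(1,3) ih(5)[OF that] inj by auto
    then have "reduced_word (h @ ?c w)"
      using h(1) IH(1) ih(3) by (cases "w = []") (auto simp: reduced_word_append)
    moreover have "fst (hd h) = \<pi> i"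
      using h(3) ih(3) by simp
    ultimately show ?case
      using ih IH h by (simp add: s)
  qed simp
  have inj_c: "v = w" if "?c v = ?c w" "v \<in> ?NF" "w \<in> ?NF" for v w
    using that
  proof (induction v arbitrary: w)
    case Nil
    then show ?case
      using NF[of w] by force
  next
    case (Cons s v)
    obtain i h where s: "s = (i, h)"
      by (cases s)
    have "w \<noteq> []"
      using Cons.prems NF[of "s # v"] by force
    then obtain j k u where w: "w = (j, k) # u"
      by (metis list.exhaust surj_pair)
    have ih: "i \<in> I" "h \<in> ?H i" "v \<in> ?NF" "v \<noteq> [] \<Longrightarrow> fst (hd v) \<noteq> i"
      using Cons.prems(2) by (auto simp: s NF_Cons)
    have jk: "j \<in> I" "k \<in> ?H j" "u \<in> ?NF" "u \<noteq> [] \<Longrightarrow> fst (hd u) \<noteq> j"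
      using Cons.prems(3) by (auto simp: w NF_Cons)
    have "\<pi> i = \<pi> j"
      using Cons.prems(1) NF[OF Cons.prems(2)] NF[OF Cons.prems(3)] by (simp add: s w)
    then have ij: "i = j"
      using inj ih(1) jk(1) by blast
    have tw: "takeWhile (\<lambda>x. fst x = \<pi> i) (g @ ?c t) = g"
      if "g \<in> ?H i" "t \<in> ?NF" "t \<noteq> [] \<Longrightarrow> fst (hd t) \<noteq> i" for g t
    proof -
      have "takeWhile (\<lambda>x. fst x = \<pi> i) (?c t) = []"
        using NF[OF that(2)] that(3) inj ih(1) by (cases "t = []") (auto simp: takeWhile_eq_Nil_iff)
      moreover have "\<forall>x\<in>set g. fst x = \<pi> i"
        using that(1) by (auto simp: petal_def)
      ultimately show ?thesis
        by (simp add: takeWhile_append2)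
    qed
    have eq: "h @ ?c v = k @ ?c u"
      using Cons.prems(1) by (simp add: s w)
    have "h = k"
      using tw[OF ih(2,3,4)] tw[of k u] jk ij eq by simp
    then have "v = u"
      using eq Cons.IH[of u] ih(3) jk(3) by simp
    then show ?case
      using \<open>h = k\<close> ij by (simp add: s w)
  qed
  have surj_c: "\<exists>w\<in>?NF. ?c w = u" if "reduced_word u" "u \<in> words N" for u
    using that
  proof (induction u)
    case Nil
    show ?case
      by (intro bexI[of _ "[]"]) (auto simp: normal_forms_def)
  next
    case (Cons x u)
    have "reduced_word u" "u \<in> words N" "fst x < N"
      using Cons.prems by (auto simp: reduced_word_Cons)
    then obtain w where w: "w \<in> ?NF" "?c w = u"
      using Cons.IH by blast
    obtain i where i: "i \<in> I" "\<pi> i = fst x"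
      using \<pi> \<open>fst x < N\<close> by (auto simp: bij_betw_def) (metis imageE lessThan_iff)
    have single: "[x] \<in> ?H i"
      using i by (simp add: petal_def)
    show ?case
    proof (cases "w \<noteq> [] \<and> fst (hd w) = i")
      case True
      then obtain h v where wv: "w = (i, h) # v"
        by (cases w) auto
      have "reduced_word ((x # h) @ ?c v)"
        using Cons.prems(1) w(2) by (simp add: wv)
      then have "reduced_word (x # h)"
        by (simp only: reduced_word_append)
      moreover have "h \<in> ?H i"
        using w(1) unfolding wv NF_Cons by blast
      ultimately have "x # h \<in> ?H i"
        using i by (auto simp: petal_def)
      then show ?thesis
        using w by (intro bexI[of _ "(i, x # h) # v"]) (auto simp: wv NF_Cons)
    next
      case False
      then show ?thesis
        using w i single by (intro bexI[of _ "(i, [x]) # w"]) (auto simp: NF_Cons)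
    qed
  qed
  have "bij_betw (nf_prod ?G) ?NF (carrier ?G)"
    unfolding bij_betw_def
  proof
    show "inj_on (nf_prod ?G) ?NF"
      using inj_c NF by (intro inj_onI) metis
    show "nf_prod ?G ` ?NF = carrier ?G"
    proof
      show "nf_prod ?G ` ?NF \<subseteq> carrier ?G"
        using NF by auto
      show "carrier ?G \<subseteq> nf_prod ?G ` ?NF"
      proof
        fix u assume "u \<in> carrier ?G"
        then obtain w where "w \<in> ?NF" "?c w = u"
          using surj_c[of u] by auto
        then show "u \<in> nf_prod ?G ` ?NF"
          using NF[of w] by (intro image_eqI[of _ _ w]) auto
      qed
    qed
  qed
  then show ?thesis
    unfolding internal_free_product_def nf_prod_def[symmetric] using sub by blast
qed

lemma word_map_petal:
  assumes k: "k < N" and f: "f k = [(k, c)]"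
  shows "word_map N f ` petal k = petal k"
proof -
  have carr: "w \<in> words N" "reduced_word w" if "w \<in> petal k" for w
    using that k by (auto simp: petal_def words_def)
  have img: "path_image f w = (if c then w else map inv_letter w)" if "fst ` set w \<subseteq> {k}" for w
    using that by (induction w) (auto simp: path_image_Cons f inv_letter_def)
  have red: "reduced_word (map inv_letter w) \<longleftrightarrow> reduced_word w" for w
    by (simp add: reduced_word_def successively_map) (intro successively_cong refl, metis inv_letter_inv)
  have val: "word_map N f w = (if c then w else map inv_letter w)" if "w \<in> petal k" for w
    using that carr[OF that] by (simp add: word_map_apply img petal_def red)
  have inv: "map inv_letter w \<in> petal k" if "w \<in> petal k" for w
    using that by (auto simp: petal_def red)
  show ?thesis
  proof
    show "word_map N f ` petal k \<subseteq> petal k"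
      using val inv by auto
    show "petal k \<subseteq> word_map N f ` petal k"
    proof
      fix w assume w: "w \<in> petal k"
      have "w = word_map N f (if c then w else map inv_letter w)"
        using val[OF w] val[OF inv[OF w]] by (simp add: comp_def)
      then show "w \<in> word_map N f ` petal k"
        using w inv[OF w] by (metis image_eqI)
    qed
  qed
qed

lemma petal_proper:
  assumes "k < 2"
  shows "petal k \<noteq> {[]}" "petal k \<noteq> carrier F2"
proof -
  have "[(k, True)] \<in> petal k"
    by (simp add: petal_def)
  then show "petal k \<noteq> {[]}"
    by auto
  have "[(1 - k, True)] \<in> carrier F2"
    by simp
  moreover have "[(1 - k, True)] \<notin> petal k"
    using assms by (cases "k = 0") (auto simp: petal_def)
  ultimately show "petal k \<noteq> carrier F2"
    by blast
qed

text \<open>Conjugacy of classes lifts to conjugacy of automorphisms: an inner factor is absorbed in \<open>\<beta>\<close>.\<close>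

lemma conjugate_auto:
  assumes m: "m \<in> auto F2" and x: "R.conjugate x (outer F2 m)"
  obtains \<chi> \<beta> where "\<chi> \<in> auto F2" "\<beta> \<in> auto F2" "x = outer F2 \<beta>"
    "\<And>y. y \<in> carrier F2 \<Longrightarrow> \<chi> (m y) = \<beta> (\<chi> y)"
proof -
  interpret group F2 by (rule group_free_group)
  obtain X where X: "X \<in> carrier (Out F2)" "x = X \<otimes>\<^bsub>Out F2\<^esub> (outer F2 m \<otimes>\<^bsub>Out F2\<^esub> inv\<^bsub>Out F2\<^esub> X)"
    using x unfolding R.conjugate_def by blast
  obtain \<chi> where \<chi>: "\<chi> \<in> auto F2" "X = outer F2 \<chi>"
    using X(1) unfolding carrier_Out by blast
  have mc: "outer F2 m \<in> carrier (Out F2)"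
    using m by (simp add: carrier_Out)
  have xc: "x \<in> carrier (Out F2)"
    using X mc by simp
  then obtain \<beta>0 where \<beta>0: "\<beta>0 \<in> auto F2" "x = outer F2 \<beta>0"
    unfolding carrier_Out by blast
  have "x \<otimes>\<^bsub>Out F2\<^esub> X = X \<otimes>\<^bsub>Out F2\<^esub> outer F2 m"
    using X(1) mc by (simp add: X(2) R.m_assoc del: free_group_sel)
  then have "outer F2 (compose (carrier F2) \<beta>0 \<chi>) = outer F2 (compose (carrier F2) \<chi> m)"
    by (simp only: \<chi>(2) \<beta>0(2) outer_mult[OF \<beta>0(1) \<chi>(1)] outer_mult[OF \<chi>(1) m])
  then have "compose (carrier F2) \<chi> m \<in> outer F2 (compose (carrier F2) \<beta>0 \<chi>)"
    using outer_self[OF auto_compose[OF \<chi>(1) m]] by simp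
  then obtain g where g: "g \<in> carrier F2"
      "compose (carrier F2) \<chi> m = compose (carrier F2) (inner_aut F2 g) (compose (carrier F2) \<beta>0 \<chi>)"
    unfolding outer_def2[OF auto_compose[OF \<beta>0(1) \<chi>(1)]] by blast
  let ?\<beta> = "compose (carrier F2) (inner_aut F2 g) \<beta>0"
  have \<beta>: "?\<beta> \<in> outer F2 \<beta>0"
    using g(1) unfolding outer_def2[OF \<beta>0(1)] by blast
  show ?thesis
  proof (rule that[OF \<chi>(1) outer_memD[OF \<beta>0(1) \<beta>]])
    show "x = outer F2 ?\<beta>"
      by (simp only: \<beta>0(2) outer_eqI[OF \<beta>0(1) \<beta>])
    show "\<chi> (m y) = ?\<beta> (\<chi> y)" if "y \<in> carrier F2" for y
      using fun_cong[OF g(2), of y] that auto_closed[OF \<chi>(1) that]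
      by (simp add: compose_def del: free_group_sel)
  qed
qed

lemma not_out_irreducible_fixed_generator:
  assumes f: "word_map 2 f \<in> auto F2" and x: "R.conjugate x (out_map f)" and k: "k < 2" "f k = [(k, c)]"
  shows "\<not> out_irreducible F2 x"
proof -
  interpret group F2 by (rule group_free_group)
  obtain \<chi> \<beta> where \<chi>: "\<chi> \<in> auto F2" "\<beta> \<in> auto F2" "x = outer F2 \<beta>"
      "\<And>y. y \<in> carrier F2 \<Longrightarrow> \<chi> (word_map 2 f y) = \<beta> (\<chi> y)"
    by (rule conjugate_auto[OF f x], rule that)
  define \<pi> :: "nat \<Rightarrow> nat" where "\<pi> i = (if k = 1 then i else 1 - i)" for i
  have "bij_betw \<pi> {0..1} {..<2}"
    by (rule bij_betw_byWitness[where f' = \<pi>]) (auto simp: \<pi>_def)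
  then have ifp: "internal_free_product F2 {0..1} (\<lambda>i. petal (\<pi> i))"
    by (rule internal_free_product_petals)
  have "\<pi> 1 = k"
    using k(1) by (auto simp: \<pi>_def)
  then show ?thesis
    unfolding \<chi>(3)
    using petal_proper[OF k(1)] word_map_petal[where f = f, OF k]
    by (intro not_out_irreducible_conjugate[OF \<chi>(1,2) \<chi>(4) ifp]) simp_all
qed



section \<open>Stretch factors in rank two\<close>

text \<open>
  The positive automorphism that represents the product \<open>R.val w\<close>; \<open>transvect\<close> is \<open>a \<mapsto> ab\<close>, and the
  other generator is \<open>b \<mapsto> ba\<close>.
\<close>

definition transvect2 :: "nat \<Rightarrow> letter list" where
  "transvect2 = on_gens [(0, True)] [(1, True), (0, True)]"

fun word_auto :: "bool list \<Rightarrow> nat \<Rightarrow> letter list" where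
  "word_auto [] i = [(i, True)]"
| "word_auto (b # w) i = path_image (if b then transvect else transvect2) (word_auto w i)"

fun tail_auto :: "bool \<Rightarrow> bool \<Rightarrow> nat \<Rightarrow> letter list" where
  "tail_auto j i n = [(if j then 1 - n else n, \<not> i)]"

definition full_auto :: "bool list \<Rightarrow> bool \<Rightarrow> bool \<Rightarrow> nat \<Rightarrow> letter list" where
  "full_auto w j i n = path_image (word_auto w) (tail_auto j i n)"

lemma transvect2_words: "i < 2 \<Longrightarrow> transvect2 i \<in> words 2"
  by (auto simp: less_2_iff transvect2_def compute_words)

lemma word_auto_words: "n < 2 \<Longrightarrow> word_auto w n \<in> words 2"
  by (induction w) (auto intro!: path_image_words[where N = 2 and M = 2] F2_gens_words transvect2_words)

lemma tail_auto_words: "n < 2 \<Longrightarrow> tail_auto j i n \<in> words 2"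
  by auto

lemma out_map_gen:
  "word_map 2 (if b then transvect else transvect2) \<in> auto F2 \<and>
    out_map (if b then transvect else transvect2) = R.gen b"
proof (cases b)
  case False
  note mult = out_map_mult F2_autos F2_gens_words path_image_words[where N = 2 and M = 2]
  have eq: "word_map 2 transvect2 = word_map 2 (\<lambda>i. path_image swap_gens (path_image transvect (swap_gens i)))"
    by (rule word_map_eqI) (auto simp: less_2_iff transvect2_def compute_words)
  have "word_map 2 (\<lambda>i. path_image swap_gens (path_image transvect (swap_gens i))) \<in> auto F2 \<and>
    out_map (\<lambda>i. path_image swap_gens (path_image transvect (swap_gens i))) = R.f"
    unfolding R.f_def by (simp add: mult)
  then show ?thesis
    using False by (simp add: R.gen_def eq)
qed (simp add: R.gen_def F2_autos)

lemma out_map_word_auto: "word_map 2 (word_auto w) \<in> auto F2 \<and> out_map (word_auto w) = R.val w"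
proof (induction w)
  case Nil
  have "word_map 2 (word_auto []) = word_map 2 (\<lambda>i. [(i, True)])"
    by (rule word_map_eqI) simp
  then show ?case
    using id_auto out_map_one by simp
next
  case (Cons b w)
  let ?g = "if b then transvect else transvect2"
  have "word_map 2 (word_auto (b # w)) = word_map 2 (\<lambda>i. path_image ?g (word_auto w i))"
    by (rule word_map_eqI) simp
  moreover note out_map_mult[of ?g "word_auto w"] out_map_gen[of b] Cons.IH word_auto_words
  ultimately show ?case
    by (metis R.val_simps(2))
qed

lemma out_map_tail_auto: "word_map 2 (tail_auto j i) \<in> auto F2 \<and> out_map (tail_auto j i) = R.tailpart j False i"
proof -
  note mult = out_map_mult F2_autos F2_gens_words path_image_words[where N = 2 and M = 2]
  let ?i = "\<lambda>n. path_image invert_gen (path_image swap_gens (path_image invert_gen (swap_gens n)))"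
  let ?si = "\<lambda>n. path_image swap_gens (?i n)"
  have i: "word_map 2 ?i \<in> auto F2 \<and> out_map ?i = R.\<iota>"
    unfolding R.\<iota>_def by (simp add: mult)
  have si: "word_map 2 ?si \<in> auto F2 \<and> out_map ?si = out_map swap_gens \<otimes>\<^bsub>Out F2\<^esub> R.\<iota>"
    unfolding R.\<iota>_def by (simp add: mult)
  have "word_map 2 (tail_auto False False) = word_map 2 (\<lambda>i. [(i, True)])"
    by (rule word_map_eqI) simp
  moreover have "word_map 2 (tail_auto True False) = word_map 2 swap_gens"
    by (rule word_map_eqI) (auto simp: less_2_iff compute_words)
  moreover have "word_map 2 (tail_auto False True) = word_map 2 ?i"
    by (rule word_map_eqI) (auto simp: less_2_iff compute_words)
  moreover have "word_map 2 (tail_auto True True) = word_map 2 ?si"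
    by (rule word_map_eqI) (auto simp: less_2_iff compute_words)
  ultimately show ?thesis
    using i si id_auto out_map_one[symmetric] F2_autos by (cases i; cases j) (simp_all add: R.tailpart_def)
qed

lemma out_map_full_auto:
  "word_map 2 (full_auto w j i) \<in> auto F2" "out_map (full_auto w j i) = R.val w \<otimes>\<^bsub>Out F2\<^esub> R.tailpart j False i"
proof -
  have "full_auto w j i = (\<lambda>n. path_image (word_auto w) (tail_auto j i n))"
    by (simp add: full_auto_def fun_eq_iff)
  then show "word_map 2 (full_auto w j i) \<in> auto F2" "out_map (full_auto w j i) = R.val w \<otimes>\<^bsub>Out F2\<^esub> R.tailpart j False i"
    using out_map_mult[of "word_auto w" "tail_auto j i"] out_map_word_auto[of w] out_map_tail_auto[of j i]
      tail_auto_words by metis+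
qed

lemma full_auto_eq:
  "full_auto w j i n = (let u = word_auto w (if j then 1 - n else n) in if i then inv_word u else u)"
  by (simp add: full_auto_def path_image_Cons Let_def)

lemma word_auto_positive: "x \<in> set (word_auto w n) \<Longrightarrow> snd x"
proof (induction w arbitrary: x)
  case (Cons b w)
  then show ?case
    by (fastforce simp: path_image_def transvect2_def compute_words split: if_splits)
qed simp

lemma word_auto_nonempty: "word_auto w n \<noteq> []"
proof (induction w)
  case (Cons b w)
  have "path_image (if b then transvect else transvect2) u \<noteq> []" if "u \<noteq> []" for u
    using that by (cases u) (auto simp: path_image_Cons transvect2_def compute_words inv_word_def)
  then show ?case
    using Cons by simp
qed simp

lemma reduced_word_same_sign: "\<forall>x\<in>set w. snd x = c \<Longrightarrow> reduced_word w"
proof (induction w)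
  case (Cons x w)
  then show ?case
    by (cases w) (auto simp: reduced_word_Cons inv_letter_def)
qed simp

lemma full_auto_sign: "x \<in> set (full_auto w j i n) \<Longrightarrow> snd x = (\<not> i)"
  using word_auto_positive by (auto simp: full_auto_eq Let_def inv_letter_def split: if_splits)

lemma full_auto_valid:
  assumes "n < 2"
  shows "full_auto w j i n \<in> words 2 \<and> full_auto w j i n \<noteq> [] \<and> reduced_word (full_auto w j i n)"
  using assms word_auto_words[of _ w] word_auto_nonempty[of w]
    reduced_word_same_sign[of "full_auto w j i n" "\<not> i"] full_auto_sign[of _ w j i n]
  by (auto simp: full_auto_eq Let_def)

lemma full_auto_train_track: "train_track (rose 2) (full_auto w j i)"
proof (rule train_track_roseI[where P = "\<lambda>u. \<exists>c. \<forall>x\<in>set u. snd x = c"])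
  show "\<exists>c. \<forall>x\<in>set (path_image (full_auto w j i) u). snd x = c" if same: "\<exists>c. \<forall>x\<in>set u. snd x = c" for u
  proof -
    obtain c where c: "\<forall>x\<in>set u. snd x = c"
      using same by (elim exE)
    have "snd x = (c \<noteq> i)" if x: "x \<in> set (path_image (full_auto w j i) u)" for x
    proof -
      obtain l where l: "l \<in> set u" "x \<in> set (if snd l then full_auto w j i (fst l) else inv_word (full_auto w j i (fst l)))"
        using x unfolding path_image_def by auto
      show ?thesis
      proof (cases "snd l")
        case True
        then show ?thesis
          using l c full_auto_sign[of x w j i "fst l"] by auto
      next
        case False
        then obtain y where "y \<in> set (full_auto w j i (fst l))" "x = inv_letter y"
          using l(2) by auto
        then show ?thesis
          using False l(1) c full_auto_sign[of y w j i "fst l"] by (auto simp: inv_letter_def)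
      qed
    qed
    then show ?thesis
      by (intro exI[of _ "c \<noteq> i"] ballI)
  qed
  show "reduced_word u" if same: "\<exists>c. \<forall>x\<in>set u. snd x = c" for u
  proof -
    obtain c where "\<forall>x\<in>set u. snd x = c"
      using same by (elim exE)
    then show ?thesis
      by (rule reduced_word_same_sign)
  qed
  show "\<exists>c. \<forall>x\<in>set [(n, True)]. snd x = c" for n :: nat
    by (intro exI[of _ True]) simp
  show "full_auto w j i n \<in> words 2" if "n < 2" for n
    using full_auto_valid[OF that] by (rule conjunct1)
qed

text \<open>
  The transition matrix of \<open>word_auto w\<close>, read off row by row: the two generators act by elementary
  row operations.
\<close>

fun word_mat :: "bool list \<Rightarrow> nat \<times> nat \<times> nat \<times> nat" where
  "word_mat [] = (1, 0, 0, 1)"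
| "word_mat (b # w) =
    (case word_mat w of (p, q, r, t) \<Rightarrow> if b then (p, q, r + p, t + q) else (p + r, q + t, r, t))"

lemma edge_count_word_auto:
  "word_mat w = (edge_count (word_auto w 0) 0, edge_count (word_auto w 1) 0,
    edge_count (word_auto w 0) 1, edge_count (word_auto w 1) 1)"
proof (induction w)
  case (Cons b w)
  have "edge_count (path_image (if b then transvect else transvect2) u) 0
      = (if b then edge_count u 0 else edge_count u 0 + edge_count u 1) \<and>
    edge_count (path_image (if b then transvect else transvect2) u) 1
      = (if b then edge_count u 1 + edge_count u 0 else edge_count u 1)" if "u \<in> words 2" for u
    using that
    by (induction u) (auto simp: less_2_iff path_image_Cons transvect2_def compute_words inv_word_def)
  from this[OF word_auto_words[of 0 w]] this[OF word_auto_words[of 1 w]] show ?case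
    by (simp add: Cons.IH)
qed simp

text \<open>
  Reading the word backwards multiplies by the same elementary matrices from the other side, which
  transposes the matrix about its antidiagonal; exchanging the two letters conjugates it by the
  permutation matrix.  Both preserve trace and determinant.
\<close>

lemma word_mat_snoc:
  "word_mat (w @ [b]) =
    (case word_mat w of (p, q, r, t) \<Rightarrow> if b then (p + q, q, r + t, t) else (p, p + q, r, r + t))"
  by (induction w) (auto split: prod.splits)

lemma word_mat_rev: "word_mat (rev w) = (case word_mat w of (p, q, r, t) \<Rightarrow> (t, q, r, p))"
  by (induction w) (auto simp: word_mat_snoc split: prod.splits)

lemma word_mat_Not: "word_mat (map Not w) = (case word_mat w of (p, q, r, t) \<Rightarrow> (t, r, q, p))"
  by (induction w) (auto split: prod.splits)

lemma word_mat_det: "word_mat w = (p, q, r, t) \<Longrightarrow> p * t = q * r + 1 \<and> 0 < p \<and> 0 < t"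
  by (induction w arbitrary: p q r t) (auto split: prod.splits if_splits simp: algebra_simps)

lemma word_auto_fixed_generator:
  "word_mat w = (p, 0, r, t) \<Longrightarrow> word_auto w 1 = [(1, True)]"
  "word_mat w = (p, q, 0, t) \<Longrightarrow> word_auto w 0 = [(0, True)]"
proof (induction w arbitrary: p q r t)
  case (Cons b w)
  {
    case 1
    with Cons.IH(1) word_mat_det[of w] show ?case
      by (auto split: prod.splits if_splits simp: path_image_Cons transvect_def on_gens_def)
  next
    case 2
    with Cons.IH(2) word_mat_det[of w] show ?case
      by (auto split: prod.splits if_splits simp: path_image_Cons transvect2_def on_gens_def)
  }
qed simp_all

text \<open>
  The larger root \<open>l\<close> of the characteristic polynomial exceeds \<open>p\<close>, so the eigenvector \<open>(q, l - p)\<close> is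
  positive.
\<close>

lemma PF_eigenvalue_rose_two:
  fixes p q r t :: real
  assumes "q > 0" "r > 0"
    and f: "real (edge_count (f 0) 0) = p" "real (edge_count (f 1) 0) = q"
      "real (edge_count (f 0) 1) = r" "real (edge_count (f 1) 1) = t"
  shows "PF_eigenvalue (transition_matrix (rose 2) f) ((p + t + sqrt ((p + t)\<^sup>2 - 4 * (p * t - q * r))) / 2)"
proof -
  define S where "S = sqrt ((p + t)\<^sup>2 - 4 * (p * t - q * r))"
  have disc: "(p + t)\<^sup>2 - 4 * (p * t - q * r) = (p - t)\<^sup>2 + 4 * (q * r)"
    by (simp add: power2_eq_square algebra_simps)
  have pos: "q * r > 0"
    using assms by simp
  have "sqrt ((p - t)\<^sup>2) < S"
    unfolding S_def disc using pos by (intro real_sqrt_less_mono) linarith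
  then have S: "p - t < S"
    by simp
  have "S\<^sup>2 = (p - t)\<^sup>2 + 4 * (q * r)"
    unfolding S_def disc using pos by (intro real_sqrt_pow2) (simp add: add_nonneg_nonneg)
  then have root: "r * q + t * ((p + t + S) / 2 - p) = (p + t + S) / 2 * ((p + t + S) / 2 - p)"
    by (simp add: power2_eq_square field_simps)
  have "PF_eigenvalue (transition_matrix (rose 2) f) ((p + t + S) / 2)"
  proof (rule PF_eigenvalue_roseI[where w = "\<lambda>i. if i = 0 then q else (p + t + S) / 2 - p"])
    fix i :: nat assume "i < 2"
    then consider "i = 0" | "i = 1"
      by linarith
    then show "(\<Sum>j<2. real (edge_count (f j) i) * (if j = 0 then q else (p + t + S) / 2 - p))
        = (p + t + S) / 2 * (if i = 0 then q else (p + t + S) / 2 - p)"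
      using f root by cases (simp_all add: numeral_2_eq_2 algebra_simps)
  qed (use S assms in \<open>auto simp: field_simps\<close>)
  then show ?thesis
    by (simp add: S_def)
qed

text \<open>
  The map on the rose is a train track map because all letters of an image have the same sign.
  Conjugating the class only changes the marking.  Composition with the exchange of the generators
  (\<open>j\<close>) swaps the columns of the matrix: the trace becomes \<open>q + r\<close> and the determinant \<open>-1\<close>.
\<close>

lemma stretch_factor_full_auto:
  assumes x: "R.conjugate x (R.val w \<otimes>\<^bsub>Out F2\<^esub> R.tailpart j False i)" and w: "word_mat w = (p, q, r, t)"
    and pos: "j \<or> 0 < q \<and> 0 < r"
  shows "stretch_factor 2 x = ((if j then real (q + r) else real (p + t)) +
    sqrt ((if j then real (q + r) else real (p + t))\<^sup>2 - 4 * (if j then - 1 else 1))) / 2"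
proof -
  let ?f = "full_auto w j i"
  interpret group F2 by (rule group_free_group)
  note m = out_map_full_auto(1)[of w j i]
  have x': "R.conjugate x (out_map ?f)"
    using x by (simp only: out_map_full_auto(2))
  obtain \<chi> \<beta> where \<chi>: "\<chi> \<in> auto F2" "\<beta> \<in> auto F2" "x = outer F2 \<beta>"
      "\<And>y. y \<in> carrier F2 \<Longrightarrow> \<chi> (word_map 2 ?f y) = \<beta> (\<chi> y)"
    by (rule conjugate_auto[OF m x'], rule that)
  obtain \<tau> where \<tau>: "\<tau> \<in> auto F2" "\<And>y. y \<in> carrier F2 \<Longrightarrow> \<tau> (\<chi> y) = y" "\<And>y. y \<in> carrier F2 \<Longrightarrow> \<chi> (\<tau> y) = y"
    by (rule auto_inverse[OF \<chi>(1)], rule that)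
  have marked: "\<tau> (\<beta> y) = word_map 2 ?f (\<tau> y)" if "y \<in> carrier F2" for y
    using \<chi>(4)[OF auto_closed[OF \<tau>(1) that]] \<tau>(2)[OF auto_closed[OF m auto_closed[OF \<tau>(1) that]]] \<tau>(3)[OF that]
    by simp
  have det: "p * t = q * r + 1" "0 < p" "0 < t"
    using word_mat_det[OF w] by auto
  have cnt: "edge_count (word_auto w 0) 0 = p" "edge_count (word_auto w 1) 0 = q"
    "edge_count (word_auto w 0) 1 = r" "edge_count (word_auto w 1) 1 = t"
    using edge_count_word_auto[of w] w by simp_all
  have inv_cnt: "edge_count (inv_word u) k = edge_count u k" for u k
    by (induction u) auto
  have irr: "irreducible_mat (transition_matrix (rose 2) ?f)"
    using pos det(2,3) by (intro irreducible_roseI disjI1) (auto simp: less_2_iff full_auto_eq Let_def inv_cnt cnt cnt[unfolded One_nat_def])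
  have detr: "real p * real t = real q * real r + 1"
    using arg_cong[OF det(1), of real] by simp
  have "PF_eigenvalue (transition_matrix (rose 2) ?f)
    (((if j then real (q + r) else real (p + t)) +
    sqrt ((if j then real (q + r) else real (p + t))\<^sup>2 - 4 * (if j then - 1 else 1))) / 2)"
  proof (cases j)
    case True
    have "PF_eigenvalue (transition_matrix (rose 2) ?f)
        ((real q + real r + sqrt ((real q + real r)\<^sup>2 - 4 * (real q * real r - real p * real t))) / 2)"
      using det(2,3) True by (intro PF_eigenvalue_rose_two) (simp_all add: full_auto_eq Let_def inv_cnt cnt cnt[unfolded One_nat_def])
    then show ?thesis
      using True detr by simp
  next
    case False
    have "PF_eigenvalue (transition_matrix (rose 2) ?f)
        ((real p + real t + sqrt ((real p + real t)\<^sup>2 - 4 * (real p * real t - real q * real r))) / 2)"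
      using pos False by (intro PF_eigenvalue_rose_two) (simp_all add: full_auto_eq Let_def inv_cnt cnt cnt[unfolded One_nat_def])
    then show ?thesis
      using False detr by simp
  qed
  then show ?thesis
    unfolding \<chi>(3)
    by (intro stretch_factor_rose[OF _ \<chi>(2) \<tau>(1) full_auto_valid marked full_auto_train_track irr]) simp_all
qed

text \<open>
  A fully irreducible class has infinite order, so it is conjugate to a positive automorphism,
  possibly composed with the inversion of both generators.  Its inverse is then conjugate to one
  whose matrix has the same trace and determinant.  Both off-diagonal entries are positive, since
  otherwise a generator would be fixed up to inversion.
\<close>

lemma stretch_factor_inverse_rank_two:
  assumes \<phi>: "\<phi> \<in> carrier (Out F2)" and irr: "out_fully_irreducible F2 \<phi>"
  shows "stretch_factor 2 (inv\<^bsub>Out F2\<^esub> \<phi>) = stretch_factor 2 \<phi>"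
proof -
  interpret group F2 by (rule group_free_group)
  have span: "\<phi> \<in> R.spanned"
    using \<phi> all_spanned unfolding carrier_Out by blast
  have irr1: "out_irreducible F2 \<phi>"
    using irr[unfolded out_fully_irreducible_def, rule_format, of 1] \<phi> by simp
  have not_fixed: "f k \<noteq> [(k, c)]" if "word_map 2 f \<in> auto F2" "R.conjugate \<phi> (out_map f)" "k < 2" for f k c
    using not_out_irreducible_fixed_generator[OF that] irr1 by blast
  have "\<phi> [^]\<^bsub>Out F2\<^esub> (12::nat) \<noteq> \<one>\<^bsub>Out F2\<^esub>"
  proof
    assume one: "\<phi> [^]\<^bsub>Out F2\<^esub> (12::nat) = \<one>\<^bsub>Out F2\<^esub>"
    have "\<not> out_irreducible F2 \<one>\<^bsub>Out F2\<^esub>"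
      using R.conjugate_refl[OF R.one_closed]
      by (intro not_out_irreducible_fixed_generator[OF id_auto, where k = 0]) (simp_all only: out_map_one pos2)
    moreover have "out_irreducible F2 (\<phi> [^]\<^bsub>Out F2\<^esub> (12::nat))"
      using irr[unfolded out_fully_irreducible_def, rule_format, of 12] by simp
    ultimately show False
      by (simp only: one)
  qed
  then obtain w j i where c: "R.conjugate \<phi> (R.val w \<otimes>\<^bsub>Out F2\<^esub> R.tailpart j False i)"
    using R.conjugate_positive[OF span] by blast
  let ?y = "R.val w \<otimes>\<^bsub>Out F2\<^esub> R.tailpart j False i"
  obtain X where X: "X \<in> carrier (Out F2)" "\<phi> = X \<otimes>\<^bsub>Out F2\<^esub> (?y \<otimes>\<^bsub>Out F2\<^esub> inv\<^bsub>Out F2\<^esub> X)"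
    using c unfolding R.conjugate_def by blast
  have yc: "?y \<in> carrier (Out F2)"
    by simp
  have "inv\<^bsub>Out F2\<^esub> \<phi> = X \<otimes>\<^bsub>Out F2\<^esub> (inv\<^bsub>Out F2\<^esub> ?y \<otimes>\<^bsub>Out F2\<^esub> inv\<^bsub>Out F2\<^esub> X)"
    unfolding X(2) using X(1) yc by (simp add: R.inv_mult_group R.m_assoc del: free_group_sel)
  then have "R.conjugate (inv\<^bsub>Out F2\<^esub> \<phi>) (inv\<^bsub>Out F2\<^esub> ?y)"
    using X(1) unfolding R.conjugate_def by blast
  then have c': "R.conjugate (inv\<^bsub>Out F2\<^esub> \<phi>)
      (R.val (map (\<lambda>b. b \<noteq> j) (rev w)) \<otimes>\<^bsub>Out F2\<^esub> R.tailpart j False (i \<noteq> j))"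
    by (rule R.conjugate_trans[OF _ _ R.conjugate_inverse, rotated]) simp
  obtain p q r t where w: "word_mat w = (p, q, r, t)"
    by (cases "word_mat w")
  have pos: "j \<or> 0 < q \<and> 0 < r"
  proof (rule ccontr)
    assume neg: "\<not> (j \<or> 0 < q \<and> 0 < r)"
    have cf: "R.conjugate \<phi> (out_map (full_auto w j i))"
      using c by (simp only: out_map_full_auto(2))
    have "q = 0 \<or> r = 0"
      using neg by auto
    then obtain k where "k < 2" "word_auto w k = [(k, True)]"
      using word_auto_fixed_generator w by (metis one_less_numeral_iff pos2 semiring_norm(76))
    then have "full_auto w j i k = [(k, \<not> i)]"
      using neg by (auto simp: full_auto_eq Let_def inv_letter_def)
    then show False
      using not_fixed[OF out_map_full_auto(1) cf \<open>k < 2\<close>] by blast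
  qed
  have w': "word_mat (map (\<lambda>b. b \<noteq> j) (rev w)) = (if j then (p, r, q, t) else (t, q, r, p))"
  proof (cases j)
    case True
    then have "map (\<lambda>b. b \<noteq> j) (rev w) = map Not (rev w)"
      by simp
    then show ?thesis
      using True by (simp only: word_mat_Not word_mat_rev w) simp
  next
    case False
    then have "map (\<lambda>b. b \<noteq> j) (rev w) = rev w"
      by (simp add: map_idI)
    then show ?thesis
      using False by (simp add: word_mat_rev w)
  qed
  show ?thesis
  proof (cases j)
    case True
    then show ?thesis
      using stretch_factor_full_auto[OF c w] stretch_factor_full_auto[OF c', of p r q t] w'
      by (simp add: add.commute)
  next
    case False
    then show ?thesis
      using stretch_factor_full_auto[OF c w] stretch_factor_full_auto[OF c', of t q r p] w' pos
      by (simp add: add.commute)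
  qed
qed

theorem theorem3:
  fixes N :: nat
  assumes "N \<ge> 1"
  shows "(\<exists>\<phi> :: nat \<Rightarrow> (letter list \<Rightarrow> letter list) set.
            (\<forall>k. \<phi> k \<in> carrier (Out (free_group N)) \<and>
                 out_fully_irreducible (free_group N) (\<phi> k) \<and>
                 out_spectral_ratio_defined N (\<phi> k) \<and>
                 out_spectral_ratio_defined N (inv\<^bsub>Out (free_group N)\<^esub> (\<phi> k))) \<and>
            filterlim (\<lambda>k. out_spectral_ratio N (\<phi> k)) at_top sequentially \<and>
            (\<lambda>k. out_spectral_ratio N (inv\<^bsub>Out (free_group N)\<^esub> (\<phi> k))) \<longlonglongrightarrow> 1)
         \<longleftrightarrow> N \<ge> 3"
proof
  assume "N \<ge> 3"
  then show "\<exists>\<phi> :: nat \<Rightarrow> (letter list \<Rightarrow> letter list) set.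
            (\<forall>k. \<phi> k \<in> carrier (Out (free_group N)) \<and>
                 out_fully_irreducible (free_group N) (\<phi> k) \<and>
                 out_spectral_ratio_defined N (\<phi> k) \<and>
                 out_spectral_ratio_defined N (inv\<^bsub>Out (free_group N)\<^esub> (\<phi> k))) \<and>
            filterlim (\<lambda>k. out_spectral_ratio N (\<phi> k)) at_top sequentially \<and>
            (\<lambda>k. out_spectral_ratio N (inv\<^bsub>Out (free_group N)\<^esub> (\<phi> k))) \<longlonglongrightarrow> 1"
    by (rule family_exists)
next
  assume "\<exists>\<phi> :: nat \<Rightarrow> (letter list \<Rightarrow> letter list) set.
            (\<forall>k. \<phi> k \<in> carrier (Out (free_group N)) \<and>
                 out_fully_irreducible (free_group N) (\<phi> k) \<and>
                 out_spectral_ratio_defined N (\<phi> k) \<and>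
                 out_spectral_ratio_defined N (inv\<^bsub>Out (free_group N)\<^esub> (\<phi> k))) \<and>
            filterlim (\<lambda>k. out_spectral_ratio N (\<phi> k)) at_top sequentially \<and>
            (\<lambda>k. out_spectral_ratio N (inv\<^bsub>Out (free_group N)\<^esub> (\<phi> k))) \<longlonglongrightarrow> 1"
  then show "N \<ge> 3"
  proof (elim exE conjE)
    fix \<phi> :: "nat \<Rightarrow> (letter list \<Rightarrow> letter list) set"
    assume all: "\<forall>k. \<phi> k \<in> carrier (Out (free_group N)) \<and>
                   out_fully_irreducible (free_group N) (\<phi> k) \<and>
                   out_spectral_ratio_defined N (\<phi> k) \<and>
                   out_spectral_ratio_defined N (inv\<^bsub>Out (free_group N)\<^esub> (\<phi> k))"
      and large: "filterlim (\<lambda>k. out_spectral_ratio N (\<phi> k)) at_top sequentially"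
      and small: "(\<lambda>k. out_spectral_ratio N (inv\<^bsub>Out (free_group N)\<^esub> (\<phi> k))) \<longlonglongrightarrow> 1"
    have \<phi>: "\<phi> k \<in> carrier (Out (free_group N))" "out_fully_irreducible (free_group N) (\<phi> k)"
        "out_spectral_ratio_defined N (\<phi> k)" for k
      using all[rule_format, of k] by (simp_all only: simp_thms)
    have "N \<noteq> 1"
      using rank_one_no_spectral_ratio[of "\<phi> 0"] \<phi>(1,3)[of 0] by auto
    moreover have "N \<noteq> 2"
    proof
      assume N: "N = 2"
      have eq: "out_spectral_ratio N (inv\<^bsub>Out (free_group N)\<^esub> (\<phi> k)) = out_spectral_ratio N (\<phi> k)" for k
        using stretch_factor_inverse_rank_two \<phi>(1,2)[of k] by (simp only: N out_spectral_ratio_def)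
      have "eventually (\<lambda>k. out_spectral_ratio N (\<phi> k) < 2) sequentially"
        using small unfolding eq by (rule order_tendstoD) simp
      moreover have "eventually (\<lambda>k. 2 \<le> out_spectral_ratio N (\<phi> k)) sequentially"
        using large by (simp only: filterlim_at_top)
      ultimately have "eventually (\<lambda>k. False) sequentially"
        by eventually_elim simp
      then show False
        by simp
    qed
    ultimately show "N \<ge> 3"
      using assms by linarith
  qed
qed

end
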